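(* Consider the CMC hierarchy, that is, the system consisting of the following two groups of structure equations (all the notation is defined in the context). (A) $$d\xi-\mathrm{i}\rho\wedge\xi=\sum_{m\ge1}a^{2m+3}\,dt_m\wedge\xi,\qquad d\bar\xi+\mathrm{i}\rho\wedge\bar\xi=\sum_{m\ge1}\bar a^{2m+3}\,d\bar t_m\wedge\bar\xi,$$ $$d\rho\equiv R\,\tfrac{\mathrm{i}}{2}\,\xi\wedge\bar\xi \mod dt_m,\,d\bar t_m\ (m\ge1),\qquad R=\gamma^2-h_2\bar h_2,$$ $$dh_2+2\mathrm{i}h_2\rho=h_3\xi-2\sum_{m\ge1}h_2a^{2m+3}dt_m,\qquad d\bar h_2-2\mathrm{i}\bar h_2\rho=\bar h_3\bar\xi-2\sum_{m\ge1}\bar h_2\bar a^{2m+3}d\bar t_m,$$ where the complete expression for $d\rho$ (including its $dt_m$, $d\bar t_m$ terms) is the one given by the $\lambda$-degree $0$ part of $d\boldsymbol\phi+\boldsymbol\phi\wedge\boldsymbol\phi=0$, i.e. by $d\phi_0+(\boldsymbol\phi_+\wedge\boldsymbol\phi_-+\boldsymbol\phi_-\wedge\boldsymbol\phi_+)_0=0$. (C) $$d\mathbf Y+[\boldsymbol\phi,\mathbf Y]=0,\qquad d(-\bar{\mathbf Y}^t)+[\boldsymbol\phi,(-\bar{\mathbf Y}^t)]=0.$$ Then the system (A), (C) is compatible: the identity $d^2=0$ is a formal consequence of these structure equations.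
   Context: Everything is formal. Let $\gamma$ be a real constant with $\gamma^2>0$ and $\mathrm i=\sqrt{-1}$. **Original CMC structure equations.** On the infinite jet space of the (complexified) CMC system one has scalar functions $h_j,\bar h_j$ ($j\ge2$), treated as independent, with $h_2,\bar h_2\ne0$ and chosen square roots $h_2^{1/2},\bar h_2^{1/2}$, and 1-forms $\xi,\bar\xi,\rho$ satisfying (modulo the differential ideal of the jet space) $$d\xi=\mathrm i\rho\wedge\xi,\quad d\bar\xi=-\mathrm i\rho\wedge\bar\xi,\quad d\rho=R\tfrac{\mathrm i}{2}\xi\wedge\bar\xi,\quad R=\gamma^2-h_2\bar h_2,\quad dh_j+\mathrm i jh_j\rho=h_{j+1}\xi+T_j\bar\xi,$$ and the formal conjugates of these, where $T_2=0$, $T_{j+1}=\sum_{s=0}^{j-2}\frac{j+s+2}{2j}\binom{j}{s+2}h_{j-s}(\delta_{0s}\gamma^2-h_{2+s}\bar h_2)$ for $j\ge2$. Put $z_j=h_2^{-j/2}h_j$ ($j\ge3$). **Formal complex conjugation** (overline): the multiplicative, conjugate-linear operation ($\mathrm i\mapsto-\mathrm i$, $\gamma\mapsto\gamma$) with $\lambda^{\pm1}\mapsto\lambda^{\mp1}$, $h_j\leftrightarrow\bar h_j$, $t_m\leftrightarrow\bar t_m$, $\xi\leftrightarrow\bar\xi$, $\rho\mapsto\rho$. Superscript $t$ is transpose. **Canonical formal Killing field.** Let $$\phi_\lambda=\begin{pmatrix}\frac{\mathrm i}{2}\rho&-\frac{\lambda}{2}\gamma\bar\xi-\frac{\lambda^{-1}}{2}h_2\xi\\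 \frac{\lambda}{2}\bar h_2\bar\xi+\frac{\lambda^{-1}}{2}\gamma\xi&-\frac{\mathrm i}{2}\rho\end{pmatrix},\quad \phi_0=\begin{pmatrix}\frac{\mathrm i}{2}\rho&0\\0&-\frac{\mathrm i}{2}\rho\end{pmatrix}.$$ The canonical formal Killing field is $$\mathbf Y=\begin{pmatrix}-\mathrm i\mathbf a&2\mathbf c\\2\mathbf b&\mathrm i\mathbf a\end{pmatrix},\quad \mathbf a=\sum_{n\ge0}\lambda^{2n}a^{2n+1},\ \mathbf b=\sum_{n\ge0}\lambda^{2n+1}b^{2n+2},\ \mathbf c=\sum_{n\ge0}\lambda^{2n+1}c^{2n+2}$$ (superscripts on $a,b,c$ are indices), determined by $a^1=0$, $b^2=-\mathrm i\gamma h_2^{-1/2}$, $c^2=\mathrm ih_2^{1/2}$, $\det\mathbf Y=-4\gamma\lambda^2$, and $d\mathbf Y+[\phi_\lambda,\mathbf Y]=0$ with respect to the original CMC structure equations. One has $a^{2n+1},\,h_2^{1/2}b^{2n+2},\,h_2^{-1/2}c^{2n+2}\in\mathbb C[z_3,z_4,\dots]$; e.g. $a^3=z_3$. $\bar a^{2n+1}$ denotes the formal conjugate of $a^{2n+1}$. In the CMC hierarchy $\mathbf Y$ is given by the same expressions in the $h_j$. **Extended Maurer–Cartan form.** New independent variables $t_m,\bar t_m$ ($m\ge0$) are introduced, with the relations $dt_0=-\frac12h_2^{1/2}\xi$ and $d\bar t_0=-\frac12\bar h_2^{1/2}\bar\xi$. For $m\ge0$ write $\frac1{2\mathrm i}\lambda^{-2m-2}\mathbf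 Y=U_m+U_{(m+1)}$, where $U_m$ consists of the terms of $\lambda$-degree $\le-1$ and $U_{(m+1)}$ of the terms of $\lambda$-degree $\ge0$. Set $$\boldsymbol\phi=-\sum_{m\ge0}\bar U_m^t\,d\bar t_m+\phi_0+\sum_{m\ge0}U_m\,dt_m=:\boldsymbol\phi_++\phi_0+\boldsymbol\phi_-,$$ with $\boldsymbol\phi_+$ the terms of $\lambda$-degree $\ge1$ and $\boldsymbol\phi_-$ those of $\lambda$-degree $\le-1$ (equivalently $\boldsymbol\phi=-\sum_{m\ge1}\bar U_m^td\bar t_m+\phi_\lambda+\sum_{m\ge1}U_mdt_m$). The subscript $(\cdot)_0$ denotes the $\lambda$-degree $0$ part. Equalities in (A), (C) are understood modulo the differential ideal that these equations define on the product of the infinite jet space with the spaces of the variables $t_m,\bar t_m$. *)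

theory Defs
  imports Complex_Main
    "HOL-Library.Poly_Mapping"
    "HOL-Library.Product_Plus"
    "HOL-Library.Function_Algebras"
    "HOL-Library.Numeral_Type"
begin

section \<open>Functions\<close>

text \<open>
  The functions are the elements of the ring
  \<open>\<complex>[h\<^sub>2\<^sup>\<plusminus>\<^sup>1\<^sup>/\<^sup>2, h\<^sub>3, h\<^sub>4, \<dots>, t\<^sub>0, t\<^sub>1, \<dots>]\<close> tensored with its formal conjugate.
  A monomial of one factor is \<open>(p, \<alpha>, \<beta>)\<close>, standing for
  \<open>h\<^sub>2\<^sup>p\<^sup>/\<^sup>2 \<Prod>\<^sub>k h\<^bsub>k+3\<^esub>\<^bsup>\<alpha> k\<^esup> \<Prod>\<^sub>m t\<^sub>m\<^bsup>\<beta> m\<^esup>\<close>; the exponent \<open>p\<close> may be negative.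
  The second component of a pair of monomials is the conjugate factor. Multiplication of
  finitely supported functions is convolution over the additive monoid of monomials,
  i.e. multiplication of Laurent polynomials.
\<close>

type_synonym side = "int \<times> (nat \<Rightarrow>\<^sub>0 nat) \<times> (nat \<Rightarrow>\<^sub>0 nat)"
type_synonym fn = "(side \<times> side) \<Rightarrow>\<^sub>0 complex"

definition cst :: "complex \<Rightarrow> fn" where
  "cst z = Poly_Mapping.single 0 z"

definition fn_conj :: "fn \<Rightarrow> fn" where
  "fn_conj f = Poly_Mapping.map_key prod.swap (Poly_Mapping.map cnj f)"

text \<open>\<open>h2pow p\<close> is \<open>h\<^sub>2\<^sup>p\<^sup>/\<^sup>2\<close>.\<close>

definition h2pow :: "int \<Rightarrow> fn" where
  "h2pow p = Poly_Mapping.single ((p, 0, 0), 0) 1"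

text \<open>Meaningful for \<open>j \<ge> 2\<close> only.\<close>

definition jet_h :: "nat \<Rightarrow> fn" where
  "jet_h j = (if j = 2 then h2pow 2
              else Poly_Mapping.single ((0, Poly_Mapping.single (j - 3) 1, 0), 0) 1)"

definition jet_hb :: "nat \<Rightarrow> fn" where
  "jet_hb j = fn_conj (jet_h j)"

definition var_t :: "nat \<Rightarrow> fn" where
  "var_t m = Poly_Mapping.single ((0, 0, Poly_Mapping.single m 1), 0) 1"

definition var_tb :: "nat \<Rightarrow> fn" where
  "var_tb m = fn_conj (var_t m)"


section \<open>Differential forms\<close>

text \<open>
  The coframe is \<open>\<xi>, \<xi>bar, \<rho>, dt\<^sub>m, dtbar\<^sub>m\<close> with \<open>m \<ge> 1\<close>: since \<open>dt\<^sub>0\<close> is a multiple of \<open>\<xi>\<close>,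
  the constructors \<open>DT m\<close> and \<open>DTb m\<close> stand for \<open>dt\<^bsub>m+1\<^esub>\<close> and \<open>dtbar\<^bsub>m+1\<^esub>\<close>.
\<close>

datatype coframe = Xi | Xib | Rho | DT nat | DTb nat

fun pos :: "coframe \<Rightarrow> nat" where
  "pos Xi = 0"
| "pos Xib = 1"
| "pos Rho = 2"
| "pos (DT m) = 2 * m + 3"
| "pos (DTb m) = 2 * m + 4"

text \<open>
  The structure equations involve infinite sums over \<open>m\<close>, so forms are formal, possibly infinite,
  sums \<open>\<Sum>\<^sub>S \<alpha> S \<theta>\<^sup>S\<close>, where \<open>\<theta>\<^sup>S\<close> is the exterior product of the coframe elements in the finite
  set \<open>S\<close>, taken in the order given by \<open>pos\<close>. Forms are added pointwise.
\<close>

type_synonym form = "coframe set \<Rightarrow> fn"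

definition Omega :: "nat \<Rightarrow> form set" where
  "Omega k = {\<alpha>. \<forall>S. \<alpha> S \<noteq> 0 \<longrightarrow> finite S \<and> card S = k}"

definition fn0 :: "fn \<Rightarrow> form" where
  "fn0 f = (\<lambda>S. if S = {} then f else 0)"

definition theta :: "coframe \<Rightarrow> form" where
  "theta g = (\<lambda>S. if S = {g} then 1 else 0)"

definition smult :: "fn \<Rightarrow> form \<Rightarrow> form" where
  "smult f \<alpha> = (\<lambda>S. f * \<alpha> S)"

text \<open>\<open>\<theta>\<^sup>T \<and> \<theta>\<^sup>U = wsign T U \<theta>\<^bsup>T \<union> U\<^esup>\<close> for disjoint \<open>T\<close>, \<open>U\<close>: the exponent counts the inversions.\<close>

definition wsign :: "coframe set \<Rightarrow> coframe set \<Rightarrow> fn" where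
  "wsign T U = (- 1) ^ card {(x, y). x \<in> T \<and> y \<in> U \<and> pos y < pos x}"

definition wedge :: "form \<Rightarrow> form \<Rightarrow> form"  (infixl "\<and>\<^sub>f" 70) where
  "\<alpha> \<and>\<^sub>f \<beta> = (\<lambda>S. \<Sum>T\<in>Pow S. wsign T (S - T) * \<alpha> T * \<beta> (S - T))"

text \<open>Sum of a family of forms in which each coefficient receives finitely many contributions.\<close>

definition fsum :: "('i \<Rightarrow> form) \<Rightarrow> form" where
  "fsum F = (\<lambda>S. Sum_any (\<lambda>i. F i S))"

text \<open>
  A \<open>\<complex>\<close>-linear antiderivation of degree 1. The last clause is continuity for the product topology
  (with discrete factors): \<open>d\<close> commutes with the formal infinite sums.
\<close>

definition antiderivation :: "(form \<Rightarrow> form) \<Rightarrow> bool" where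
  "antiderivation d \<longleftrightarrow>
     (\<forall>k. \<forall>\<alpha>\<in>Omega k. d \<alpha> \<in> Omega (Suc k)) \<and>
     (\<forall>k. \<forall>\<alpha>\<in>Omega k. \<forall>\<beta>\<in>Omega k. d (\<alpha> + \<beta>) = d \<alpha> + d \<beta>) \<and>
     (\<forall>z. d (fn0 (cst z)) = 0) \<and>
     (\<forall>j k. \<forall>\<alpha>\<in>Omega j. \<forall>\<beta>\<in>Omega k.
        d (\<alpha> \<and>\<^sub>f \<beta>) = d \<alpha> \<and>\<^sub>f \<beta> + smult ((- 1) ^ j) (\<alpha> \<and>\<^sub>f d \<beta>)) \<and>
     (\<forall>k S. \<exists>F. finite F \<and> (\<forall>\<alpha>\<in>Omega k. (\<forall>T\<in>F. \<alpha> T = 0) \<longrightarrow> d \<alpha> S = 0))"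

abbreviation xi :: form where "xi \<equiv> theta Xi"
abbreviation xib :: form where "xib \<equiv> theta Xib"
abbreviation rho :: form where "rho \<equiv> theta Rho"

definition dt :: "nat \<Rightarrow> form" where
  "dt m = (case m of 0 \<Rightarrow> smult (cst (- 1 / 2) * h2pow 1) xi | Suc n \<Rightarrow> theta (DT n))"

definition dtb :: "nat \<Rightarrow> form" where
  "dtb m = (case m of 0 \<Rightarrow> smult (cst (- 1 / 2) * fn_conj (h2pow 1)) xib | Suc n \<Rightarrow> theta (DTb n))"

text \<open>Congruence modulo the ideal generated by \<open>dt\<^sub>m\<close>, \<open>dtbar\<^sub>m\<close> with \<open>m \<ge> 1\<close>.\<close>

definition cong_mod_dt :: "form \<Rightarrow> form \<Rightarrow> bool" where
  "cong_mod_dt \<alpha> \<beta> \<longleftrightarrow> (\<forall>S. S \<subseteq> {Xi, Xib, Rho} \<longrightarrow> \<alpha> S = \<beta> S)"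


section \<open>The original CMC structure equations\<close>

definition curvR :: "real \<Rightarrow> fn" where
  "curvR \<gamma> = cst (of_real (\<gamma>\<^sup>2)) - jet_h 2 * jet_hb 2"

text \<open>The functions \<open>T\<^sub>k\<close>, \<open>k \<ge> 2\<close>; for \<open>k > 2\<close> the formula is the one for \<open>T\<^bsub>j+1\<^esub>\<close> with \<open>j = k - 1\<close>.\<close>

definition Tfun :: "real \<Rightarrow> nat \<Rightarrow> fn" where
  "Tfun \<gamma> k = (if k \<le> 2 then 0 else
     (let j = k - 1 in
       \<Sum>s = 0..j - 2.
         cst (of_nat (j + s + 2) / of_nat (2 * j) * of_nat (j choose (s + 2))) * jet_h (j - s) *
         ((if s = 0 then cst (of_real (\<gamma>\<^sup>2)) else 0) - jet_h (2 + s) * jet_hb 2)))"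

text \<open>
  The variables \<open>t\<^sub>m\<close> do not occur in the original system; accordingly the values of \<open>d\<close> on them,
  and on the coframe elements \<open>DT m\<close>, \<open>DTb m\<close>, are left open.
\<close>

definition cmc_structure :: "real \<Rightarrow> (form \<Rightarrow> form) \<Rightarrow> bool" where
  "cmc_structure \<gamma> d \<longleftrightarrow>
     antiderivation d \<and>
     d xi = smult (cst \<i>) (rho \<and>\<^sub>f xi) \<and>
     d xib = - smult (cst \<i>) (rho \<and>\<^sub>f xib) \<and>
     d rho = smult (curvR \<gamma> * cst (\<i> / 2)) (xi \<and>\<^sub>f xib) \<and>
     (\<forall>j\<ge>2. d (fn0 (jet_h j)) + smult (cst (\<i> * of_nat j) * jet_h j) rho =
        smult (jet_h (j + 1)) xi + smult (Tfun \<gamma> j) xib) \<and>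
     (\<forall>j\<ge>2. d (fn0 (jet_hb j)) - smult (cst (\<i> * of_nat j) * jet_hb j) rho =
        smult (jet_hb (j + 1)) xib + smult (fn_conj (Tfun \<gamma> j)) xi)"


section \<open>Series in \<open>\<lambda>\<close> and matrices\<close>

text \<open>
  A series in \<open>\<lambda>\<close>, possibly infinite in both directions, is the function giving its coefficients.
  Products are formed coefficientwise by \<open>fsum\<close>; in all products below only finitely many terms
  contribute to a given coefficient.
\<close>

type_synonym lfn = "int \<Rightarrow> fn"
type_synonym lform = "int \<Rightarrow> form"
type_synonym 'a mat2 = "2 \<Rightarrow> 2 \<Rightarrow> 'a"

definition mat2 :: "'a \<Rightarrow> 'a \<Rightarrow> 'a \<Rightarrow> 'a \<Rightarrow> 'a mat2" where
  "mat2 p q r s = (\<lambda>i j. if i = 1 then (if j = 1 then p else q) else (if j = 1 then r else s))"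

definition lmono :: "int \<Rightarrow> form \<Rightarrow> lform" where
  "lmono k \<alpha> = (\<lambda>n. if n = k then \<alpha> else 0)"

definition lwedge :: "lform \<Rightarrow> lform \<Rightarrow> lform" where
  "lwedge P Q = (\<lambda>n. fsum (\<lambda>k. P k \<and>\<^sub>f Q (n - k)))"

definition mwedge :: "lform mat2 \<Rightarrow> lform mat2 \<Rightarrow> lform mat2" where
  "mwedge A B = (\<lambda>i j. \<Sum>k\<in>UNIV. lwedge (A i k) (B k j))"

definition mcomm :: "lform mat2 \<Rightarrow> lform mat2 \<Rightarrow> lform mat2" where
  "mcomm A B = mwedge A B - mwedge B A"

definition mdet :: "lform mat2 \<Rightarrow> lform" where
  "mdet A = lwedge (A 1 1) (A 2 2) - lwedge (A 1 2) (A 2 1)"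

definition mdiff :: "(form \<Rightarrow> form) \<Rightarrow> lform mat2 \<Rightarrow> lform mat2" where
  "mdiff d A = (\<lambda>i j n. d (A i j n))"

definition mlift :: "lfn mat2 \<Rightarrow> lform mat2" where
  "mlift A = (\<lambda>i j n. fn0 (A i j n))"

text \<open>The conjugate transpose; formal conjugation inverts \<open>\<lambda>\<close>.\<close>

definition mstar :: "lfn mat2 \<Rightarrow> lfn mat2" where
  "mstar A = (\<lambda>i j n. fn_conj (A j i (- n)))"


section \<open>The canonical formal Killing field\<close>

definition phi0 :: "lform mat2" where
  "phi0 = mat2 (lmono 0 (smult (cst (\<i> / 2)) rho)) 0
               0 (lmono 0 (smult (cst (- \<i> / 2)) rho))"

definition phi_lambda :: "real \<Rightarrow> lform mat2" where
  "phi_lambda \<gamma> = mat2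
     (lmono 0 (smult (cst (\<i> / 2)) rho))
     (lmono 1 (smult (cst (- of_real \<gamma> / 2)) xib) + lmono (- 1) (smult (cst (- 1 / 2) * jet_h 2) xi))
     (lmono 1 (smult (cst (1 / 2) * jet_hb 2) xib) + lmono (- 1) (smult (cst (of_real \<gamma> / 2)) xi))
     (lmono 0 (smult (cst (- \<i> / 2)) rho))"

text \<open>
  The arguments of \<open>a\<close>, \<open>b\<close>, \<open>c\<close> are the superscripts \<open>2n+1\<close> resp. \<open>2n+2\<close>, so that the coefficient of
  \<open>\<lambda>\<^sup>k\<close> carries the superscript \<open>k + 1\<close>; values of \<open>a\<close> at even and of \<open>b\<close>, \<open>c\<close> at odd arguments
  are never used.
\<close>

definition Ymat :: "(nat \<Rightarrow> fn) \<Rightarrow> (nat \<Rightarrow> fn) \<Rightarrow> (nat \<Rightarrow> fn) \<Rightarrow> lfn mat2" where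
  "Ymat a b c = mat2
     (\<lambda>k. if 0 \<le> k \<and> even k then cst (- \<i>) * a (nat k + 1) else 0)
     (\<lambda>k. if 0 \<le> k \<and> odd k then cst 2 * c (nat k + 1) else 0)
     (\<lambda>k. if 0 \<le> k \<and> odd k then cst 2 * b (nat k + 1) else 0)
     (\<lambda>k. if 0 \<le> k \<and> even k then cst \<i> * a (nat k + 1) else 0)"

definition canonical_killing ::
  "real \<Rightarrow> (form \<Rightarrow> form) \<Rightarrow> (nat \<Rightarrow> fn) \<Rightarrow> (nat \<Rightarrow> fn) \<Rightarrow> (nat \<Rightarrow> fn) \<Rightarrow> bool" where
  "canonical_killing \<gamma> d a b c \<longleftrightarrow>
     a 1 = 0 \<and>
     b 2 = cst (- \<i> * of_real \<gamma>) * h2pow (- 1) \<and>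
     c 2 = cst \<i> * h2pow 1 \<and>
     mdet (mlift (Ymat a b c)) = lmono 2 (fn0 (cst (- 4 * of_real \<gamma>))) \<and>
     mdiff d (mlift (Ymat a b c)) + mcomm (phi_lambda \<gamma>) (mlift (Ymat a b c)) = 0"


section \<open>The CMC hierarchy\<close>

text \<open>\<open>Umat Y m\<close> is the part of \<open>1/(2i) \<lambda>\<^bsup>-2m-2\<^esup> Y\<close> of degree \<open>\<le> -1\<close>.\<close>

definition Umat :: "lfn mat2 \<Rightarrow> nat \<Rightarrow> lfn mat2" where
  "Umat Y m = (\<lambda>i j n. if n \<le> - 1 then cst (1 / (2 * \<i>)) * Y i j (n + 2 * int m + 2) else 0)"

definition phi_minus :: "lfn mat2 \<Rightarrow> lform mat2" where
  "phi_minus Y = (\<lambda>i j n. fsum (\<lambda>m. smult (Umat Y m i j n) (dt m)))"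

definition phi_plus :: "lfn mat2 \<Rightarrow> lform mat2" where
  "phi_plus Y = (\<lambda>i j n. - fsum (\<lambda>m. smult (mstar (Umat Y m) i j n) (dtb m)))"

definition phi_ext :: "lfn mat2 \<Rightarrow> lform mat2" where
  "phi_ext Y = phi_plus Y + phi0 + phi_minus Y"

text \<open>
  The system (A). The sums over \<open>m \<ge> 1\<close> are indexed by \<open>Suc m\<close>. The next to last equation, the
  \<open>\<lambda>\<close>-degree 0 part of the flatness of \<open>phi_ext\<close>, is the complete expression for \<open>d\<rho>\<close>.
\<close>

definition system_A :: "real \<Rightarrow> (nat \<Rightarrow> fn) \<Rightarrow> (nat \<Rightarrow> fn) \<Rightarrow> (nat \<Rightarrow> fn) \<Rightarrow> (form \<Rightarrow> form) \<Rightarrow> bool" where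
  "system_A \<gamma> a b c d \<longleftrightarrow>
     d xi - smult (cst \<i>) (rho \<and>\<^sub>f xi) =
       fsum (\<lambda>m. smult (a (2 * Suc m + 3)) (dt (Suc m) \<and>\<^sub>f xi)) \<and>
     d xib + smult (cst \<i>) (rho \<and>\<^sub>f xib) =
       fsum (\<lambda>m. smult (fn_conj (a (2 * Suc m + 3))) (dtb (Suc m) \<and>\<^sub>f xib)) \<and>
     d (fn0 (jet_h 2)) + smult (cst (2 * \<i>) * jet_h 2) rho =
       smult (jet_h 3) xi
       - smult (cst 2) (fsum (\<lambda>m. smult (jet_h 2 * a (2 * Suc m + 3)) (dt (Suc m)))) \<and>
     d (fn0 (jet_hb 2)) - smult (cst (2 * \<i>) * jet_hb 2) rho =
       smult (jet_hb 3) xib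
       - smult (cst 2) (fsum (\<lambda>m. smult (jet_hb 2 * fn_conj (a (2 * Suc m + 3))) (dtb (Suc m)))) \<and>
     (\<forall>i j. mdiff d phi0 i j 0
        + (mwedge (phi_plus (Ymat a b c)) (phi_minus (Ymat a b c))
           + mwedge (phi_minus (Ymat a b c)) (phi_plus (Ymat a b c))) i j 0 = 0) \<and>
     cong_mod_dt (d rho) (smult (curvR \<gamma> * cst (\<i> / 2)) (xi \<and>\<^sub>f xib))"

definition system_C :: "(nat \<Rightarrow> fn) \<Rightarrow> (nat \<Rightarrow> fn) \<Rightarrow> (nat \<Rightarrow> fn) \<Rightarrow> (form \<Rightarrow> form) \<Rightarrow> bool" where
  "system_C a b c d \<longleftrightarrow>
     (let Y = mlift (Ymat a b c); Z = mlift (- mstar (Ymat a b c)); \<phi> = phi_ext (Ymat a b c) in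
        mdiff d Y + mcomm \<phi> Y = 0 \<and> mdiff d Z + mcomm \<phi> Z = 0)"

text \<open>
  The exterior derivative determined by the hierarchy. The \<open>t\<^sub>m\<close> being variables, the coframe
  elements \<open>dt\<^sub>m\<close>, \<open>m \<ge> 1\<close>, are their differentials and closed. For \<open>m = 0\<close> only the relation
  \<open>dt\<^sub>0 = -1/2 h\<^sub>2\<^sup>1\<^sup>/\<^sup>2 \<xi>\<close> is imposed, not the closedness of the right hand side.
\<close>

definition cmc_hierarchy ::
  "real \<Rightarrow> (nat \<Rightarrow> fn) \<Rightarrow> (nat \<Rightarrow> fn) \<Rightarrow> (nat \<Rightarrow> fn) \<Rightarrow> (form \<Rightarrow> form) \<Rightarrow> bool" where
  "cmc_hierarchy \<gamma> a b c d \<longleftrightarrow>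
     antiderivation d \<and>
     (\<forall>m. d (fn0 (var_t m)) = dt m \<and> d (fn0 (var_tb m)) = dtb m) \<and>
     (\<forall>m\<ge>1. d (dt m) = 0 \<and> d (dtb m) = 0) \<and>
     system_A \<gamma> a b c d \<and> system_C a b c d"

end

theory Submission
  imports "HOL-Computational_Algebra.Formal_Laurent_Series" Defs
begin

text \<open>
  All structure equations are translated into statements about derivations of the ring of functions.
  Replace the coframe elements \<open>\<xi>\<close> and \<open>\<xi>bar\<close> by \<open>dt\<^sub>0\<close> and \<open>dtbar\<^sub>0\<close>; the dual vector fields are then
  \<open>\<partial>\<^sub>m\<close>, \<open>\<partial>bar\<^sub>m\<close> (\<open>m \<ge> 0\<close>) and the rotation field \<open>H\<close> dual to \<open>\<rho>\<close>. Write \<open>V\<^sub>m = \<lambda>\<^bsup>-2m-2\<^esup> Y / 2i\<close>, let \<open>U\<^sub>m\<close> be its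
  part of negative degree, \<open>Q\<^sub>m\<close> the conjugate transpose of \<open>U\<^sub>m\<close>, and \<open>s = diag (i/2, -i/2)\<close>. The system
  (C) says that \<open>\<partial>\<^sub>m\<close>, \<open>\<partial>bar\<^sub>m\<close> and \<open>H\<close> differentiate both \<open>Y\<close> and its conjugate transpose by
  \<open>X \<mapsto> - [P, X]\<close> with \<open>P = U\<^sub>m\<close>, \<open>P = - Q\<^sub>m\<close> and \<open>P = s\<close>, respectively.

  The square of \<open>d\<close> vanishes. If two derivations \<open>e\<close>, \<open>f\<close> act on \<open>Y\<close> through \<open>P\<close>, \<open>Q\<close> in this way, then
  \<open>[e, f] + \<kappa> H\<close> acts through the curvature \<open>e Q - f P + [P, Q] + \<kappa> s\<close>. The curvatures of the hierarchy vanish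
  (\<open>flat_ephi\<close>): for two negative parts \<open>U\<^sub>m\<close>, \<open>U\<^sub>l\<close> this follows from \<open>[V\<^sub>m, V\<^sub>l] = 0\<close> by comparing degrees, and
  for a mixed pair all that is left is the term of degree 0, which is cancelled by the equation for \<open>d\<rho>\<close>.
  Hence \<open>[e, f] + \<kappa> H\<close> annihilates the coefficients of \<open>Y\<close> and of its conjugate. These
  coefficients determine all jet functions: the recursion for \<open>Y\<close>, which uses \<open>det Y = -4 \<gamma> \<lambda>\<^sup>2\<close> and \<open>\<gamma> \<noteq> 0\<close>,
  shows that each \<open>h\<^sub>N\<close> is, up to a unit and functions of lower order, a coefficient of \<open>Y\<close>
  (\<open>Y_leading\<close>, \<open>kills_jets\<close>). So \<open>d\<^sup>2\<close> vanishes on functions. It vanishes on the closed forms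
  \<open>dt\<^sub>m\<close>, \<open>dtbar\<^sub>m\<close>, and on \<open>\<rho>\<close> because \<open>\<rho>\<close> occurs in \<open>dh\<^sub>2\<close> with a unit coefficient; continuity and the
  Leibniz rule give the rest (\<open>hierarchy_square_zero\<close>).

  The exterior derivative of the hierarchy exists. The derivation \<open>\<partial>\<^sub>m\<close> of the jet functions is defined by its value
  on \<open>h\<^sub>2\<^sup>1\<^sup>/\<^sup>2\<close> and by prescribing its commutator with \<open>\<partial>\<^sub>0\<close> (\<open>ex_commuting_derivation\<close>). The defect
  \<open>X = \<partial>\<^sub>m Y + [U\<^sub>m, Y]\<close> satisfies \<open>\<partial>\<^sub>0 X = - [U\<^sub>0, X]\<close> because the curvature of the pair vanishes, and it
  anticommutes with \<open>Y\<close> because \<open>Y\<^sup>2\<close> is constant; these two facts force \<open>X = 0\<close> degree by degree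
  (\<open>series_unique\<close>, \<open>ex_flow\<close>). The same argument gives the action of \<open>\<partial>bar\<^sub>m\<close>. The derivations
  so obtained are assembled into an antiderivation (locale \<open>frame\<close>) in which
  \<open>dt\<^sub>m\<close> is closed and \<open>d\<rho>\<close> is the 2-form dictated by the degree 0 equation (\<open>hierarchy_exists\<close>).
\<close>

unbundle fps_syntax

section \<open>The ring of functions and its derivations\<close>

abbreviation "coef \<equiv> Poly_Mapping.lookup"
abbreviation "supp \<equiv> Poly_Mapping.keys"

lemma cst_add: "cst (x + y) = cst x + cst y"
  by (simp add: cst_def single_add)

lemma cst_mult: "cst (x * y) = cst x * cst y"
  by (simp add: cst_def mult_single)

lemma cst_0 [simp]: "cst 0 = 0"
  by (simp add: cst_def)

lemma cst_1 [simp]: "cst 1 = 1"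
  by (simp add: cst_def)

lemma cst_minus: "cst (- x) = - cst x"
  by (simp add: cst_def single_uminus)

lemma cst_inverse: "z \<noteq> 0 \<Longrightarrow> cst (1 / z) * cst z = 1"
  by (simp flip: cst_mult)

lemma h2pow_add: "h2pow (p + q) = h2pow p * h2pow q"
  by (simp add: h2pow_def mult_single)

lemma h2pow_0 [simp]: "h2pow 0 = 1"
  by (simp add: h2pow_def flip: zero_prod_def)

lemma h2pow_inverse [simp]: "h2pow 1 * h2pow (- 1) = 1" "h2pow (- 1) * h2pow 1 = 1"
  by (simp_all flip: h2pow_add)

lemma jet_h_2: "jet_h 2 = h2pow 1 * h2pow 1"
  by (simp add: jet_h_def flip: h2pow_add)

lemma lookup_fn_conj: "coef (fn_conj f) k = cnj (coef f (prod.swap k))"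
proof -
  have "inj (prod.swap :: side \<times> side \<Rightarrow> side \<times> side)" by (rule injI) (metis swap_swap)
  then show ?thesis
    by (simp add: fn_conj_def map_key.rep_eq map.rep_eq when_def)
qed

lemma fn_conj_add [simp]: "fn_conj (f + g) = fn_conj f + fn_conj g"
  by (rule poly_mapping_eqI) (simp add: lookup_fn_conj lookup_add)

lemma fn_conj_fn_conj [simp]: "fn_conj (fn_conj f) = f"
  by (rule poly_mapping_eqI) (simp add: lookup_fn_conj)

lemma fn_conj_single: "fn_conj (Poly_Mapping.single k z) = Poly_Mapping.single (prod.swap k) (cnj z)"
  by (rule poly_mapping_eqI) (cases k, auto simp: lookup_fn_conj lookup_single when_def prod.swap_def)

lemma fn_conj_0 [simp]: "fn_conj 0 = 0"
  by (rule poly_mapping_eqI) (simp add: lookup_fn_conj)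

lemma poly_mapping_sum_singles: "f = (\<Sum>k\<in>supp f. Poly_Mapping.single k (coef f k))"
  by (rule poly_mapping_eqI)
     (simp add: lookup_sum lookup_single when_def in_keys_iff)

lemma poly_mapping_induct_single [case_names add single]:
  assumes "\<And>f g. P f \<Longrightarrow> P g \<Longrightarrow> P (f + g)" and "\<And>k z. P (Poly_Mapping.single k z)"
  shows "P (f :: 'a \<Rightarrow>\<^sub>0 'b::comm_monoid_add)"
proof -
  have "P (\<Sum>k\<in>A. Poly_Mapping.single k (coef f k))" if "finite A" for A
    using that
  proof (induction A)
    case empty
    show ?case using assms(2)[of undefined 0] by simp
  qed (simp add: assms)
  from this[of "supp f"] show ?thesis by (simp flip: poly_mapping_sum_singles)
qed

lemma fn_conj_mult [simp]: "fn_conj (f * g) = fn_conj f * fn_conj g"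
proof (induction f rule: poly_mapping_induct_single)
  case (single k z)
  show ?case
  proof (induction g rule: poly_mapping_induct_single)
    case (single l w)
    have "prod.swap (k + l) = prod.swap k + prod.swap l"
      by (cases k; cases l) simp
    then show ?case by (simp add: fn_conj_single mult_single)
  qed (simp add: algebra_simps)
qed (simp add: algebra_simps)

lemma fn_conj_cst [simp]: "fn_conj (cst z) = cst (cnj z)"
  by (simp add: cst_def fn_conj_single zero_prod_def)

lemma fn_conj_1 [simp]: "fn_conj 1 = 1"
  using fn_conj_cst[of 1] by simp

lemma fn_conj_minus [simp]: "fn_conj (- f) = - fn_conj f"
  by (rule poly_mapping_eqI) (simp add: lookup_fn_conj)

lemma fn_conj_diff [simp]: "fn_conj (f - g) = fn_conj f - fn_conj g"
  by (rule poly_mapping_eqI) (simp add: lookup_fn_conj lookup_minus)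

text \<open>
  A derivation is determined on the generated subalgebra by its values on the generators; this is how all
  identities between derivations below are checked.
\<close>

inductive_set alg :: "fn set \<Rightarrow> fn set" for G where
  gen: "g \<in> G \<Longrightarrow> g \<in> alg G"
| cst: "cst z \<in> alg G"
| add: "f \<in> alg G \<Longrightarrow> g \<in> alg G \<Longrightarrow> f + g \<in> alg G"
| mult: "f \<in> alg G \<Longrightarrow> g \<in> alg G \<Longrightarrow> f * g \<in> alg G"

lemma alg_mono: "f \<in> alg G \<Longrightarrow> G \<subseteq> G' \<Longrightarrow> f \<in> alg G'"
  by (induction rule: alg.induct) (auto intro: alg.intros)

lemma alg_0: "0 \<in> alg G" and alg_1: "1 \<in> alg G"
  using alg.cst[of 0 G] alg.cst[of 1 G] by simp_all

lemma alg_minus: "f \<in> alg G \<Longrightarrow> - f \<in> alg G"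
  using alg.mult[OF alg.cst[of "- 1" G]] by (simp add: cst_minus)

lemma alg_diff: "f \<in> alg G \<Longrightarrow> g \<in> alg G \<Longrightarrow> f - g \<in> alg G"
  using alg.add[OF _ alg_minus] by fastforce

lemma alg_sum: "(\<And>x. x \<in> A \<Longrightarrow> f x \<in> alg G) \<Longrightarrow> sum f A \<in> alg G"
  by (induction A rule: infinite_finite_induct) (auto intro: alg.add alg_0)

lemma alg_fn_conj: "f \<in> alg G \<Longrightarrow> fn_conj f \<in> alg (fn_conj ` G)"
  by (induction rule: alg.induct) (auto intro: alg.intros)

definition jet_gens :: "fn set" where
  "jet_gens = {h2pow 1, h2pow (- 1)} \<union> jet_h ` {3..}"

definition all_gens :: "fn set" where
  "all_gens = jet_gens \<union> range var_t \<union> fn_conj ` (jet_gens \<union> range var_t)"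

lemma alg_power: "f \<in> alg G \<Longrightarrow> f ^ n \<in> alg G"
  by (induction n) (auto intro: alg_1 alg.mult)

lemma h2pow_in_alg: "{h2pow 1, h2pow (- 1)} \<subseteq> G \<Longrightarrow> h2pow p \<in> alg G"
proof (induction p rule: int_induct[of _ 0])
  case base
  then show ?case by (simp add: alg_1)
next
  case (step1 i)
  then have "h2pow (i + 1) = h2pow i * h2pow 1" by (simp add: h2pow_add)
  with step1 show ?case by (auto intro: alg.mult alg.gen)
next
  case (step2 i)
  then have "h2pow (i - 1) = h2pow i * h2pow (- 1)" by (simp flip: h2pow_add)
  with step2 show ?case by (auto intro: alg.mult alg.gen)
qed

text \<open>
  Every monomial is a product of powers of the generators and of a power of \<open>h\<^sub>2\<^sup>1\<^sup>/\<^sup>2\<close>, and likewise for its conjugate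
  factor; functions are linear combinations of monomials.
\<close>

lemma alg_all_gens: "f \<in> alg all_gens"
proof (induction f rule: poly_mapping_induct_single)
  case (add f g)
  then show ?case by (rule alg.add)
next
  case (single k z)
  have mon1: "Poly_Mapping.single ((p, \<alpha>, \<beta>), 0) 1 \<in> alg (jet_gens \<union> range var_t)" for p \<alpha> \<beta>
  proof -
    let ?G = "alg (jet_gens \<union> range var_t)"
    have 0: "h2pow p \<in> ?G" by (rule h2pow_in_alg) (auto simp: jet_gens_def)
    have 1: "Poly_Mapping.single ((0, \<alpha>, 0), 0) 1 \<in> ?G" for \<alpha>
    proof (induction \<alpha> rule: poly_mapping_induct_single)
      case (add f g)
      have "Poly_Mapping.single ((0, f + g, 0), 0) 1 =
        (Poly_Mapping.single ((0, f, 0), 0) 1 :: fn) * Poly_Mapping.single ((0, g, 0), 0) 1"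
        by (simp add: mult_single)
      with add show ?case by (auto intro: alg.mult)
    next
      case (single j n)
      have "Poly_Mapping.single ((0, Poly_Mapping.single j n, 0), 0) 1 = jet_h (j + 3) ^ n"
      proof (induction n)
        case 0
        show ?case by (simp flip: zero_prod_def)
      next
        case (Suc n)
        have "jet_h (j + 3) = Poly_Mapping.single ((0, Poly_Mapping.single j 1, 0), 0) 1"
          by (simp add: jet_h_def)
        then have "jet_h (j + 3) ^ Suc n = Poly_Mapping.single ((0, Poly_Mapping.single j 1, 0), 0) 1 *
          Poly_Mapping.single ((0, Poly_Mapping.single j n, 0), 0) 1"
          by (simp add: Suc)
        then show ?case by (simp add: mult_single flip: single_add)
      qed
      then show ?case by (simp add: alg_power alg.gen jet_gens_def)
    qed
    have 2: "Poly_Mapping.single ((0, 0, \<beta>), 0) 1 \<in> ?G" for \<beta>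
    proof (induction \<beta> rule: poly_mapping_induct_single)
      case (add f g)
      have "Poly_Mapping.single ((0, 0, f + g), 0) 1 =
        (Poly_Mapping.single ((0, 0, f), 0) 1 :: fn) * Poly_Mapping.single ((0, 0, g), 0) 1"
        by (simp add: mult_single)
      with add show ?case by (auto intro: alg.mult)
    next
      case (single j n)
      have "Poly_Mapping.single ((0, 0, Poly_Mapping.single j n), 0) 1 = var_t j ^ n"
      proof (induction n)
        case 0
        show ?case by (simp flip: zero_prod_def)
      next
        case (Suc n)
        then have "var_t j ^ Suc n = Poly_Mapping.single ((0, 0, Poly_Mapping.single j 1), 0) 1 *
          Poly_Mapping.single ((0, 0, Poly_Mapping.single j n), 0) 1"
          by (simp add: var_t_def)
        then show ?case by (simp add: mult_single flip: single_add)
      qed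
      then show ?case by (simp add: alg_power alg.gen)
    qed
    have "Poly_Mapping.single ((p, \<alpha>, \<beta>), 0) 1 = h2pow p *
       Poly_Mapping.single ((0, \<alpha>, 0), 0) 1 * Poly_Mapping.single ((0, 0, \<beta>), 0) 1"
      by (simp add: mult_single h2pow_def)
    with 0 1 2 show ?thesis by (auto intro: alg.mult)
  qed
  have mon2: "Poly_Mapping.single (0, (p, \<alpha>, \<beta>)) 1 \<in> alg (fn_conj ` (jet_gens \<union> range var_t))" for p \<alpha> \<beta>
    using alg_fn_conj[OF mon1[of p \<alpha> \<beta>]] by (simp add: fn_conj_single)
  obtain p \<alpha> \<beta> p' \<alpha>' \<beta>' where k: "k = ((p, \<alpha>, \<beta>), (p', \<alpha>', \<beta>'))" by (cases k) auto
  have "Poly_Mapping.single k z = cst z * Poly_Mapping.single ((p, \<alpha>, \<beta>), 0) 1 *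
     Poly_Mapping.single (0, (p', \<alpha>', \<beta>')) 1"
    by (simp add: k mult_single cst_def)
  moreover have "Poly_Mapping.single ((p, \<alpha>, \<beta>), 0) 1 \<in> alg all_gens"
    by (rule alg_mono[OF mon1]) (auto simp: all_gens_def)
  moreover have "Poly_Mapping.single (0, (p', \<alpha>', \<beta>')) 1 \<in> alg all_gens"
    by (rule alg_mono[OF mon2]) (auto simp: all_gens_def)
  ultimately show ?case by (auto intro: alg.mult alg.cst)
qed

subsection \<open>Derivations\<close>

definition derivation :: "('a::ring \<Rightarrow> 'a) \<Rightarrow> bool" where
  "derivation D \<longleftrightarrow> (\<forall>f g. D (f + g) = D f + D g) \<and> (\<forall>f g. D (f * g) = D f * g + f * D g)"

definition der :: "(fn \<Rightarrow> fn) \<Rightarrow> bool" where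
  "der D \<longleftrightarrow> derivation D \<and> (\<forall>z. D (cst z) = 0)"

lemma derivation_add: "derivation D \<Longrightarrow> D (f + g) = D f + D g"
  and derivation_mult: "derivation D \<Longrightarrow> D (f * g) = D f * g + f * D g"
  by (simp_all add: derivation_def)

lemma derivation_0: "derivation D \<Longrightarrow> D 0 = 0"
  using derivation_add[of D 0 0] by simp

lemma derivation_minus: "derivation D \<Longrightarrow> D (- f) = - D f"
  using derivation_add[of D f "- f"] by (simp add: derivation_0 eq_neg_iff_add_eq_0 add.commute)

lemma derivation_diff: "derivation D \<Longrightarrow> D (f - g) = D f - D g"
  using derivation_add[of D f "- g"] by (simp add: derivation_minus)

lemma derivation_sum: "derivation D \<Longrightarrow> D (sum f A) = (\<Sum>x\<in>A. D (f x))"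
  by (induction A rule: infinite_finite_induct) (auto simp: derivation_0 derivation_add)

lemmas derivation_simps = derivation_add derivation_mult derivation_0 derivation_minus derivation_diff

lemma derI:
  assumes "\<And>f g. D (f + g) = D f + D g" "\<And>f g. D (f * g) = D f * g + f * D g" "\<And>z. D (cst z) = 0"
  shows "der D"
  using assms by (simp add: der_def derivation_def)

lemma der_derivation: "der D \<Longrightarrow> derivation D" and der_cst: "der D \<Longrightarrow> D (cst z) = 0"
  by (simp_all add: der_def)

lemma der_add: "der D \<Longrightarrow> D (f + g) = D f + D g"
  and der_mult: "der D \<Longrightarrow> D (f * g) = D f * g + f * D g"
  and der_0: "der D \<Longrightarrow> D 0 = 0"
  and der_minus: "der D \<Longrightarrow> D (- f) = - D f"
  and der_diff: "der D \<Longrightarrow> D (f - g) = D f - D g"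
  by (simp_all add: der_def derivation_simps)

lemma der_1: "der D \<Longrightarrow> D 1 = 0"
  using der_cst[of D 1] by simp

lemma der_cst_mult: "der D \<Longrightarrow> D (cst z * f) = cst z * D f"
  by (simp add: der_mult der_cst)

lemmas der_simps = der_add der_cst_mult der_mult der_0 der_minus der_diff der_1 der_cst

lemma der_plus: "der D \<Longrightarrow> der E \<Longrightarrow> der (\<lambda>f. D f + E f)"
  by (rule derI) (simp_all add: der_simps algebra_simps)

lemma der_scale: "der D \<Longrightarrow> der (\<lambda>f. x * D f)"
  by (rule derI) (simp_all add: der_add der_mult der_cst algebra_simps)

lemma der_zero: "der (\<lambda>f. 0)"
  by (rule derI) simp_all

lemma der_commutator: "der D \<Longrightarrow> der E \<Longrightarrow> der (\<lambda>f. D (E f) - E (D f))"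
  by (rule derI) (simp_all add: der_add der_mult der_cst der_0 algebra_simps)

text \<open>
  The conjugate vector field. It lets the action of \<open>D\<close> on barred functions be expressed by the action of a
  derivation on unbarred ones.
\<close>

definition conj_der :: "(fn \<Rightarrow> fn) \<Rightarrow> fn \<Rightarrow> fn" where
  "conj_der D f = fn_conj (D (fn_conj f))"

lemma der_conj_der: "der D \<Longrightarrow> der (conj_der D)"
  by (rule derI) (simp_all add: conj_der_def der_add der_mult der_cst)

lemma conj_der_conj_der [simp]: "conj_der (conj_der D) = D"
  by (simp add: conj_der_def fun_eq_iff)

lemma der_eq_on_alg:
  assumes "der D" "der E" and "\<And>g. g \<in> G \<Longrightarrow> D g = E g" and "f \<in> alg G"
  shows "D f = E f"
  using assms(4)
  by (induction rule: alg.induct) (simp_all add: assms(3) der_add[OF assms(1)] der_add[OF assms(2)]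
      der_mult[OF assms(1)] der_mult[OF assms(2)] der_cst[OF assms(1)] der_cst[OF assms(2)])

lemma der_h2pow_neg: "der D \<Longrightarrow> D (h2pow (- 1)) = - h2pow (- 1) * h2pow (- 1) * D (h2pow 1)"
proof -
  assume D: "der D"
  have "0 = h2pow (- 1) * D (h2pow 1 * h2pow (- 1))" by (simp add: der_1[OF D])
  also have "\<dots> = h2pow (- 1) * D (h2pow 1) * h2pow (- 1) + (h2pow (- 1) * h2pow 1) * D (h2pow (- 1))"
    unfolding der_mult[OF D] by (simp only: algebra_simps)
  finally show ?thesis by (simp add: algebra_simps eq_neg_iff_add_eq_0)
qed

lemma der_jet_h_2: "der D \<Longrightarrow> D (jet_h 2) = cst 2 * h2pow 1 * D (h2pow 1)"
  using cst_add[of 1 1] by (simp add: jet_h_2 der_mult algebra_simps)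

lemma der_h2pow_1:
  assumes "der D" shows "D (h2pow 1) = cst (1 / 2) * h2pow (- 1) * D (jet_h 2)"
proof -
  have "cst (1 / 2) * h2pow (- 1) * D (jet_h 2) = (cst (1/2) * cst 2) * (h2pow (- 1) * h2pow 1) * D (h2pow 1)"
    unfolding der_jet_h_2[OF assms] by (simp only: ac_simps)
  then show ?thesis by (simp flip: cst_mult)
qed

lemma der_eq_on_jets:
  assumes "der D" "der E" "D (h2pow 1) = E (h2pow 1)" "\<And>k. k \<ge> 3 \<Longrightarrow> D (jet_h k) = E (jet_h k)"
    and "f \<in> alg jet_gens"
  shows "D f = E f"
  using assms(1,2) _ assms(5)
  by (rule der_eq_on_alg) (auto simp: jet_gens_def assms der_h2pow_neg)

lemma der_eqI:
  assumes "der D" "der E"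
    and "\<And>f. f \<in> alg jet_gens \<Longrightarrow> D f = E f" "\<And>f. f \<in> alg jet_gens \<Longrightarrow> conj_der D f = conj_der E f"
    and "\<And>m. D (var_t m) = E (var_t m)" "\<And>m. D (var_tb m) = E (var_tb m)"
  shows "D = E"
proof
  fix f
  have "D g = E g" if "g \<in> jet_gens" for g using assms(3) that by (simp add: alg.gen)
  moreover have "D (fn_conj g) = E (fn_conj g)" if "g \<in> jet_gens" for g
    using arg_cong[OF assms(4)[of g], of fn_conj] that by (simp add: alg.gen conj_der_def)
  ultimately show "D f = E f"
    by (rule_tac der_eq_on_alg[OF assms(1,2) _ alg_all_gens])
       (auto simp: all_gens_def assms(5,6) simp flip: var_tb_def)
qed

definition lin_ext :: "(side \<times> side \<Rightarrow> fn) \<Rightarrow> fn \<Rightarrow> fn" where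
  "lin_ext M f = (\<Sum>k\<in>supp f. cst (coef f k) * M k)"

lemma lin_ext_add: "lin_ext M (f + g) = lin_ext M f + lin_ext M g"
  unfolding lin_ext_def
  by (rule setsum_keys_plus_distrib) (simp_all add: cst_add algebra_simps)

lemma lin_ext_single: "lin_ext M (Poly_Mapping.single k z) = cst z * M k"
  by (simp add: lin_ext_def)

text \<open>
  Both sides of the Leibniz rule are bilinear, and the monomials span.
\<close>

lemma der_lin_ext:
  assumes "\<And>k l. M (k + l) = M k * Poly_Mapping.single l 1 + Poly_Mapping.single k 1 * M l"
  shows "der (lin_ext M)"
proof (rule derI)
  show "lin_ext M (f * g) = lin_ext M f * g + f * lin_ext M g" for f g
  proof (induction f rule: poly_mapping_induct_single)
    case (single k z)
    show ?case
    proof (induction g rule: poly_mapping_induct_single)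
      case (single l w)
      have *: "Poly_Mapping.single k z = cst z * Poly_Mapping.single k 1" for k z
        by (simp add: cst_def mult_single)
      have "lin_ext M (Poly_Mapping.single k z * Poly_Mapping.single l w) =
          cst z * cst w * (M k * Poly_Mapping.single l 1 + Poly_Mapping.single k 1 * M l)"
        by (simp add: mult_single lin_ext_single assms cst_mult)
      then show ?case
        unfolding lin_ext_single by (subst *[of k z], subst *[of l w]) (simp add: algebra_simps)
    qed (simp add: lin_ext_add algebra_simps)
  qed (simp add: lin_ext_add algebra_simps)
  have "M 0 = 0" using assms[of 0 0] by simp
  then show "lin_ext M (cst z) = 0" for z by (simp add: cst_def lin_ext_single)
qed (rule lin_ext_add)

text \<open>
  A family \<open>v\<close> of values on the variables of one exponent vector \<open>\<alpha>\<close> extends to monomials by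
  \<open>\<alpha> \<mapsto> \<Sum>\<^sub>j \<alpha>\<^sub>j x\<^bsup>\<alpha> - e\<^sub>j\<^esup> v\<^sub>j\<close>; the truncated difference is harmless since \<open>\<alpha>\<^sub>j = 0\<close> kills the term.
  Here \<open>x\<close>, \<open>y\<close>, \<open>z\<close> complete an exponent vector to a monomial with fixed remaining exponents.
\<close>

lemma monomial_Leibniz:
  fixes x y z :: "(nat \<Rightarrow>\<^sub>0 nat) \<Rightarrow> fn" and v :: "nat \<Rightarrow> fn"
  assumes xyz: "\<And>\<alpha> \<beta>. x (\<alpha> + \<beta>) = y \<alpha> * z \<beta>"
  defines "S \<equiv> \<lambda>x \<alpha>. \<Sum>j\<in>supp \<alpha>. cst (of_nat (coef \<alpha> j)) * x (\<alpha> - Poly_Mapping.single j 1) * v j"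
  shows "S x (\<alpha> + \<beta>) = S y \<alpha> * z \<beta> + y \<alpha> * S z \<beta>"
proof -
  let ?A = "supp \<alpha> \<union> supp \<beta>"
  have split: "S w \<gamma> = (\<Sum>j\<in>?A. cst (of_nat (coef \<gamma> j)) * w (\<gamma> - Poly_Mapping.single j 1) * v j)"
    if "supp \<gamma> \<subseteq> ?A" for \<gamma> :: "nat \<Rightarrow>\<^sub>0 nat" and w
    unfolding S_def using that by (intro sum.mono_neutral_left) (auto simp: in_keys_iff)
  have shift1: "\<alpha> + \<beta> - Poly_Mapping.single j 1 = \<alpha> - Poly_Mapping.single j 1 + \<beta>" if "coef \<alpha> j \<noteq> 0" for j
    using that by (intro poly_mapping_eqI) (auto simp: lookup_minus lookup_add lookup_single when_def)
  have shift2: "\<alpha> + \<beta> - Poly_Mapping.single j 1 = \<alpha> + (\<beta> - Poly_Mapping.single j 1)" if "coef \<beta> j \<noteq> 0" for j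
    using that by (intro poly_mapping_eqI) (auto simp: lookup_minus lookup_add lookup_single when_def)
  have "cst (of_nat (coef (\<alpha> + \<beta>) j)) * x (\<alpha> + \<beta> - Poly_Mapping.single j 1) * v j =
     (cst (of_nat (coef \<alpha> j)) * y (\<alpha> - Poly_Mapping.single j 1) * v j) * z \<beta> +
     y \<alpha> * (cst (of_nat (coef \<beta> j)) * z (\<beta> - Poly_Mapping.single j 1) * v j)" for j
  proof -
    have "cst (of_nat (coef \<alpha> j)) * x (\<alpha> + \<beta> - Poly_Mapping.single j 1) =
       cst (of_nat (coef \<alpha> j)) * y (\<alpha> - Poly_Mapping.single j 1) * z \<beta>"
      by (cases "coef \<alpha> j = 0") (use shift1[of j] in \<open>simp_all add: xyz\<close>)
    moreover have "cst (of_nat (coef \<beta> j)) * x (\<alpha> + \<beta> - Poly_Mapping.single j 1) =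
       y \<alpha> * cst (of_nat (coef \<beta> j)) * z (\<beta> - Poly_Mapping.single j 1)"
      by (cases "coef \<beta> j = 0") (use shift2[of j] in \<open>simp_all add: xyz\<close>)
    ultimately show ?thesis by (simp add: lookup_add cst_add algebra_simps)
  qed
  moreover have "supp (\<alpha> + \<beta>) \<subseteq> ?A" by (rule keys_add)
  ultimately show ?thesis
    by (simp add: split sum_distrib_left sum_distrib_right sum.distrib)
qed

text \<open>
  The three summands differentiate a monomial by its power of \<open>h\<^sub>2\<^sup>1\<^sup>/\<^sup>2\<close>, its jet variables and its time variables.
\<close>

lemma ex_der_one_side:
  "\<exists>D. der D \<and> D (h2pow 1) = vu \<and> (\<forall>k\<ge>3. D (jet_h k) = vh k) \<and> (\<forall>m. D (var_t m) = vt m) \<and>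
     D (fn_conj (h2pow 1)) = 0 \<and> (\<forall>k\<ge>3. D (jet_hb k) = 0) \<and> (\<forall>m. D (var_tb m) = 0)"
proof -
  define X :: "side \<times> side \<Rightarrow> fn" where "X = (\<lambda>k. Poly_Mapping.single k 1)"
  have X: "X (k + l) = X k * X l" for k l by (simp add: X_def mult_single)
  define M1 :: "side \<times> side \<Rightarrow> fn" where
    "M1 = (\<lambda>((p, \<alpha>, \<beta>), k). cst (of_int p) * X ((p - 1, \<alpha>, \<beta>), k) * vu)"
  define M2 :: "side \<times> side \<Rightarrow> fn" where
    "M2 = (\<lambda>((p, \<alpha>, \<beta>), k). \<Sum>j\<in>supp \<alpha>. cst (of_nat (coef \<alpha> j)) *
       X ((p, \<alpha> - Poly_Mapping.single j 1, \<beta>), k) * vh (j + 3))"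
  define M3 :: "side \<times> side \<Rightarrow> fn" where
    "M3 = (\<lambda>((p, \<alpha>, \<beta>), k). \<Sum>j\<in>supp \<beta>. cst (of_nat (coef \<beta> j)) *
       X ((p, \<alpha>, \<beta> - Poly_Mapping.single j 1), k) * vt j)"
  have 1: "M1 (k + l) = M1 k * X l + X k * M1 l" for k l
  proof -
    obtain p \<alpha> \<beta> K p' \<alpha>' \<beta>' K' where kl: "k = ((p, \<alpha>, \<beta>), K)" "l = ((p', \<alpha>', \<beta>'), K')"
      by (cases k; cases l) auto
    have "X ((p + p' - 1, \<alpha> + \<alpha>', \<beta> + \<beta>'), K + K') = X ((p - 1, \<alpha>, \<beta>), K) * X l"
      "X ((p + p' - 1, \<alpha> + \<alpha>', \<beta> + \<beta>'), K + K') = X k * X ((p' - 1, \<alpha>', \<beta>'), K')"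
      unfolding X[symmetric] kl by (simp_all add: algebra_simps)
    then have "M1 (k + l) = cst (of_int p) * (X ((p - 1, \<alpha>, \<beta>), K) * X l) * vu +
       cst (of_int p') * (X k * X ((p' - 1, \<alpha>', \<beta>'), K')) * vu"
      by (simp add: M1_def kl cst_add algebra_simps)
    then show ?thesis by (simp add: M1_def kl algebra_simps)
  qed
  have 2: "M2 (k + l) = M2 k * X l + X k * M2 l" for k l
  proof -
    obtain p \<alpha> \<beta> K p' \<alpha>' \<beta>' K' where kl: "k = ((p, \<alpha>, \<beta>), K)" "l = ((p', \<alpha>', \<beta>'), K')"
      by (cases k; cases l) auto
    have *: "X ((p + p', a + b, \<beta> + \<beta>'), K + K') = X ((p, a, \<beta>), K) * X ((p', b, \<beta>'), K')" for a b
      unfolding X[symmetric] by simp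
    show ?thesis
      unfolding kl M2_def
      using monomial_Leibniz[of "\<lambda>a. X ((p + p', a, \<beta> + \<beta>'), K + K')", OF *, where v = "\<lambda>j. vh (j + 3)"]
      by simp
  qed
  have 3: "M3 (k + l) = M3 k * X l + X k * M3 l" for k l
  proof -
    obtain p \<alpha> \<beta> K p' \<alpha>' \<beta>' K' where kl: "k = ((p, \<alpha>, \<beta>), K)" "l = ((p', \<alpha>', \<beta>'), K')"
      by (cases k; cases l) auto
    have *: "X ((p + p', \<alpha> + \<alpha>', a + b), K + K') = X ((p, \<alpha>, a), K) * X ((p', \<alpha>', b), K')" for a b
      unfolding X[symmetric] by simp
    show ?thesis
      unfolding kl M3_def
      using monomial_Leibniz[of "\<lambda>a. X ((p + p', \<alpha> + \<alpha>', a), K + K')", OF *, where v = vt]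
      by simp
  qed
  define D where "D = lin_ext (\<lambda>k. M1 k + M2 k + M3 k)"
  have der: "der D"
    unfolding D_def by (rule der_lin_ext) (simp add: 1 2 3 X_def algebra_simps)
  have X0: "X ((0, 0, 0), 0) = 1" by (simp add: X_def flip: zero_prod_def)
  have D: "D (Poly_Mapping.single k 1) = M1 k + M2 k + M3 k" for k
    by (simp add: D_def lin_ext_single)
  have "D (h2pow 1) = vu"
    by (simp add: h2pow_def D M1_def M2_def M3_def X0)
  moreover have "D (jet_h k) = vh k" if "k \<ge> 3" for k
    using that by (simp add: jet_h_def D M1_def M2_def M3_def X0)
  moreover have "D (var_t m) = vt m" for m
    by (simp add: var_t_def D M1_def M2_def M3_def X0)
  moreover have "D (fn_conj (Poly_Mapping.single (k, 0) 1)) = 0" for k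
    by (simp add: fn_conj_single D M1_def M2_def M3_def zero_prod_def)
  ultimately show ?thesis
    using der by (intro exI[of _ D]) (simp add: h2pow_def jet_hb_def jet_h_def var_tb_def var_t_def)
qed

text \<open>
  The generators are algebraically independent apart from the invertibility of \<open>h\<^sub>2\<^sup>1\<^sup>/\<^sup>2\<close>, so the
  values on them can be prescribed freely: add to a derivation supported on the unbarred variables the
  conjugate of another one.
\<close>

lemma ex_der:
  "\<exists>D. der D \<and> D (h2pow 1) = vu \<and> (\<forall>k\<ge>3. D (jet_h k) = vh k) \<and> (\<forall>m. D (var_t m) = vt m) \<and>
     D (fn_conj (h2pow 1)) = vub \<and> (\<forall>k\<ge>3. D (jet_hb k) = vhb k) \<and> (\<forall>m. D (var_tb m) = vtb m)"
proof -
  obtain D where D: "der D" "D (h2pow 1) = vu" "\<And>k. k \<ge> 3 \<Longrightarrow> D (jet_h k) = vh k" "\<And>m. D (var_t m) = vt m"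
    "D (fn_conj (h2pow 1)) = 0" "\<And>k. k \<ge> 3 \<Longrightarrow> D (jet_hb k) = 0" "\<And>m. D (var_tb m) = 0"
    using ex_der_one_side[of vu vh vt] by blast
  obtain E where E: "der E" "E (h2pow 1) = fn_conj vub" "\<And>k. k \<ge> 3 \<Longrightarrow> E (jet_h k) = fn_conj (vhb k)"
    "\<And>m. E (var_t m) = fn_conj (vtb m)"
    "E (fn_conj (h2pow 1)) = 0" "\<And>k. k \<ge> 3 \<Longrightarrow> E (jet_hb k) = 0" "\<And>m. E (var_tb m) = 0"
    using ex_der_one_side[of "fn_conj vub" "\<lambda>k. fn_conj (vhb k)" "\<lambda>m. fn_conj (vtb m)"] by blast
  have "der (\<lambda>f. D f + conj_der E f)" by (intro der_plus der_conj_der D(1) E(1))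
  then show ?thesis
    using D E by (intro exI[of _ "\<lambda>f. D f + conj_der E f"]) (simp add: conj_der_def jet_hb_def var_tb_def)
qed

section \<open>Laurent series with coefficients in the \<open>2 \<times> 2\<close> matrices\<close>

text \<open>
  As a ring type, \<open>2 \<times> 2\<close> matrices can serve as coefficients of formal Laurent series, and commutator
  identities become identities in a noncommutative ring.
\<close>

datatype 'a m2 = M2 (e11: 'a) (e12: 'a) (e21: 'a) (e22: 'a)

lemma m2_eqI: "e11 A = e11 B \<Longrightarrow> e12 A = e12 B \<Longrightarrow> e21 A = e21 B \<Longrightarrow> e22 A = e22 B \<Longrightarrow> A = B"
  by (cases A; cases B) simp

instantiation m2 :: (ring_1) ring_1
begin

definition "0 = M2 0 0 0 0"
definition "1 = M2 1 0 0 1"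
definition "A + B = M2 (e11 A + e11 B) (e12 A + e12 B) (e21 A + e21 B) (e22 A + e22 B)"
definition "A - B = M2 (e11 A - e11 B) (e12 A - e12 B) (e21 A - e21 B) (e22 A - e22 B)"
definition "- A = M2 (- e11 A) (- e12 A) (- e21 A) (- e22 A)"
definition "A * B = M2 (e11 A * e11 B + e12 A * e21 B) (e11 A * e12 B + e12 A * e22 B)
  (e21 A * e11 B + e22 A * e21 B) (e21 A * e12 B + e22 A * e22 B)"

lemmas m2_defs = zero_m2_def one_m2_def plus_m2_def minus_m2_def uminus_m2_def times_m2_def

instance
  by standard (simp_all add: m2_defs algebra_simps)

end

lemma m2_entries [simp]:
  "e11 0 = 0" "e12 0 = 0" "e21 0 = 0" "e22 0 = 0"
  "e11 1 = 1" "e12 1 = 0" "e21 1 = 0" "e22 1 = 1"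
  "e11 (A + B) = e11 A + e11 B" "e12 (A + B) = e12 A + e12 B"
  "e21 (A + B) = e21 A + e21 B" "e22 (A + B) = e22 A + e22 B"
  "e11 (A - B) = e11 A - e11 B" "e12 (A - B) = e12 A - e12 B"
  "e21 (A - B) = e21 A - e21 B" "e22 (A - B) = e22 A - e22 B"
  "e11 (- A) = - e11 A" "e12 (- A) = - e12 A" "e21 (- A) = - e21 A" "e22 (- A) = - e22 A"
  "e11 (A * B) = e11 A * e11 B + e12 A * e21 B" "e12 (A * B) = e11 A * e12 B + e12 A * e22 B"
  "e21 (A * B) = e21 A * e11 B + e22 A * e21 B" "e22 (A * B) = e21 A * e12 B + e22 A * e22 B"
  by (simp_all add: m2_defs)

lemma m2_sum: "sum F A = M2 (\<Sum>x\<in>A. e11 (F x)) (\<Sum>x\<in>A. e12 (F x)) (\<Sum>x\<in>A. e21 (F x)) (\<Sum>x\<in>A. e22 (F x))"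
  by (induction A rule: infinite_finite_induct) (simp_all add: m2_defs)

abbreviation scalar :: "'a \<Rightarrow> 'a::zero m2" where "scalar z \<equiv> M2 z 0 0 z"

lemma scalar_commute: "scalar (z :: 'a::comm_ring_1) * A = A * scalar z"
  by (rule m2_eqI) (simp_all add: mult.commute)

lemma m2_map_entries [simp]:
  "e11 (map_m2 D A) = D (e11 A)" "e12 (map_m2 D A) = D (e12 A)"
  "e21 (map_m2 D A) = D (e21 A)" "e22 (map_m2 D A) = D (e22 A)"
  by (cases A; simp)+

lemma derivation_map_m2: "derivation D \<Longrightarrow> derivation (map_m2 D)"
  by (auto simp: derivation_def intro!: m2_eqI)

subsection \<open>Coefficients and products\<close>

definition bounded_below :: "(int \<Rightarrow> 'a::zero) \<Rightarrow> bool" where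
  "bounded_below f \<longleftrightarrow> (\<exists>N. \<forall>n<N. f n = 0)"

lemma bounded_belowI: "(\<And>n. n < N \<Longrightarrow> f n = 0) \<Longrightarrow> bounded_below f"
  by (auto simp: bounded_below_def)

lemma nth_Abs_fls_bounded: "bounded_below f \<Longrightarrow> Abs_fls f $$ n = f n"
  unfolding bounded_below_def using nth_Abs_fls_lower_bound by blast

lemma fls_mult_nth_support:
  fixes F G :: "'a::ring_1 fls"
  shows "{k. F $$ k * G $$ (n - k) \<noteq> 0} \<subseteq> {fls_subdegree F..n - fls_subdegree G}"
proof
  fix k assume "k \<in> {k. F $$ k * G $$ (n - k) \<noteq> 0}"
  then have "F $$ k \<noteq> 0" "G $$ (n - k) \<noteq> 0" by auto
  then have "\<not> k < fls_subdegree F" "\<not> n - k < fls_subdegree G" by auto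
  then show "k \<in> {fls_subdegree F..n - fls_subdegree G}" by simp
qed

lemma fls_mult_nth_finite: "finite {k. F $$ k * (G :: 'a::ring_1 fls) $$ (n - k) \<noteq> 0}"
  by (rule finite_subset[OF fls_mult_nth_support]) simp

text \<open>
  The coefficients of a product of Laurent series are given by the same unrestricted sum that defines products of
  \<open>\<lambda>\<close>-series of forms.
\<close>

lemma fls_mult_nth_any: "(F * (G :: 'a::ring_1 fls)) $$ n = Sum_any (\<lambda>k. F $$ k * G $$ (n - k))"
  by (simp add: fls_times_nth(2) Sum_any.expand_superset[OF _ fls_mult_nth_support])

lemma fls_mult_nth_sum:
  fixes F G :: "'a::ring_1 fls"
  assumes "finite A" "\<And>k. k \<notin> A \<Longrightarrow> F $$ k * G $$ (n - k) = 0"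
  shows "(F * G) $$ n = (\<Sum>k\<in>A. F $$ k * G $$ (n - k))"
  unfolding fls_mult_nth_any using assms by (intro Sum_any.expand_superset) auto

text \<open>
  The scalar monomials \<open>z \<lambda>\<^sup>k\<close>. They are central although the coefficient ring is not commutative.
\<close>

definition cmon :: "int \<Rightarrow> 'a::ring_1 \<Rightarrow> 'a m2 fls" where
  "cmon k z = fls_shift (- k) (fls_const (scalar z))"

lemma cmon_nth [simp]: "cmon k z $$ n = (if n = k then scalar z else 0)"
  by (auto simp: cmon_def)

lemma cmon_mult_nth [simp]: "(cmon k z * F) $$ n = scalar z * F $$ (n - k)"
  by (simp add: cmon_def fls_shifted_times_simps)

lemma cmon_commute: "cmon k (z :: 'a::comm_ring_1) * F = F * cmon k z"
  by (simp add: fls_eq_iff) (simp add: cmon_def fls_shifted_times_simps scalar_commute)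

definition lact :: "('a \<Rightarrow> 'a) \<Rightarrow> 'a::ring_1 m2 fls \<Rightarrow> 'a m2 fls" where
  "lact D F = Abs_fls (\<lambda>n. map_m2 D (F $$ n))"

lemma map_m2_0: "D 0 = 0 \<Longrightarrow> map_m2 D 0 = 0"
  by (simp add: zero_m2_def)

lemma lact_nth: "D 0 = 0 \<Longrightarrow> lact D F $$ n = map_m2 D (F $$ n)"
  unfolding lact_def
  by (rule nth_Abs_fls_bounded, rule bounded_belowI[of "fls_subdegree F"]) (simp add: map_m2_0)

lemma derivation_lact:
  assumes "derivation D"
  shows "derivation (lact D)"
proof -
  have D0: "D 0 = 0" using assms by (rule derivation_0)
  note m = derivation_map_m2[OF assms]
  have "lact D (F * G) = lact D F * G + F * lact D G" for F G
  proof (rule fls_eqI)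
    fix n
    let ?A = "{fls_subdegree F..n - fls_subdegree G}"
    have A: "F $$ k = 0 \<or> G $$ (n - k) = 0" if "k \<notin> ?A" for k using that by auto
    have z: "map_m2 D 0 = 0" by (rule map_m2_0[where D = D, OF D0])
    have "lact D (F * G) $$ n = map_m2 D (\<Sum>k\<in>?A. F $$ k * G $$ (n - k))"
      unfolding lact_nth[where D = D, OF D0] using A by (subst fls_mult_nth_sum[of ?A]) auto
    also have "\<dots> = (\<Sum>k\<in>?A. map_m2 D (F $$ k) * G $$ (n - k)) + (\<Sum>k\<in>?A. F $$ k * map_m2 D (G $$ (n - k)))"
      by (simp add: derivation_sum[OF m] derivation_mult[OF m] sum.distrib)
    also have "(\<Sum>k\<in>?A. map_m2 D (F $$ k) * G $$ (n - k)) = (lact D F * G) $$ n"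
      by (subst fls_mult_nth_sum[of ?A]) (use A z lact_nth[where D = D, OF D0] in auto)
    also have "(\<Sum>k\<in>?A. F $$ k * map_m2 D (G $$ (n - k))) = (F * lact D G) $$ n"
      by (subst fls_mult_nth_sum[of ?A]) (use A z lact_nth[where D = D, OF D0] in auto)
    finally show "lact D (F * G) $$ n = (lact D F * G + F * lact D G) $$ n" by simp
  qed
  moreover have "lact D (F + G) = lact D F + lact D G" for F G
    by (simp add: fls_eq_iff lact_nth[where D = D, OF D0] derivation_add[OF m])
  ultimately show ?thesis by (simp add: derivation_def)
qed

lemmas lact_simps = derivation_simps[OF derivation_lact[OF der_derivation]]

lemma lact_nth_der [simp]: "der D \<Longrightarrow> lact D F $$ n = map_m2 D (F $$ n)"
  by (simp add: lact_nth der_0)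

lemma lact_cmon_cst [simp]: "der D \<Longrightarrow> lact D (cmon k (cst z)) = 0"
  by (rule fls_eqI) (auto simp: der_cst der_0 intro!: m2_eqI)

lemma lact_lincomb:
  assumes "der e" "der f" "der h"
  shows "lact (\<lambda>x. e (f x) - f (e x) + \<kappa> * h x) F =
    lact e (lact f F) - lact f (lact e F) + cmon 0 \<kappa> * lact h F"
proof (rule fls_eqI)
  fix n
  have "lact (\<lambda>x. e (f x) - f (e x) + \<kappa> * h x) F $$ n = map_m2 (\<lambda>x. e (f x) - f (e x) + \<kappa> * h x) (F $$ n)"
    by (rule lact_nth) (simp add: assms der_0)
  then show "lact (\<lambda>x. e (f x) - f (e x) + \<kappa> * h x) F $$ n =
      (lact e (lact f F) - lact f (lact e F) + cmon 0 \<kappa> * lact h F) $$ n"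
    by (auto simp: assms intro: m2_eqI)
qed

subsection \<open>Truncation in the degree\<close>

definition proj :: "int set \<Rightarrow> 'a::zero fls \<Rightarrow> 'a fls" where
  "proj S F = Abs_fls (\<lambda>n. if n \<in> S then F $$ n else 0)"

lemma proj_nth [simp]: "proj S F $$ n = (if n \<in> S then F $$ n else 0)"
  unfolding proj_def
  by (rule nth_Abs_fls_bounded, rule bounded_belowI[of "fls_subdegree F"]) simp

definition supported :: "int set \<Rightarrow> 'a::zero fls \<Rightarrow> bool" where
  "supported S F \<longleftrightarrow> (\<forall>n. n \<notin> S \<longrightarrow> F $$ n = 0)"

lemma supportedD: "supported S F \<Longrightarrow> n \<notin> S \<Longrightarrow> F $$ n = 0"
  by (simp add: supported_def)

lemma supported_proj [simp]: "supported S (proj S F)"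
  by (simp add: supported_def)

lemma proj_supported: "supported S F \<Longrightarrow> proj S F = F"
  by (simp add: fls_eq_iff supported_def)

lemma proj_disjoint: "supported T F \<Longrightarrow> S \<inter> T = {} \<Longrightarrow> proj S F = 0"
  by (auto simp: fls_eq_iff supported_def)

lemma proj_add: "proj S (F + G :: 'a::ring_1 fls) = proj S F + proj S G"
  and proj_diff: "proj S (F - G :: 'a fls) = proj S F - proj S G"
  and proj_minus: "proj S (- F :: 'a fls) = - proj S F"
  by (simp_all add: fls_eq_iff)

lemmas proj_simps = proj_add proj_diff proj_minus

lemma supported_mono: "supported S F \<Longrightarrow> S \<subseteq> T \<Longrightarrow> supported T F"
  by (auto simp: supported_def)

lemma supported_add: "supported S F \<Longrightarrow> supported S G \<Longrightarrow> supported S (F + G :: 'a::ring_1 fls)"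
  and supported_diff: "supported S F \<Longrightarrow> supported S G \<Longrightarrow> supported S (F - G :: 'a fls)"
  and supported_minus: "supported S F \<Longrightarrow> supported S (- F :: 'a fls)"
  by (simp_all add: supported_def)

lemma supported_mult:
  assumes "supported S F" "supported T G" "\<And>x y. x \<in> S \<Longrightarrow> y \<in> T \<Longrightarrow> x + y \<in> R"
  shows "supported R (F * G :: 'a::ring_1 fls)"
  unfolding supported_def fls_mult_nth_any
proof (intro allI impI)
  fix n assume n: "n \<notin> R"
  have "F $$ k * G $$ (n - k) = 0" for k
    using assms(3)[of k "n - k"] n supportedD[OF assms(1), of k] supportedD[OF assms(2), of "n - k"]
    by (cases "k \<in> S"; cases "n - k \<in> T") simp_all
  then show "Sum_any (\<lambda>k. F $$ k * G $$ (n - k)) = 0" by simp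
qed

lemma lact_proj: "der D \<Longrightarrow> lact D (proj S F) = proj S (lact D F)"
  by (simp add: fls_eq_iff map_m2_0 der_0)

definition comm :: "'a::ring \<Rightarrow> 'a \<Rightarrow> 'a" where
  "comm A B = A * B - B * A"

lemma supported_comm:
  assumes "supported S F" "supported T G" "\<And>x y. x \<in> S \<Longrightarrow> y \<in> T \<Longrightarrow> x + y \<in> R"
  shows "supported R (comm F G :: 'a::ring_1 fls)"
proof -
  have "x + y \<in> R" if "x \<in> T" "y \<in> S" for x y
    using assms(3)[OF that(2,1)] by (simp add: add.commute)
  then show ?thesis
    unfolding comm_def by (intro supported_diff supported_mult[OF assms] supported_mult[OF assms(2,1)])
qed

lemma lact_comm: "der D \<Longrightarrow> lact D (comm A B) = comm (lact D A) B + comm A (lact D B)"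
  by (simp add: comm_def lact_simps)

lemma comm_add_left: "comm (A + B) C = comm A C + comm B C"
  and comm_add_right: "comm A (B + C) = comm A B + comm A C"
  and comm_diff_left: "comm (A - B) C = comm A C - comm B C"
  and comm_diff_right: "comm A (B - C) = comm A B - comm A C"
  and comm_minus_left: "comm (- A) B = - comm A B"
  and comm_minus_right: "comm A (- B) = - comm A B"
  by (simp_all add: comm_def algebra_simps)

lemmas comm_simps = comm_add_left comm_add_right comm_diff_left comm_diff_right
  comm_minus_left comm_minus_right

subsection \<open>The conjugate transpose\<close>

definition adj :: "fn m2 \<Rightarrow> fn m2" where
  "adj A = M2 (fn_conj (e11 A)) (fn_conj (e21 A)) (fn_conj (e12 A)) (fn_conj (e22 A))"

lemma adj_entries [simp]:
  "e11 (adj A) = fn_conj (e11 A)" "e12 (adj A) = fn_conj (e21 A)"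
  "e21 (adj A) = fn_conj (e12 A)" "e22 (adj A) = fn_conj (e22 A)"
  by (simp_all add: adj_def)

lemma adj_simps [simp]:
  "adj (adj A) = A" "adj 0 = 0" "adj (A + B) = adj A + adj B" "adj (A - B) = adj A - adj B"
  "adj (- A) = - adj A"
  by (rule m2_eqI; simp)+

lemma adj_mult: "adj (A * B) = adj B * adj A"
  by (rule m2_eqI) (simp_all add: mult.commute)

lemma adj_sum: "adj (sum F A) = (\<Sum>x\<in>A. adj (F x))"
  by (induction A rule: infinite_finite_induct) simp_all

text \<open>
  Conjugation inverts \<open>\<lambda>\<close>, so the conjugate transpose of a Laurent series is a Laurent series only if
  the former is a Laurent polynomial; hence it enters as a relation.
\<close>

definition is_star :: "fn m2 fls \<Rightarrow> fn m2 fls \<Rightarrow> bool" where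
  "is_star P P' \<longleftrightarrow> (\<forall>n. P' $$ n = adj (P $$ (- n)))"

lemma is_star_sym: "is_star P P' \<Longrightarrow> is_star P' P"
  by (simp add: is_star_def)

lemma is_star_unique: "is_star P P' \<Longrightarrow> is_star P P'' \<Longrightarrow> P' = P''"
  by (simp add: is_star_def fls_eq_iff)

lemma is_star_0 [simp]: "is_star 0 0"
  by (simp add: is_star_def)

lemma is_star_add: "is_star P P' \<Longrightarrow> is_star Q Q' \<Longrightarrow> is_star (P + Q) (P' + Q')"
  and is_star_diff: "is_star P P' \<Longrightarrow> is_star Q Q' \<Longrightarrow> is_star (P - Q) (P' - Q')"
  and is_star_minus: "is_star P P' \<Longrightarrow> is_star (- P) (- P')"
  by (simp_all add: is_star_def)

text \<open>
  The reflection \<open>k \<mapsto> n + k\<close> matches the convolution sums; it exists because the sums are finite.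
\<close>

lemma is_star_mult:
  assumes "is_star P P'" "is_star Q Q'"
  shows "is_star (P * Q) (Q' * P')"
  unfolding is_star_def
proof
  fix n
  let ?A = "{k. P $$ k * Q $$ (- n - k) \<noteq> 0}"
  have A: "finite ?A" by (rule fls_mult_nth_finite)
  let ?g = "\<lambda>k. n + k"
  have Q': "Q' $$ (n + k) * P' $$ (- k) = adj (P $$ k * Q $$ (- n - k))" for k
    using assms by (simp add: is_star_def adj_mult)
  have "adj ((P * Q) $$ (- n)) = (\<Sum>k\<in>?A. adj (P $$ k * Q $$ (- n - k)))"
    using A by (subst fls_mult_nth_sum[of ?A]) (auto simp: adj_sum)
  also have "\<dots> = (\<Sum>k\<in>?A. Q' $$ (n + k) * P' $$ (n - (n + k)))" by (simp add: Q')
  also have "\<dots> = (\<Sum>l\<in>?g ` ?A. Q' $$ l * P' $$ (n - l))"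
    by (simp add: sum.reindex inj_on_def)
  also have "\<dots> = (Q' * P') $$ n"
  proof (rule fls_mult_nth_sum[symmetric])
    show "finite (?g ` ?A)" using A by simp
    fix l assume l: "l \<notin> ?g ` ?A"
    have "l - n \<notin> ?A"
    proof
      assume "l - n \<in> ?A"
      then have "?g (l - n) \<in> ?g ` ?A" by (rule imageI)
      with l show False by simp
    qed
    then have "P $$ (l - n) * Q $$ (- n - (l - n)) = 0" by blast
    then show "Q' $$ l * P' $$ (n - l) = 0" using Q'[of "l - n"] by simp
  qed
  finally show "(Q' * P') $$ n = adj ((P * Q) $$ (- n))" ..
qed

lemma is_star_comm: "is_star P P' \<Longrightarrow> is_star Q Q' \<Longrightarrow> is_star (comm P Q) (- comm P' Q')"
  unfolding comm_def using is_star_diff[OF is_star_mult is_star_mult, of P P' Q Q' Q Q' P P'] by simp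

lemma is_star_cmon: "is_star (cmon k z) (cmon (- k) (fn_conj z))"
  by (auto simp: is_star_def intro!: m2_eqI)

lemma is_star_lact: "is_star P P' \<Longrightarrow> der D \<Longrightarrow> is_star (lact D P) (lact (conj_der D) P')"
  by (auto simp: is_star_def der_conj_der conj_der_def intro!: m2_eqI)

lemma is_star_proj: "is_star P P' \<Longrightarrow> (\<And>n. n \<in> S \<longleftrightarrow> - n \<in> T) \<Longrightarrow> is_star (proj S P) (proj T P')"
  by (auto simp: is_star_def)

lemma is_star_supported: "is_star P P' \<Longrightarrow> supported S P \<Longrightarrow> (\<And>n. n \<in> S \<Longrightarrow> - n \<in> T) \<Longrightarrow> supported T P'"
  unfolding is_star_def supported_def
proof (intro allI impI)
  fix n assume *: "\<forall>n. P' $$ n = adj (P $$ - n)" "\<forall>n. n \<notin> S \<longrightarrow> P $$ n = 0"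
    "\<And>n. n \<in> S \<Longrightarrow> - n \<in> T" "n \<notin> T"
  from *(3)[of "- n"] *(4) have "- n \<notin> S" by auto
  with * show "P' $$ n = 0" by simp
qed

section \<open>Flows of a Laurent series and their curvature\<close>

text \<open>
  The derivation \<open>e\<close> moves \<open>Y\<close> by the commutator with \<open>P\<close>, and its conjugate moves \<open>Y\<close> by the commutator with
  the conjugate transpose of \<open>P\<close>. The last condition is the conjugate transpose of
  \<open>e Z = - [P, Z]\<close> for \<open>Z\<close> the conjugate transpose of \<open>Y\<close>, which is a series in \<open>\<lambda>\<^sup>-\<^sup>1\<close>; in this form all
  computations take place in Laurent series in \<open>\<lambda>\<close>.
\<close>

definition flow :: "fn m2 fls \<Rightarrow> (fn \<Rightarrow> fn) \<Rightarrow> fn m2 fls \<Rightarrow> fn m2 fls \<Rightarrow> bool" where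
  "flow Y e P P' \<longleftrightarrow> der e \<and> is_star P P' \<and>
     lact e Y = - comm P Y \<and> lact (conj_der e) Y = comm P' Y"

text \<open>
  The component of \<open>d\<phi> + \<phi> \<and> \<phi>\<close> along two vector fields \<open>e\<close>, \<open>f\<close> on which \<open>\<phi>\<close> takes the values \<open>P\<close>, \<open>Q\<close>;
  the summand \<open>Z\<close> is the contribution of the bracket of the two vector fields.
\<close>

definition curvature ::
  "(fn \<Rightarrow> fn) \<Rightarrow> fn m2 fls \<Rightarrow> (fn \<Rightarrow> fn) \<Rightarrow> fn m2 fls \<Rightarrow> fn m2 fls \<Rightarrow> fn m2 fls" where
  "curvature e P f Q Z = lact e Q - lact f P + comm P Q + Z"

text \<open>
  The conjugate transpose reverses commutators, so up to sign it carries the curvature of \<open>P\<close>, \<open>Q\<close> to that of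
  \<open>- P'\<close>, \<open>- Q'\<close>. This transports flatness from the flows \<open>t\<^sub>m\<close> to the flows \<open>tbar\<^sub>m\<close>.
\<close>

lemma curvature_conj:
  assumes "curvature e P f Q Z = 0" "der e" "der f" "is_star P P'" "is_star Q Q'" "is_star Z Z'"
  shows "curvature (conj_der e) (- P') (conj_der f) (- Q') (- Z') = 0"
proof -
  have "is_star (curvature e P f Q Z)
     (lact (conj_der e) Q' - lact (conj_der f) P' + - comm P' Q' + Z')"
    unfolding curvature_def by (intro is_star_add is_star_diff is_star_lact is_star_comm assms)
  with assms(1) have "lact (conj_der e) Q' - lact (conj_der f) P' + - comm P' Q' + Z' = 0"
    using is_star_unique[OF _ is_star_0] by auto
  then have "- (lact (conj_der e) Q' - lact (conj_der f) P' + - comm P' Q' + Z') = - 0" by (simp only:)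
  then show ?thesis
    using assms(2,3) by (simp add: curvature_def lact_simps der_conj_der comm_simps algebra_simps)
qed

lemma comm_Jacobi: "comm (comm A B) C = comm A (comm B C) - comm B (comm A C)"
  by (simp add: comm_def algebra_simps)

text \<open>
  By the Jacobi identity the commutator of two flows acts through the commutator with their curvature.
\<close>

lemma flat_flows_commute_aux:
  assumes "der e" "der f" "der h"
    and Y: "lact e Y = - comm P Y" "lact f Y = - comm Q Y" "lact h Y = - comm S Y"
    and flat: "curvature e P f Q (cmon 0 \<kappa> * S) = 0"
  shows "lact (\<lambda>x. e (f x) - f (e x) + \<kappa> * h x) Y = 0"
proof -
  have C: "cmon 0 \<kappa> * comm S Y = comm (cmon 0 \<kappa> * S) Y"
    by (simp add: comm_def right_diff_distrib mult.assoc) (simp flip: mult.assoc add: cmon_commute[of 0 \<kappa> Y])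
  have "lact (\<lambda>x. e (f x) - f (e x) + \<kappa> * h x) Y = - comm (curvature e P f Q (cmon 0 \<kappa> * S)) Y"
    unfolding lact_lincomb[OF assms(1-3)] Y curvature_def
    by (simp add: lact_simps assms lact_comm Y comm_simps comm_Jacobi C)
  then show ?thesis by (simp add: flat comm_def)
qed

lemma flat_flows_commute:
  assumes e: "flow Y e P P'" and f: "flow Y f Q Q'" and h: "flow Y h S S'"
    and flat: "curvature e P f Q (cmon 0 \<kappa> * S) = 0"
  defines "K \<equiv> \<lambda>x. e (f x) - f (e x) + \<kappa> * h x"
  shows "lact K Y = 0" "lact (conj_der K) Y = 0"
proof -
  note d = e[unfolded flow_def] f[unfolded flow_def] h[unfolded flow_def]
  show "lact K Y = 0"
    unfolding K_def by (rule flat_flows_commute_aux[of _ _ _ Y P Q S]) (use d flat in auto)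
  have "is_star (cmon 0 \<kappa> * S) (cmon 0 (fn_conj \<kappa>) * S')"
    using is_star_mult[OF is_star_cmon[of 0 \<kappa>], of S S'] d by (simp add: cmon_commute)
  then have "curvature (conj_der e) (- P') (conj_der f) (- Q') (cmon 0 (fn_conj \<kappa>) * (- S')) = 0"
    using curvature_conj[OF flat] d by simp
  then have "lact (\<lambda>x. conj_der e (conj_der f x) - conj_der f (conj_der e x) + fn_conj \<kappa> * conj_der h x) Y = 0"
    by (intro flat_flows_commute_aux[of _ _ _ Y "- P'" "- Q'" "- S'"]) (use d in \<open>auto simp: der_conj_der comm_simps\<close>)
  moreover have "conj_der K = (\<lambda>x. conj_der e (conj_der f x) - conj_der f (conj_der e x) + fn_conj \<kappa> * conj_der h x)"
    by (simp add: K_def conj_der_def fun_eq_iff)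
  ultimately show "lact (conj_der K) Y = 0" by simp
qed

subsection \<open>The polynomials of the hierarchy\<close>

text \<open>
  \<open>\<lambda>\<^bsup>-2m-2\<^esup> Y / 2i\<close>, its part of negative degree, the conjugate transpose of that part, and the value
  of \<open>\<phi>\<^sub>0\<close> on the dual of \<open>\<rho>\<close>.
\<close>

definition Vser :: "fn m2 fls \<Rightarrow> nat \<Rightarrow> fn m2 fls" where
  "Vser Y m = cmon (- 2 * int m - 2) (cst (1 / (2 * \<i>))) * Y"

definition Upol :: "fn m2 fls \<Rightarrow> nat \<Rightarrow> fn m2 fls" where
  "Upol Y m = proj {..<0} (Vser Y m)"

definition Qpol :: "fn m2 fls \<Rightarrow> nat \<Rightarrow> fn m2 fls" where
  "Qpol Y m = Abs_fls (\<lambda>n. adj (Upol Y m $$ (- n)))"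

definition Srho :: "fn m2 fls" where
  "Srho = fls_const (M2 (cst (\<i> / 2)) 0 0 (cst (- \<i> / 2)))"

lemma Upol_supported: "supported {..<0} (Upol Y m)"
  by (simp add: Upol_def)

lemma is_star_Qpol: "is_star (Upol Y m) (Qpol Y m)"
proof -
  have "bounded_below (\<lambda>n. adj (Upol Y m $$ (- n)))"
    by (rule bounded_belowI[of 0]) (simp add: Upol_def)
  then show ?thesis by (simp add: is_star_def Qpol_def nth_Abs_fls_bounded)
qed

lemma Qpol_supported: "supported {0<..} (Qpol Y m)"
  by (rule is_star_supported[OF is_star_Qpol Upol_supported]) simp

lemma Vser_split: "Vser Y m = Upol Y m + proj {0..} (Vser Y m)"
  by (simp add: fls_eq_iff Upol_def)

lemma Srho_nth: "Srho $$ n = (if n = 0 then M2 (cst (\<i> / 2)) 0 0 (cst (- \<i> / 2)) else 0)"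
  by (simp add: Srho_def)

lemma is_star_Srho: "is_star Srho (- Srho)"
  by (auto simp: is_star_def Srho_nth intro!: m2_eqI simp flip: cst_minus)

lemma Srho_supported: "supported {0} Srho"
  by (simp add: supported_def Srho_nth)

lemma lact_Srho [simp]: "der D \<Longrightarrow> lact D Srho = 0"
  by (rule fls_eqI) (auto simp: Srho_nth der_cst der_0 intro!: m2_eqI)

lemma comm_Vser: "comm P (Vser Y m) = cmon (- 2 * int m - 2) (cst (1 / (2 * \<i>))) * comm P Y"
  unfolding Vser_def comm_def right_diff_distrib mult.assoc[symmetric] cmon_commute[of _ _ P] ..

lemma lact_Vser: "der e \<Longrightarrow> lact e Y = - comm P Y \<Longrightarrow> lact e (Vser Y m) = - comm P (Vser Y m)"
  unfolding comm_Vser by (simp add: Vser_def lact_simps)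

lemma lact_Upol: "der e \<Longrightarrow> lact e Y = - comm P Y \<Longrightarrow> lact e (Upol Y m) = - proj {..<0} (comm P (Vser Y m))"
  unfolding Upol_def by (simp add: lact_proj lact_Vser proj_minus)

text \<open>
  The part of \<open>V\<^sub>m\<close> of degree \<open>\<ge> 0\<close> cannot contribute, since \<open>P\<close> does not lower degrees.
\<close>

lemma proj_neg_comm_Vser:
  assumes "supported {0..} P"
  shows "proj {..<0} (comm P (Vser Y m)) = proj {..<0} (comm P (Upol Y m))"
proof -
  have "supported {0..} (comm P (proj {0..} (Vser Y m)))"
    by (rule supported_comm[OF assms supported_proj]) simp
  then have "proj {..<0} (comm P (proj {0..} (Vser Y m))) = 0"
    by (rule proj_disjoint) auto
  then show ?thesis by (subst Vser_split) (simp add: comm_simps proj_simps)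
qed

lemma comm_Vser_Vser: "comm (Vser Y m) (Vser Y l) = 0"
proof -
  have "comm (Vser Y m) Y = 0"
    by (simp add: comm_def Vser_def cmon_commute[of _ _ Y] mult.assoc)
  then show ?thesis by (simp add: comm_Vser)
qed

text \<open>
  Expand \<open>[V\<^sub>m, V\<^sub>l] = 0\<close> along \<open>V = U + W\<close>. The commutator of the two parts of degree \<open>\<ge> 0\<close> has no negative degrees,
  and \<open>[U\<^sub>m, U\<^sub>l]\<close> has only negative ones; what remains is the asserted identity.
\<close>

lemma flat_tt:
  assumes "der e" "der f" and "lact e Y = - comm (Upol Y m) Y" "lact f Y = - comm (Upol Y l) Y"
  shows "curvature e (Upol Y m) f (Upol Y l) 0 = 0"
proof -
  let ?p = "proj {..<0 :: int}" and ?W = "\<lambda>m. proj {0..} (Vser Y m)"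
  have neg: "?p (comm (Upol Y m) (Upol Y l)) = comm (Upol Y m) (Upol Y l)"
    by (rule proj_supported, rule supported_comm[OF Upol_supported Upol_supported]) auto
  have "comm (Upol Y m + ?W m) (Vser Y l) = 0"
    using comm_Vser_Vser[of Y m l] by (subst (asm) Vser_split[of Y m])
  then have "comm (Upol Y m) (Vser Y l) = - comm (?W m) (Vser Y l)"
    by (simp add: comm_simps eq_neg_iff_add_eq_0)
  then have 1: "?p (comm (Upol Y m) (Vser Y l)) = - ?p (comm (?W m) (Upol Y l))"
    by (simp add: proj_simps proj_neg_comm_Vser)
  have 2: "?p (comm (Upol Y l) (Vser Y m)) = ?p (comm (Upol Y l) (Upol Y m)) + ?p (comm (Upol Y l) (?W m))"
    by (subst Vser_split[of Y m]) (simp add: comm_simps proj_simps)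
  have 3: "comm A B = - comm B A" for A B :: "fn m2 fls" by (simp add: comm_def)
  show ?thesis
    unfolding curvature_def lact_Upol[OF assms(1,3)] lact_Upol[OF assms(2,4)] 1 2
    using neg by (simp add: 3[of "Upol Y l"] proj_simps)
qed

text \<open>
  The conjugate of \<open>e\<close> acts on \<open>U\<^sub>m\<close> by the negative part of a commutator; conjugate transposition turns this into the
  positive part.
\<close>

lemma lact_Qpol:
  assumes "der e" "supported {0<..} P" "is_star P' P" "lact (conj_der e) Y = comm P Y"
  shows "lact e (Qpol Y m) = proj {0<..} (comm (Qpol Y m) P')"
proof -
  have "lact (conj_der e) (Upol Y m) = - proj {..<0} (comm (- P) (Vser Y m))"
    by (rule lact_Upol) (use assms in \<open>auto simp: der_conj_der comm_simps\<close>)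
  also have "\<dots> = proj {..<0} (comm P (Vser Y m))"
    by (simp add: comm_simps proj_simps)
  also have "\<dots> = proj {..<0} (comm P (Upol Y m))"
    by (rule proj_neg_comm_Vser) (use assms(2) in \<open>auto intro: supported_mono\<close>)
  finally have "is_star (proj {..<0} (comm P (Upol Y m))) (lact (conj_der (conj_der e)) (Qpol Y m))"
    using is_star_lact[OF is_star_Qpol der_conj_der[OF assms(1)], of Y m] by simp
  moreover have "is_star (proj {..<0} (comm P (Upol Y m))) (proj {0<..} (- comm P' (Qpol Y m)))"
    by (rule is_star_proj[OF is_star_comm[OF is_star_sym[OF assms(3)] is_star_Qpol]]) auto
  ultimately have "lact e (Qpol Y m) = proj {0<..} (- comm P' (Qpol Y m))"
    using is_star_unique by fastforce
  also have "- comm P' (Qpol Y m) = comm (Qpol Y m) P'" by (simp add: comm_def)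
  finally show ?thesis .
qed

text \<open>
  The derivatives of \<open>Q\<^sub>l\<close> and \<open>U\<^sub>m\<close> are the positive and the negative part of the same commutator
  \<open>[Q\<^sub>l, U\<^sub>m]\<close>, so only its part of degree 0 has to be compensated: this is the source of the terms
  \<open>dt\<^sub>m \<and> dtbar\<^sub>l\<close> in \<open>d\<rho>\<close>.
\<close>

lemma flat_ttb:
  assumes "der e" "der f" and "lact (conj_der e) Y = comm (Qpol Y m) Y" "lact f Y = comm (Qpol Y l) Y"
  shows "curvature e (Upol Y m) f (- Qpol Y l) (- proj {0} (comm (Qpol Y l) (Upol Y m))) = 0"
proof -
  have 1: "lact e (Qpol Y l) = proj {0<..} (comm (Qpol Y l) (Upol Y m))"
    by (rule lact_Qpol[OF assms(1) Qpol_supported[of Y m] is_star_Qpol assms(3)])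
  have "lact f (Upol Y m) = - proj {..<0} (comm (- Qpol Y l) (Vser Y m))"
    by (rule lact_Upol) (use assms in \<open>auto simp: comm_simps\<close>)
  also have "\<dots> = proj {..<0} (comm (Qpol Y l) (Upol Y m))"
  proof -
    have "supported {0..} (Qpol Y l)" by (rule supported_mono[OF Qpol_supported]) auto
    then show ?thesis by (simp add: comm_simps proj_simps proj_neg_comm_Vser)
  qed
  finally have 2: "lact f (Upol Y m) = proj {..<0} (comm (Qpol Y l) (Upol Y m))" .
  have 3: "comm (Upol Y m) (Qpol Y l) = - comm (Qpol Y l) (Upol Y m)" by (simp add: comm_def)
  have "- proj {0<..} X - proj {..<0} X + X = proj {0} X" for X :: "fn m2 fls"
    by (simp add: fls_eq_iff)
  from this[of "comm (Qpol Y l) (Upol Y m)"] show ?thesis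
    using assms(1) by (simp add: curvature_def lact_simps 1 2 3 comm_simps)
qed

text \<open>
  The commutator with the constant matrix \<open>s\<close> preserves degrees, hence commutes with truncation.
\<close>

lemma flat_rho:
  assumes "der h" "der e" and "lact h Y = - comm Srho Y"
  shows "curvature h Srho e (Upol Y m) 0 = 0"
proof -
  have "proj {..<0} (comm Srho (Vser Y m)) = comm Srho (Upol Y m)"
  proof -
    have "proj {..<0} (comm Srho (Vser Y m)) = proj {..<0} (comm Srho (Upol Y m))"
      by (rule proj_neg_comm_Vser, rule supported_mono[OF Srho_supported]) simp
    also have "\<dots> = comm Srho (Upol Y m)"
      by (rule proj_supported, rule supported_comm[OF Srho_supported Upol_supported]) auto
    finally show ?thesis .
  qed
  then show ?thesis by (simp add: curvature_def lact_Upol[OF assms(1,3)] assms(2))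
qed

section \<open>Differential forms and antiderivations\<close>

subsection \<open>Forms of a fixed degree\<close>

lemma pos_inj: "pos g = pos h \<Longrightarrow> g = h"
  by (cases g; cases h) (simp_all, presburger+)

lemma pos_linear: "g \<noteq> h \<Longrightarrow> pos g < pos h \<or> pos h < pos g"
  using pos_inj by (meson linorder_neqE_nat)

lemma OmegaD: "\<alpha> \<in> Omega k \<Longrightarrow> \<alpha> S \<noteq> 0 \<Longrightarrow> finite S \<and> card S = k"
  by (simp add: Omega_def)

lemma OmegaI: "(\<And>S. \<alpha> S \<noteq> 0 \<Longrightarrow> finite S \<and> card S = k) \<Longrightarrow> \<alpha> \<in> Omega k"
  by (simp add: Omega_def)

lemma Omega_infinite: "\<alpha> \<in> Omega k \<Longrightarrow> infinite S \<Longrightarrow> \<alpha> S = 0"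
  using OmegaD by blast

lemma Omega_0 [simp]: "0 \<in> Omega k"
  by (simp add: Omega_def)

lemma Omega_add: "\<alpha> \<in> Omega k \<Longrightarrow> \<beta> \<in> Omega k \<Longrightarrow> \<alpha> + \<beta> \<in> Omega k"
proof (rule OmegaI)
  fix S assume \<alpha>\<beta>: "\<alpha> \<in> Omega k" "\<beta> \<in> Omega k" and "(\<alpha> + \<beta>) S \<noteq> 0"
  then have "\<alpha> S \<noteq> 0 \<or> \<beta> S \<noteq> 0" by auto
  then show "finite S \<and> card S = k" using OmegaD \<alpha>\<beta> by blast
qed

lemma Omega_minus: "\<alpha> \<in> Omega k \<Longrightarrow> - \<alpha> \<in> Omega k"
  by (simp add: Omega_def)

lemma Omega_diff: "\<alpha> \<in> Omega k \<Longrightarrow> \<beta> \<in> Omega k \<Longrightarrow> \<alpha> - \<beta> \<in> Omega k"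
  using Omega_add[OF _ Omega_minus] by fastforce

lemma Omega_smult: "\<alpha> \<in> Omega k \<Longrightarrow> smult f \<alpha> \<in> Omega k"
proof (rule OmegaI)
  fix S assume "\<alpha> \<in> Omega k" "smult f \<alpha> S \<noteq> 0"
  then show "finite S \<and> card S = k" using OmegaD[of \<alpha> k S] by (cases "\<alpha> S = 0") (simp_all add: smult_def)
qed

lemma sum_form_apply: "sum F A S = (\<Sum>x\<in>A. F x S)" for F :: "'i \<Rightarrow> form"
  by (induction A rule: infinite_finite_induct) simp_all

lemma Omega_sum: "(\<And>x. x \<in> A \<Longrightarrow> F x \<in> Omega k) \<Longrightarrow> sum F A \<in> Omega k"
  by (induction A rule: infinite_finite_induct) (auto intro: Omega_add)

lemma Omega_fsum: "(\<And>i. F i \<in> Omega k) \<Longrightarrow> fsum F \<in> Omega k"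
proof (rule OmegaI)
  fix S assume F: "\<And>i. F i \<in> Omega k" and "fsum F S \<noteq> 0"
  then have "\<exists>i. F i S \<noteq> 0"
    by (rule_tac ccontr) (simp add: fsum_def)
  then show "finite S \<and> card S = k" using F OmegaD by blast
qed

lemma Omega_fn0 [simp]: "fn0 f \<in> Omega 0"
  by (auto simp: Omega_def fn0_def)

lemma Omega_theta [simp]: "theta g \<in> Omega 1" "theta g \<in> Omega (Suc 0)"
  by (auto simp: Omega_def theta_def)

lemma Omega_wedge:
  assumes "\<alpha> \<in> Omega j" "\<beta> \<in> Omega k"
  shows "\<alpha> \<and>\<^sub>f \<beta> \<in> Omega (j + k)"
proof (rule OmegaI)
  fix S assume *: "(\<alpha> \<and>\<^sub>f \<beta>) S \<noteq> 0"
  then have fin: "finite S"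
    by (rule_tac ccontr) (simp add: wedge_def)
  have "\<exists>T. T \<subseteq> S \<and> \<alpha> T \<noteq> 0 \<and> \<beta> (S - T) \<noteq> 0"
  proof (rule ccontr)
    assume "\<nexists>T. T \<subseteq> S \<and> \<alpha> T \<noteq> 0 \<and> \<beta> (S - T) \<noteq> 0"
    then have "\<forall>T\<in>Pow S. wsign T (S - T) * \<alpha> T * \<beta> (S - T) = 0" by auto
    then have "(\<alpha> \<and>\<^sub>f \<beta>) S = 0" unfolding wedge_def by (rule sum.neutral)
    with * show False by simp
  qed
  then obtain T where T: "T \<subseteq> S" "\<alpha> T \<noteq> 0" "\<beta> (S - T) \<noteq> 0" by blast
  have "card T = j" "card (S - T) = k" using OmegaD[OF assms(1) T(2)] OmegaD[OF assms(2) T(3)] by simp_all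
  then have "card S = j + k"
    using card_mono[OF fin T(1)] T(1) fin by (simp add: card_Diff_subset finite_subset)
  then show "finite S \<and> card S = j + k" using fin by simp
qed

lemma smult_apply [simp]: "smult f \<alpha> S = f * \<alpha> S"
  by (simp add: smult_def)

lemma fn0_apply: "fn0 f S = (if S = {} then f else 0)"
  by (simp add: fn0_def)

lemma smult_smult: "smult f (smult g \<alpha>) = smult (f * g) \<alpha>"
  by (simp add: fun_eq_iff mult.assoc)

lemma wsign_empty [simp]: "wsign {} S = 1" "wsign S {} = 1"
  by (simp_all add: wsign_def)

text \<open>
  Homogeneity is essential here: on infinite index sets the wedge product is 0 by convention.
\<close>

lemma fn0_wedge: "\<alpha> \<in> Omega k \<Longrightarrow> fn0 f \<and>\<^sub>f \<alpha> = smult f \<alpha>"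
proof
  fix S assume \<alpha>: "\<alpha> \<in> Omega k"
  show "(fn0 f \<and>\<^sub>f \<alpha>) S = smult f \<alpha> S"
  proof (cases "finite S")
    case True
    then have "(fn0 f \<and>\<^sub>f \<alpha>) S = (\<Sum>T\<in>{{}}. wsign T (S - T) * fn0 f T * \<alpha> (S - T))"
      unfolding wedge_def by (intro sum.mono_neutral_right) (auto simp: fn0_def)
    then show ?thesis by (simp add: fn0_def)
  qed (simp add: wedge_def Omega_infinite[OF \<alpha>])
qed

lemma wedge_fn0: "\<alpha> \<in> Omega k \<Longrightarrow> \<alpha> \<and>\<^sub>f fn0 f = smult f \<alpha>"
proof
  fix S assume \<alpha>: "\<alpha> \<in> Omega k"
  show "(\<alpha> \<and>\<^sub>f fn0 f) S = smult f \<alpha> S"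
  proof (cases "finite S")
    case True
    then have "(\<alpha> \<and>\<^sub>f fn0 f) S = (\<Sum>T\<in>{S}. wsign T (S - T) * \<alpha> T * fn0 f (S - T))"
      unfolding wedge_def by (intro sum.mono_neutral_right) (auto simp: fn0_def)
    then show ?thesis by (simp add: fn0_def mult.commute)
  qed (simp add: wedge_def Omega_infinite[OF \<alpha>])
qed

lemma wedge_0 [simp]: "0 \<and>\<^sub>f \<alpha> = 0" "\<alpha> \<and>\<^sub>f 0 = 0"
  by (simp_all add: wedge_def fun_eq_iff)

lemma fn0_0 [simp]: "fn0 0 = 0"
  by (simp add: fn0_def fun_eq_iff)

lemma fn0_mult: "fn0 (f * g) = fn0 f \<and>\<^sub>f fn0 g"
  by (simp add: fn0_wedge[OF Omega_fn0]) (simp add: fun_eq_iff fn0_def)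

lemma fn0_add: "fn0 (f + g) = fn0 f + fn0 g"
  by (simp add: fun_eq_iff fn0_def)

lemma Omega_1_eqI:
  assumes "\<alpha> \<in> Omega 1" "\<beta> \<in> Omega 1" "\<And>g. \<alpha> {g} = \<beta> {g}"
  shows "\<alpha> = \<beta>"
proof
  fix S
  show "\<alpha> S = \<beta> S"
  proof (cases "\<exists>g. S = {g}")
    case False
    then have "card S \<noteq> 1" by (auto simp: card_1_singleton_iff)
    then have "\<alpha> S = 0" "\<beta> S = 0" using OmegaD[OF assms(1), of S] OmegaD[OF assms(2), of S] by blast+
    then show ?thesis by simp
  qed (use assms(3) in auto)
qed

lemma Omega_2_eqI:
  assumes "\<alpha> \<in> Omega 2" "\<beta> \<in> Omega 2" "\<And>g h. pos g < pos h \<Longrightarrow> \<alpha> {g, h} = \<beta> {g, h}"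
  shows "\<alpha> = \<beta>"
proof
  fix S
  show "\<alpha> S = \<beta> S"
  proof (cases "card S = 2")
    case True
    then obtain g h where S: "S = {g, h}" "g \<noteq> h" by (meson card_2_iff)
    then show ?thesis using assms(3)[of g h] assms(3)[of h g] pos_linear[of g h] by (auto simp: insert_commute)
  next
    case False
    then have "\<alpha> S = 0" "\<beta> S = 0" using OmegaD[OF assms(1), of S] OmegaD[OF assms(2), of S] by blast+
    then show ?thesis by simp
  qed
qed

lemma wsign_pair: "wsign {g} {h} = (if pos h < pos g then - 1 else 1)"
proof -
  have "{(x, y). x \<in> {g} \<and> y \<in> {h} \<and> pos y < pos x} = (if pos h < pos g then {(g, h)} else {})"
    by auto
  then show ?thesis by (simp add: wsign_def)
qed

lemma wedge_pair:
  assumes "\<alpha> \<in> Omega 1" "\<beta> \<in> Omega 1" "pos g < pos h"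
  shows "(\<alpha> \<and>\<^sub>f \<beta>) {g, h} = \<alpha> {g} * \<beta> {h} - \<alpha> {h} * \<beta> {g}"
proof -
  have 0: "\<alpha> {} = 0" "\<beta> {} = 0" using OmegaD[OF assms(1), of "{}"] OmegaD[OF assms(2), of "{}"] by auto
  have ne: "g \<noteq> h" using assms(3) by auto
  then have Pow: "Pow {g, h} = {{}, {g}, {h}, {g, h}}" by auto
  have D: "{g, h} - {g} = {h}" "{g, h} - {h} = {g}" using ne by auto
  have ns: "{g} \<noteq> {h}" "{g} \<noteq> {g, h}" "{h} \<noteq> {g, h}" using ne by auto
  show ?thesis
    unfolding wedge_def Pow using ns ne assms(3) by (simp add: D 0 wsign_pair)
qed

lemma wedge_single_fn0:
  "\<alpha> \<in> Omega 1 \<Longrightarrow> (\<alpha> \<and>\<^sub>f fn0 f) {g} = \<alpha> {g} * f" "\<alpha> \<in> Omega 1 \<Longrightarrow> (fn0 f \<and>\<^sub>f \<alpha>) {g} = f * \<alpha> {g}"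
  by (simp_all add: wedge_fn0 fn0_wedge mult.commute)

subsection \<open>The frame of closed coframe elements\<close>

text \<open>
  The factors by which \<open>dt\<^sub>0\<close>, \<open>dtbar\<^sub>0\<close> differ from \<open>\<xi>\<close>, \<open>\<xi>bar\<close>, and their inverses. After this rescaling
  every coframe element except \<open>\<rho>\<close> is the differential of a time variable.
\<close>

definition eta :: "coframe \<Rightarrow> fn" where
  "eta g = (case g of Xi \<Rightarrow> cst (- 1 / 2) * h2pow 1 | Xib \<Rightarrow> cst (- 1 / 2) * fn_conj (h2pow 1) | _ \<Rightarrow> 1)"

definition ieta :: "coframe \<Rightarrow> fn" where
  "ieta g = (case g of Xi \<Rightarrow> cst (- 2) * h2pow (- 1) | Xib \<Rightarrow> cst (- 2) * fn_conj (h2pow (- 1)) | _ \<Rightarrow> 1)"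

lemma conj_h2pow_inverse: "fn_conj (h2pow 1) * fn_conj (h2pow (- 1)) = 1"
  by (simp flip: fn_conj_mult)

lemma eta_ieta [simp]: "eta g * ieta g = 1" "ieta g * eta g = 1"
proof -
  have "cst (- 1 / 2) * x * (cst (- 2) * y) = cst ((- 1 / 2) * (- 2)) * (x * y)" for x y
    unfolding cst_mult by (simp only: ac_simps)
  then show "eta g * ieta g = 1" by (cases g) (simp_all add: eta_def ieta_def conj_h2pow_inverse)
  then show "ieta g * eta g = 1" by (simp add: mult.commute)
qed

definition beta :: "coframe \<Rightarrow> form" where
  "beta g = smult (eta g) (theta g)"

lemma beta_Omega [simp]: "beta g \<in> Omega 1" "beta g \<in> Omega (Suc 0)"
  by (simp_all add: beta_def Omega_smult)

lemma beta_apply: "beta g S = (if S = {g} then eta g else 0)"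
  by (simp add: beta_def theta_def)

text \<open>
  The coframe elements proportional to \<open>dt\<^sub>m\<close> and \<open>dtbar\<^sub>m\<close>, now uniformly for all \<open>m \<ge> 0\<close>.
\<close>

definition gT :: "nat \<Rightarrow> coframe" where
  "gT m = (case m of 0 \<Rightarrow> Xi | Suc n \<Rightarrow> DT n)"

definition gTb :: "nat \<Rightarrow> coframe" where
  "gTb m = (case m of 0 \<Rightarrow> Xib | Suc n \<Rightarrow> DTb n)"

lemma dt_beta: "dt m = beta (gT m)" and dtb_beta: "dtb m = beta (gTb m)"
  by (cases m; simp add: dt_def dtb_def beta_def gT_def gTb_def eta_def fun_eq_iff)+

lemma gT_simps [simp]: "gT 0 = Xi" "gT (Suc n) = DT n" "gTb 0 = Xib" "gTb (Suc n) = DTb n"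
  by (simp_all add: gT_def gTb_def)

lemma coframe_cases [case_names rho t tb]:
  obtains "g = Rho" | m where "g = gT m" | m where "g = gTb m"
proof (cases g)
  case Xi
  then show thesis by (intro that(2)[of 0]) simp
next
  case Xib
  then show thesis by (intro that(3)[of 0]) simp
next
  case (DT n)
  then show thesis by (intro that(2)[of "Suc n"]) simp
next
  case (DTb n)
  then show thesis by (intro that(3)[of "Suc n"]) simp
qed (rule that(1))

lemma gT_inject [simp]: "gT m = gT l \<longleftrightarrow> m = l" "gTb m = gTb l \<longleftrightarrow> m = l"
  "gT m \<noteq> gTb l" "gTb l \<noteq> gT m" "gT m \<noteq> Rho" "gTb m \<noteq> Rho" "Rho \<noteq> gT m" "Rho \<noteq> gTb m"
  by (cases m; cases l; simp)+

subsection \<open>Consequences of the antiderivation property\<close>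

text \<open>
  The vector fields dual to the given coframe and to the rescaled one.
\<close>

definition vf :: "(form \<Rightarrow> form) \<Rightarrow> coframe \<Rightarrow> fn \<Rightarrow> fn" where
  "vf d g f = d (fn0 f) {g}"

definition evf :: "(form \<Rightarrow> form) \<Rightarrow> coframe \<Rightarrow> fn \<Rightarrow> fn" where
  "evf d g f = ieta g * vf d g f"

lemma vf_evf: "vf d g f = eta g * evf d g f"
  by (simp add: evf_def flip: mult.assoc)

locale antider =
  fixes d :: "form \<Rightarrow> form"
  assumes antiderivation: "antiderivation d"
begin

lemma d_Omega: "\<alpha> \<in> Omega k \<Longrightarrow> d \<alpha> \<in> Omega (Suc k)"
  and d_add: "\<alpha> \<in> Omega k \<Longrightarrow> \<beta> \<in> Omega k \<Longrightarrow> d (\<alpha> + \<beta>) = d \<alpha> + d \<beta>"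
  and d_cst: "d (fn0 (cst z)) = 0"
  and d_wedge: "\<alpha> \<in> Omega j \<Longrightarrow> \<beta> \<in> Omega k \<Longrightarrow>
        d (\<alpha> \<and>\<^sub>f \<beta>) = d \<alpha> \<and>\<^sub>f \<beta> + smult ((- 1) ^ j) (\<alpha> \<and>\<^sub>f d \<beta>)"
  and d_continuous: "\<exists>F. finite F \<and> (\<forall>\<alpha>\<in>Omega k. (\<forall>T\<in>F. \<alpha> T = 0) \<longrightarrow> d \<alpha> S = 0)"
  using antiderivation unfolding antiderivation_def by blast+

lemma d_depends:
  obtains F where "finite F" "\<And>\<alpha>. \<alpha> \<in> Omega k \<Longrightarrow> (\<And>T. T \<in> F \<Longrightarrow> \<alpha> T = 0) \<Longrightarrow> d \<alpha> S = 0"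
proof -
  obtain F where "finite F \<and> (\<forall>\<alpha>\<in>Omega k. (\<forall>T\<in>F. \<alpha> T = 0) \<longrightarrow> d \<alpha> S = 0)"
    using d_continuous[of k S] by (rule exE)
  then show thesis by (intro that[of F]) simp_all
qed

lemma d_0 [simp]: "d 0 = 0"
  using d_add[OF Omega_0 Omega_0] by simp

lemma d_minus: "\<alpha> \<in> Omega k \<Longrightarrow> d (- \<alpha>) = - d \<alpha>"
  using d_add[OF _ Omega_minus, of \<alpha> k \<alpha>] by (simp add: eq_neg_iff_add_eq_0 add.commute)

lemma d_diff: "\<alpha> \<in> Omega k \<Longrightarrow> \<beta> \<in> Omega k \<Longrightarrow> d (\<alpha> - \<beta>) = d \<alpha> - d \<beta>"
  using d_add[OF _ Omega_minus, of \<alpha> k \<beta>] by (simp add: d_minus)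

lemma d_sum: "(\<And>x. x \<in> A \<Longrightarrow> F x \<in> Omega k) \<Longrightarrow> d (sum F A) = (\<Sum>x\<in>A. d (F x))"
  by (induction A rule: infinite_finite_induct) (simp_all add: d_add[of _ k] Omega_sum)

lemma d_fn0_Omega [simp]: "d (fn0 f) \<in> Omega 1" "d (fn0 f) \<in> Omega (Suc 0)"
  using d_Omega[OF Omega_fn0] by simp_all

lemma d_smult:
  assumes "\<alpha> \<in> Omega k"
  shows "d (smult f \<alpha>) = d (fn0 f) \<and>\<^sub>f \<alpha> + smult f (d \<alpha>)"
proof -
  have "smult 1 x = x" for x by (simp add: fun_eq_iff)
  then show ?thesis
    using d_wedge[OF Omega_fn0 assms, of f] fn0_wedge[OF assms] fn0_wedge[OF d_Omega[OF assms]] by simp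
qed

lemma d_sign: "\<alpha> \<in> Omega k \<Longrightarrow> d (smult ((- 1) ^ j) \<alpha>) = smult ((- 1) ^ j) (d \<alpha>)"
proof (induction j)
  case 0
  have "smult 1 x = x" for x by (simp add: fun_eq_iff)
  then show ?case by simp
next
  case (Suc j)
  have *: "smult ((- 1) ^ Suc j) x = - smult ((- 1) ^ j) x" for x by (simp add: fun_eq_iff)
  show ?case
    unfolding * d_minus[OF Omega_smult[OF Suc.prems]] Suc.IH[OF Suc.prems] ..
qed

lemma der_vf: "der (vf d g)"
proof (rule derI)
  show "vf d g (f + h) = vf d g f + vf d g h" for f h
    by (simp add: vf_def fn0_add d_add[OF Omega_fn0 Omega_fn0])
  show "vf d g (f * h) = vf d g f * h + f * vf d g h" for f h
    by (simp add: vf_def fn0_mult d_wedge[OF Omega_fn0 Omega_fn0] wedge_single_fn0)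
  show "vf d g (cst z) = 0" for z
    by (simp add: vf_def d_cst)
qed

lemma der_evf: "der (evf d g)"
  unfolding evf_def by (intro der_scale der_vf)

text \<open>
  Only finitely many terms of \<open>\<alpha>\<close> influence a given coefficient of \<open>d\<alpha>\<close>. On those the Leibniz rule applies,
  and the closed frame elements contribute no structure functions, so the usual formula for the exterior
  derivative has the single extra term from \<open>\<rho>\<close>.
\<close>

lemma d_one_form:
  assumes closed: "\<And>g. g \<noteq> Rho \<Longrightarrow> d (beta g) = 0" and \<alpha>: "\<alpha> \<in> Omega 1" and gh: "pos g < pos h"
  shows "d \<alpha> {g, h} = eta g * eta h * (evf d g (ieta h * \<alpha> {h}) - evf d h (ieta g * \<alpha> {g}))
     + \<alpha> {Rho} * d rho {g, h}"
proof -
  obtain F where F: "finite F" "\<And>\<alpha>. \<alpha> \<in> Omega 1 \<Longrightarrow> (\<And>T. T \<in> F \<Longrightarrow> \<alpha> T = 0) \<Longrightarrow> d \<alpha> {g, h} = 0"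
    by (rule d_depends[of 1 "{g, h}"]) (rule that, assumption, blast)
  define G where "G = {k. {k} \<in> F} \<union> {g, h, Rho}"
  have "finite ((\<lambda>k. {k}) -` F)" by (rule finite_vimageI[OF F(1)]) simp
  then have G: "finite G" by (simp add: G_def vimage_def)
  define \<alpha>' where "\<alpha>' = (\<Sum>k\<in>G. smult (ieta k * \<alpha> {k}) (beta k))"
  have \<alpha>'_Omega: "\<alpha>' \<in> Omega 1" unfolding \<alpha>'_def by (intro Omega_sum Omega_smult) simp
  have beta_eta: "smult (ieta k * \<alpha> {k}) (beta k) S = (if S = {k} then \<alpha> {k} else 0)" for k S
    by (simp add: beta_apply mult.commute[of _ "eta k"] flip: mult.assoc)
  have \<alpha>'_k: "\<alpha>' {k} = \<alpha> {k}" if "k \<in> G" for k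
  proof -
    have "\<alpha>' {k} = (\<Sum>l\<in>G. if {k} = {l} then \<alpha> {l} else 0)"
      unfolding \<alpha>'_def using beta_eta by (simp only: sum_form_apply beta_eta)
    also have "\<dots> = (\<Sum>l\<in>{k}. \<alpha> {l})"
      using that G by (intro sum.mono_neutral_cong_right) auto
    finally show ?thesis by simp
  qed
  have "d (\<alpha> - \<alpha>') {g, h} = 0"
  proof (rule F(2)[OF Omega_diff[OF \<alpha> \<alpha>'_Omega]])
    fix T assume "T \<in> F"
    show "(\<alpha> - \<alpha>') T = 0"
    proof (cases "\<exists>k. T = {k}")
      case True
      with \<open>T \<in> F\<close> show ?thesis by (auto simp: \<alpha>'_k G_def)
    next
      case False
      then have "\<not> (finite T \<and> card T = 1)" by (auto simp: card_1_singleton_iff)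
      with OmegaD[OF \<alpha>, of T] OmegaD[OF \<alpha>'_Omega, of T] have "\<alpha> T = 0" "\<alpha>' T = 0" by blast+
      then show ?thesis by simp
    qed
  qed
  then have "d \<alpha> {g, h} = d \<alpha>' {g, h}" by (simp add: d_diff[OF \<alpha> \<alpha>'_Omega])
  also have "\<dots> = (\<Sum>k\<in>G. d (smult (ieta k * \<alpha> {k}) (beta k)) {g, h})"
    unfolding \<alpha>'_def by (subst d_sum[where k = 1]) (auto simp: sum_form_apply intro: Omega_smult)
  also have "\<dots> = (\<Sum>k\<in>G. (d (fn0 (ieta k * \<alpha> {k})) \<and>\<^sub>f beta k) {g, h} + ieta k * \<alpha> {k} * d (beta k) {g, h})"
    by (subst d_smult[where k = 1]) auto
  also have "\<dots> = (\<Sum>k\<in>G. vf d g (ieta k * \<alpha> {k}) * beta k {h} - vf d h (ieta k * \<alpha> {k}) * beta k {g})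
     + (\<Sum>k\<in>G. ieta k * \<alpha> {k} * d (beta k) {g, h})"
    by (simp add: sum.distrib wedge_pair[OF d_fn0_Omega(1) beta_Omega(1) gh] vf_def)
  also have "(\<Sum>k\<in>G. ieta k * \<alpha> {k} * d (beta k) {g, h}) = (\<Sum>k\<in>{Rho}. ieta k * \<alpha> {k} * d (beta k) {g, h})"
    using G by (intro sum.mono_neutral_right) (auto simp: G_def closed)
  also have "\<dots> = \<alpha> {Rho} * d rho {g, h}"
  proof -
    have "beta Rho = rho" by (simp add: beta_def eta_def fun_eq_iff)
    then show ?thesis by (simp add: ieta_def)
  qed
  also have "(\<Sum>k\<in>G. vf d g (ieta k * \<alpha> {k}) * beta k {h} - vf d h (ieta k * \<alpha> {k}) * beta k {g}) =
     vf d g (ieta h * \<alpha> {h}) * eta h - vf d h (ieta g * \<alpha> {g}) * eta g"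
  proof -
    have "(\<Sum>k\<in>G. vf d x (ieta k * \<alpha> {k}) * beta k {y}) = vf d x (ieta y * \<alpha> {y}) * eta y" if "y \<in> G" for x y
    proof -
      have "(\<Sum>k\<in>G. vf d x (ieta k * \<alpha> {k}) * beta k {y}) = (\<Sum>k\<in>{y}. vf d x (ieta k * \<alpha> {k}) * beta k {y})"
        using that G by (intro sum.mono_neutral_right) (auto simp: beta_apply)
      then show ?thesis by (simp add: beta_apply)
    qed
    then show ?thesis by (simp add: sum_subtractf G_def)
  qed
  finally show ?thesis by (simp add: vf_evf algebra_simps)
qed

text \<open>
  In the rescaled frame \<open>d (df)\<close> has the components \<open>([e\<^sub>g, e\<^sub>h] + \<kappa> e\<^sub>\<rho>) f\<close>, where \<open>\<kappa>\<close> is the component of \<open>d\<rho>\<close>.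
\<close>

lemma dd_fn0:
  assumes closed: "\<And>g. g \<noteq> Rho \<Longrightarrow> d (beta g) = 0"
    and comm: "\<And>g h. pos g < pos h \<Longrightarrow>
      evf d g (evf d h f) - evf d h (evf d g f) + ieta g * ieta h * d rho {g, h} * evf d Rho f = 0"
  shows "d (d (fn0 f)) = 0"
proof (rule Omega_2_eqI)
  show "d (d (fn0 f)) \<in> Omega 2" using d_Omega[OF d_fn0_Omega(1)] by (simp add: numeral_2_eq_2)
  fix g h assume gh: "pos g < pos h"
  have "d (d (fn0 f)) {g, h} =
      eta g * eta h * (evf d g (ieta h * d (fn0 f) {h}) - evf d h (ieta g * d (fn0 f) {g}))
      + d (fn0 f) {Rho} * d rho {g, h}"
    by (rule d_one_form) (simp_all add: closed gh)
  also have "\<dots> = eta g * eta h * (evf d g (evf d h f) - evf d h (evf d g f))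
      + evf d Rho f * d rho {g, h}"
    by (simp add: evf_def vf_def ieta_def)
  also have "\<dots> = eta g * eta h * (evf d g (evf d h f) - evf d h (evf d g f)
      + ieta g * ieta h * d rho {g, h} * evf d Rho f)"
  proof -
    have "eta g * eta h * (ieta g * ieta h * d rho {g, h} * evf d Rho f) =
      (eta g * ieta g) * (eta h * ieta h) * (evf d Rho f * d rho {g, h})" by (simp only: ac_simps)
    then show ?thesis by (simp add: distrib_left)
  qed
  finally show "d (d (fn0 f)) {g, h} = 0 {g, h}" by (simp add: comm[OF gh])
qed simp

definition basis :: "coframe set \<Rightarrow> form" where
  "basis S = (\<lambda>T. if T = S then 1 else 0)"

lemma basis_Omega: "finite S \<Longrightarrow> basis S \<in> Omega (card S)"
  by (simp add: Omega_def basis_def)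

lemma theta_wedge_basis:
  assumes S: "finite S" "g \<notin> S" "\<And>h. h \<in> S \<Longrightarrow> pos g < pos h"
  shows "theta g \<and>\<^sub>f basis S = basis (insert g S)"
proof
  fix T
  have sgn: "wsign {g} S = 1"
  proof -
    have "{(x, y). x \<in> {g} \<and> y \<in> S \<and> pos y < pos x} = {}" using S(3) by fastforce
    then show ?thesis unfolding wsign_def by (simp only: card.empty power_0)
  qed
  show "(theta g \<and>\<^sub>f basis S) T = basis (insert g S) T"
  proof (cases "T = insert g S")
    case True
    then have "T - {g} = S" using S by auto
    have "(theta g \<and>\<^sub>f basis S) T = (\<Sum>A\<in>{{g}}. wsign A (T - A) * theta g A * basis S (T - A))"
      unfolding wedge_def using True S by (intro sum.mono_neutral_right) (auto simp: theta_def)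
    then show ?thesis using \<open>T - {g} = S\<close> True sgn by (simp add: theta_def basis_def)
  next
    case False
    have "(theta g \<and>\<^sub>f basis S) T = 0"
      unfolding wedge_def using False by (intro sum.neutral) (auto simp: theta_def basis_def)
    with False show ?thesis by (simp add: basis_def)
  qed
qed

lemma dd_wedge:
  assumes "\<alpha> \<in> Omega j" "\<beta> \<in> Omega k" "d (d \<alpha>) = 0" "d (d \<beta>) = 0"
  shows "d (d (\<alpha> \<and>\<^sub>f \<beta>)) = 0"
proof -
  note d\<alpha> = d_Omega[OF assms(1)] and d\<beta> = d_Omega[OF assms(2)]
  have 1: "\<alpha> \<and>\<^sub>f d \<beta> \<in> Omega (Suc (j + k))" using Omega_wedge[OF assms(1) d\<beta>] by simp
  have 2: "d \<alpha> \<and>\<^sub>f \<beta> \<in> Omega (Suc (j + k))" using Omega_wedge[OF d\<alpha> assms(2)] by simp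
  have "d (d (\<alpha> \<and>\<^sub>f \<beta>)) = d (d \<alpha> \<and>\<^sub>f \<beta>) + smult ((- 1) ^ j) (d (\<alpha> \<and>\<^sub>f d \<beta>))"
    unfolding d_wedge[OF assms(1,2)] by (subst d_add[OF 2 Omega_smult[OF 1]]) (simp add: d_sign[OF 1])
  also have "\<dots> = 0"
    unfolding d_wedge[OF d\<alpha> assms(2)] d_wedge[OF assms(1) d\<beta>] assms(3,4) by (simp add: fun_eq_iff)
  finally show ?thesis .
qed

lemma dd_smult:
  assumes "\<And>f. d (d (fn0 f)) = 0" "\<alpha> \<in> Omega k" "d (d \<alpha>) = 0"
  shows "d (d (smult f \<alpha>)) = 0"
  using dd_wedge[OF Omega_fn0 assms(2) assms(1) assms(3)] by (simp add: fn0_wedge[OF assms(2)])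

text \<open>
  Continuity, applied twice: a coefficient of \<open>d (d \<alpha>)\<close> depends on finitely many coefficients of \<open>d \<alpha>\<close>, each of which
  depends on finitely many coefficients of \<open>\<alpha>\<close>. Any larger finite set of components may be used instead,
  which is convenient for singling out \<open>\<rho>\<close>.
\<close>

lemma dd_finite:
  assumes "\<alpha> \<in> Omega k"
  shows "\<exists>F. finite F \<and> F \<subseteq> {T. finite T \<and> card T = k} \<and> (\<forall>G. finite G \<longrightarrow> F \<subseteq> G \<longrightarrow> G \<subseteq> {T. finite T \<and> card T = k} \<longrightarrow>
    d (d \<alpha>) S = (\<Sum>T\<in>G. d (d (smult (\<alpha> T) (basis T))) S))"
proof -
  obtain F1 where F1: "finite F1"
    "\<And>\<alpha>. \<alpha> \<in> Omega (Suc k) \<Longrightarrow> (\<And>T. T \<in> F1 \<Longrightarrow> \<alpha> T = 0) \<Longrightarrow> d \<alpha> S = 0"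
    by (rule d_depends[of "Suc k" S]) (rule that, assumption, blast)
  define F2 where "F2 S = (SOME F. finite F \<and> (\<forall>\<alpha>\<in>Omega k. (\<forall>T\<in>F. \<alpha> T = 0) \<longrightarrow> d \<alpha> S = 0))" for S
  have F2': "finite (F2 S) \<and> (\<forall>\<alpha>\<in>Omega k. (\<forall>T\<in>F2 S. \<alpha> T = 0) \<longrightarrow> d \<alpha> S = 0)" for S
    unfolding F2_def by (rule someI_ex[OF d_continuous])
  then have F2: "finite (F2 S)"
    "\<alpha> \<in> Omega k \<Longrightarrow> (\<And>T. T \<in> F2 S \<Longrightarrow> \<alpha> T = 0) \<Longrightarrow> d \<alpha> S = 0" for S \<alpha> by simp_all
  define F where "F = (\<Union>S\<in>F1. F2 S) \<inter> {T. finite T \<and> card T = k}"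
  show ?thesis
  proof (intro exI[of _ F] conjI allI impI)
    show "finite F" using F1(1) F2(1) by (simp add: F_def)
    show "F \<subseteq> {T. finite T \<and> card T = k}" by (simp add: F_def)
    fix G assume G: "finite G" "F \<subseteq> G" "G \<subseteq> {T. finite T \<and> card T = k}"
    have b: "smult (\<alpha> T) (basis T) \<in> Omega k" if "T \<in> G" for T
      using that G(3) basis_Omega[of T] by (auto intro: Omega_smult)
    define \<alpha>' where "\<alpha>' = (\<Sum>T\<in>G. smult (\<alpha> T) (basis T))"
    have \<alpha>'_Omega: "\<alpha>' \<in> Omega k" unfolding \<alpha>'_def by (rule Omega_sum[OF b])
    have \<alpha>': "\<alpha>' T = \<alpha> T" if "T \<in> G" for T
    proof -
      have "\<alpha>' T = (\<Sum>R\<in>G. \<alpha> R * basis R T)" by (simp add: \<alpha>'_def sum_form_apply)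
      also have "\<dots> = (\<Sum>R\<in>{T}. \<alpha> R * basis R T)"
        using that G by (intro sum.mono_neutral_right) (auto simp: basis_def)
      finally show ?thesis by (simp add: basis_def)
    qed
    have diff: "\<alpha> - \<alpha>' \<in> Omega k" using assms \<alpha>'_Omega by (rule Omega_diff)
    have "d (d (\<alpha> - \<alpha>')) S = 0"
    proof (rule F1(2)[OF d_Omega[OF diff]])
      fix R assume R: "R \<in> F1"
      show "d (\<alpha> - \<alpha>') R = 0"
      proof (rule F2(2)[OF diff])
        fix T assume "T \<in> F2 R"
        show "(\<alpha> - \<alpha>') T = 0"
        proof (cases "finite T \<and> card T = k")
          case True
          then have "T \<in> G" using R \<open>T \<in> F2 R\<close> G(2) by (auto simp: F_def)
          then show ?thesis by (simp add: \<alpha>')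
        next
          case False
          then show ?thesis using OmegaD[OF diff, of T] by blast
        qed
      qed
    qed
    then have "d (d \<alpha>) S = d (d \<alpha>') S"
      by (simp add: d_diff[OF assms \<alpha>'_Omega] d_diff[OF d_Omega[OF assms] d_Omega[OF \<alpha>'_Omega]])
    also have "\<dots> = (\<Sum>T\<in>G. d (d (smult (\<alpha> T) (basis T))) S)"
      unfolding \<alpha>'_def by (simp add: d_sum[OF b] d_sum[OF d_Omega[OF b]] sum_form_apply)
    finally show "d (d \<alpha>) S = (\<Sum>T\<in>G. d (d (smult (\<alpha> T) (basis T))) S)" .
  qed
qed

lemma basis_singleton: "basis {g} = theta g"
  by (auto simp: basis_def theta_def fun_eq_iff)

text \<open>
  The square of \<open>d\<close> obeys the Leibniz rule, so it suffices to treat functions and the coframe. For \<open>\<rho>\<close>: if \<open>\<rho>\<close> occurs in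
  some exact form \<open>df\<^sub>0\<close> with a unit coefficient \<open>x\<^sup>-\<^sup>1\<close>, then \<open>0 = d (d (df\<^sub>0)) = x\<^sup>-\<^sup>1 d (d \<rho>)\<close>, because all other
  coefficients and coframe elements are already annihilated.
\<close>

lemma dd_eq_0:
  assumes closed: "\<And>g. g \<noteq> Rho \<Longrightarrow> d (beta g) = 0"
    and ddf: "\<And>f. d (d (fn0 f)) = 0" and unit: "x * vf d Rho f\<^sub>0 = 1" and \<alpha>: "\<alpha> \<in> Omega k"
  shows "d (d \<alpha>) = 0"
proof -
  have theta_beta: "theta g = smult (ieta g) (beta g)" for g
    by (simp add: fun_eq_iff beta_def flip: mult.assoc)
  have "d (d (theta g)) = 0" if "g \<noteq> Rho" for g
    unfolding theta_beta by (rule dd_smult[OF ddf beta_Omega(1)]) (simp add: closed[OF that])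
  moreover have ddrho: "d (d rho) = 0"
  proof
    fix S
    let ?\<alpha> = "d (fn0 f\<^sub>0)"
    from dd_finite[OF d_fn0_Omega(1), of f\<^sub>0 S] obtain F where F: "finite F" "F \<subseteq> {T. finite T \<and> card T = 1}"
      "\<And>G. finite G \<Longrightarrow> F \<subseteq> G \<Longrightarrow> G \<subseteq> {T. finite T \<and> card T = 1} \<Longrightarrow>
        d (d ?\<alpha>) S = (\<Sum>T\<in>G. d (d (smult (?\<alpha> T) (basis T))) S)" by blast
    let ?G = "insert {Rho} F"
    have "0 = d (d ?\<alpha>) S" by (simp add: ddf)
    also have "\<dots> = (\<Sum>T\<in>?G. d (d (smult (?\<alpha> T) (basis T))) S)"
      by (rule F(3)) (use F(1,2) in auto)
    also have "\<dots> = (\<Sum>T\<in>{{Rho}}. d (d (smult (?\<alpha> T) (basis T))) S)"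
    proof (rule sum.mono_neutral_right)
      show "\<forall>T\<in>?G - {{Rho}}. d (d (smult (?\<alpha> T) (basis T))) S = 0"
      proof
        fix T assume "T \<in> ?G - {{Rho}}"
        then have "T \<in> {T. finite T \<and> card T = 1}" "T \<noteq> {Rho}" using F(2) by auto
        then obtain g where g: "T = {g}" "g \<noteq> Rho" by (auto simp: card_1_singleton_iff)
        have "d (d (theta g)) = 0" unfolding theta_beta[of g]
          by (rule dd_smult[OF ddf beta_Omega(1)]) (simp add: closed[OF g(2)])
        then show "d (d (smult (?\<alpha> T) (basis T))) S = 0"
          unfolding g basis_singleton using dd_smult[OF ddf Omega_theta(1)] by simp
      qed
    qed (use F(1) in auto)
    also have "\<dots> = vf d Rho f\<^sub>0 * d (d rho) S"
    proof -
      have "d (d (smult y rho)) = smult y (d (d rho))" for y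
      proof -
        have o: "d rho \<in> Omega 2" using d_Omega[OF Omega_theta(1)] by (simp add: numeral_2_eq_2)
        have o': "d (fn0 y) \<and>\<^sub>f rho \<in> Omega 2"
          using Omega_wedge[OF d_fn0_Omega(1) Omega_theta(1)] by (simp add: numeral_2_eq_2)
        have o'': "d (fn0 y) \<and>\<^sub>f d rho + smult (- 1) (d (fn0 y) \<and>\<^sub>f d rho) = 0" by (simp add: fun_eq_iff)
        have "d (d (smult y rho)) = d (d (fn0 y) \<and>\<^sub>f rho) + d (smult y (d rho))"
          unfolding d_smult[OF Omega_theta(1)] by (rule d_add[OF o' Omega_smult[OF o]])
        also have "\<dots> = smult (- 1) (d (fn0 y) \<and>\<^sub>f d rho) + (d (fn0 y) \<and>\<^sub>f d rho + smult y (d (d rho)))"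
          unfolding d_wedge[OF d_fn0_Omega(1) Omega_theta(1)] d_smult[OF o] ddf by simp
        also have "\<dots> = smult y (d (d rho))" using o'' by (simp add: algebra_simps)
        finally show ?thesis .
      qed
      then show ?thesis by (simp add: basis_singleton vf_def)
    qed
    finally have "0 = x * (vf d Rho f\<^sub>0 * d (d rho) S)" by simp
    then show "d (d rho) S = 0 S" by (simp add: unit flip: mult.assoc)
  qed
  ultimately have ddtheta: "d (d (theta g)) = 0" for g by (cases "g = Rho") auto
  have ddbasis: "d (d (basis S)) = 0" if "finite S" for S
    using that
  proof (induction "card S" arbitrary: S)
    case 0
    then have "basis S = fn0 1" by (simp add: basis_def fn0_def fun_eq_iff)
    then show ?case by (simp add: ddf)
  next
    case (Suc n)
    define g where "g = arg_min_on pos S"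
    have "S \<noteq> {}" using Suc by auto
    then have g: "g \<in> S" unfolding g_def by (intro arg_min_if_finite(1) Suc(3))
    have min: "pos g < pos h" if "h \<in> S - {g}" for h
      using arg_min_if_finite(2)[OF Suc(3) \<open>S \<noteq> {}\<close>, of pos] that pos_linear[of g h] by (auto simp: g_def)
    have "basis S = theta g \<and>\<^sub>f basis (S - {g})"
      using theta_wedge_basis[of "S - {g}" g] min Suc(3) g by (simp add: insert_absorb)
    moreover have "d (d (basis (S - {g}))) = 0" using Suc g by (intro Suc(1)) auto
    ultimately show ?case
      using dd_wedge[OF Omega_theta(1) basis_Omega[of "S - {g}"] ddtheta] Suc(3) by simp
  qed
  show ?thesis
  proof
    fix S
    from dd_finite[OF \<alpha>, of S] obtain F where "finite F" "F \<subseteq> {T. finite T \<and> card T = k}"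
      "d (d \<alpha>) S = (\<Sum>T\<in>F. d (d (smult (\<alpha> T) (basis T))) S)" by blast
    moreover have "d (d (smult (\<alpha> T) (basis T))) S = 0" if "T \<in> F" for T
    proof -
      have "finite T" using that \<open>F \<subseteq> _\<close> by auto
      then show ?thesis using dd_smult[OF ddf basis_Omega ddbasis] by simp
    qed
    ultimately show "d (d \<alpha>) S = 0 S" by simp
  qed
qed

end

section \<open>Matrices of forms and their components\<close>

lemma UNIV_two: "(UNIV :: 2 set) = {1, 2}"
proof -
  have "x = 1 \<or> x = 2" for x :: 2
  proof (cases x)
    case (of_int z)
    then have "z = 0 \<or> z = 1" by simp arith
    with of_int show ?thesis by auto
  qed
  then show ?thesis by auto
qed

lemma forall_two: "(\<forall>i::2. P i) \<longleftrightarrow> P 1 \<and> P 2"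
  by (metis UNIV_I UNIV_two insertE singletonD)

lemma mat2_simps [simp]: "mat2 p q r s 1 1 = p" "mat2 p q r s 1 2 = q" "mat2 p q r s 2 1 = r" "mat2 p q r s 2 2 = s"
  by (simp_all add: mat2_def)

text \<open>
  A matrix of \<open>\<lambda>\<close>-series of forms becomes, one exterior monomial at a time, a \<open>\<lambda>\<close>-series of matrices of functions,
  to which the ring calculus of matrix series applies.
\<close>

definition mcoef :: "lform mat2 \<Rightarrow> coframe set \<Rightarrow> int \<Rightarrow> fn m2" where
  "mcoef A S n = M2 (A 1 1 n S) (A 1 2 n S) (A 2 1 n S) (A 2 2 n S)"

definition lcoef :: "lfn mat2 \<Rightarrow> int \<Rightarrow> fn m2" where
  "lcoef F n = M2 (F 1 1 n) (F 1 2 n) (F 2 1 n) (F 2 2 n)"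

definition homog :: "nat \<Rightarrow> lform mat2 \<Rightarrow> bool" where
  "homog k A \<longleftrightarrow> (\<forall>i j n. A i j n \<in> Omega k)"

lemma homogD: "homog k A \<Longrightarrow> A i j n \<in> Omega k"
  by (simp add: homog_def)

lemma homog_mlift: "homog 0 (mlift F)"
  by (simp add: homog_def mlift_def)

lemma homog_add: "homog k A \<Longrightarrow> homog k B \<Longrightarrow> homog k (A + B)"
  and homog_diff: "homog k A \<Longrightarrow> homog k B \<Longrightarrow> homog k (A - B)"
  by (simp_all add: homog_def Omega_add Omega_diff)

lemma Omega_lwedge: "(\<And>n. P n \<in> Omega j) \<Longrightarrow> (\<And>n. Q n \<in> Omega k) \<Longrightarrow> lwedge P Q n \<in> Omega (j + k)"
  unfolding lwedge_def by (intro Omega_fsum Omega_wedge)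

lemma mwedge_apply: "mwedge A B i j n = lwedge (A i 1) (B 1 j) n + lwedge (A i 2) (B 2 j) n"
  by (simp add: mwedge_def UNIV_two)

lemma homog_mwedge: "homog j A \<Longrightarrow> homog k B \<Longrightarrow> homog (j + k) (mwedge A B)"
  unfolding homog_def mwedge_apply by (intro allI Omega_add Omega_lwedge) auto

lemma mcoef_add: "mcoef (A + B) S n = mcoef A S n + mcoef B S n"
  and mcoef_diff: "mcoef (A - B) S n = mcoef A S n - mcoef B S n"
  by (rule m2_eqI; simp add: mcoef_def)+

lemma homog_1_eq_0_iff: "homog 1 A \<Longrightarrow> A = 0 \<longleftrightarrow> (\<forall>g n. mcoef A {g} n = 0)"
proof
  assume A: "homog 1 A" and *: "\<forall>g n. mcoef A {g} n = 0"
  have "A i j n {g} = 0" for i j n g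
  proof -
    from * have "M2 (A 1 1 n {g}) (A 1 2 n {g}) (A 2 1 n {g}) (A 2 2 n {g}) = M2 0 0 0 0"
      by (simp add: mcoef_def zero_m2_def)
    then have "\<forall>i j. A i j n {g} = 0" by (simp add: forall_two)
    then show ?thesis by blast
  qed
  then have "A i j n = 0" for i j n
    by (intro Omega_1_eqI[OF homogD[OF A] Omega_0]) simp
  then show "A = 0" by (simp add: fun_eq_iff)
qed (simp add: mcoef_def zero_m2_def)

lemma lwedge_single_lift:
  assumes P: "\<And>n. P n \<in> Omega 1" and K: "finite K" "\<And>k. k \<notin> K \<Longrightarrow> P k {g} = 0"
  shows "lwedge P (\<lambda>n. fn0 (f n)) n {g} = (\<Sum>k\<in>K. P k {g} * f (n - k))"
    and "lwedge (\<lambda>n. fn0 (f n)) P n {g} = (\<Sum>k\<in>K. f (n - k) * P k {g})"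
proof -
  have "lwedge P (\<lambda>n. fn0 (f n)) n {g} = Sum_any (\<lambda>k. P k {g} * f (n - k))"
    by (simp add: lwedge_def fsum_def wedge_single_fn0[OF P])
  also have "\<dots> = (\<Sum>k\<in>K. P k {g} * f (n - k))"
    by (rule Sum_any.expand_superset[OF K(1)]) (use K(2) in fastforce)
  finally show "lwedge P (\<lambda>n. fn0 (f n)) n {g} = (\<Sum>k\<in>K. P k {g} * f (n - k))" .
  have "lwedge (\<lambda>n. fn0 (f n)) P n {g} = Sum_any (\<lambda>k. f k * P (n - k) {g})"
    by (simp add: lwedge_def fsum_def wedge_single_fn0[OF P])
  also have "\<dots> = (\<Sum>k\<in>(\<lambda>k. n - k) ` K. f k * P (n - k) {g})"
  proof (rule Sum_any.expand_superset)
    show "{k. f k * P (n - k) {g} \<noteq> 0} \<subseteq> (\<lambda>k. n - k) ` K"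
    proof
      fix k assume "k \<in> {k. f k * P (n - k) {g} \<noteq> 0}"
      then have "P (n - k) {g} \<noteq> 0" by auto
      then have "n - k \<in> K" using K(2) by blast
      then have "n - (n - k) \<in> (\<lambda>k. n - k) ` K" by (rule imageI)
      then show "k \<in> (\<lambda>k. n - k) ` K" by simp
    qed
  qed (use K(1) in simp)
  also have "\<dots> = (\<Sum>k\<in>K. f (n - k) * P k {g})"
    by (simp add: sum.reindex inj_on_def)
  finally show "lwedge (\<lambda>n. fn0 (f n)) P n {g} = (\<Sum>k\<in>K. f (n - k) * P k {g})" .
qed

text \<open>
  The finite set \<open>K\<close> contains the \<open>\<lambda>\<close>-degrees of the component of \<open>A\<close> along \<open>g\<close>. The function factor may
  be infinite in \<open>\<lambda>\<close>, and even unbounded below as for the conjugate of \<open>Y\<close>.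
\<close>

lemma mcoef_mwedge_lift:
  assumes A: "homog 1 A" and K: "finite K" "\<And>k. k \<notin> K \<Longrightarrow> mcoef A {g} k = 0"
  shows "mcoef (mwedge A (mlift F)) {g} n = (\<Sum>k\<in>K. mcoef A {g} k * lcoef F (n - k))"
    and "mcoef (mwedge (mlift F) A) {g} n = (\<Sum>k\<in>K. lcoef F (n - k) * mcoef A {g} k)"
proof -
  have 0: "A i j k {g} = 0" if "k \<notin> K" for i j k
  proof -
    from K(2)[OF that] have "\<forall>i j. A i j k {g} = 0" by (simp add: mcoef_def zero_m2_def forall_two)
    then show ?thesis by blast
  qed
  have L: "lwedge (A i j) (\<lambda>n. fn0 (f n)) n {g} = (\<Sum>k\<in>K. A i j k {g} * f (n - k))"
    "lwedge (\<lambda>n. fn0 (f n)) (A i j) n {g} = (\<Sum>k\<in>K. f (n - k) * A i j k {g})" for i j f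
    by (rule lwedge_single_lift[OF homogD[OF A] K(1) 0]; assumption)+
  show "mcoef (mwedge A (mlift F)) {g} n = (\<Sum>k\<in>K. mcoef A {g} k * lcoef F (n - k))"
    by (rule m2_eqI) (simp_all add: mcoef_def lcoef_def mwedge_apply mlift_def L m2_sum sum.distrib)
  show "mcoef (mwedge (mlift F) A) {g} n = (\<Sum>k\<in>K. lcoef F (n - k) * mcoef A {g} k)"
    by (rule m2_eqI) (simp_all add: mcoef_def lcoef_def mwedge_apply mlift_def L m2_sum sum.distrib)
qed

lemma lwedge_pair:
  assumes P: "\<And>n. P n \<in> Omega 1" "\<And>n. Q n \<in> Omega 1"
    and K: "finite K" "\<And>k. k \<notin> K \<Longrightarrow> P k {g} = 0 \<and> P k {h} = 0" and gh: "pos g < pos h"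
  shows "lwedge P Q n {g, h} = (\<Sum>k\<in>K. P k {g} * Q (n - k) {h} - P k {h} * Q (n - k) {g})"
proof -
  have "lwedge P Q n {g, h} = Sum_any (\<lambda>k. P k {g} * Q (n - k) {h} - P k {h} * Q (n - k) {g})"
    by (simp add: lwedge_def fsum_def wedge_pair[OF P gh])
  also have "\<dots> = (\<Sum>k\<in>K. P k {g} * Q (n - k) {h} - P k {h} * Q (n - k) {g})"
    by (rule Sum_any.expand_superset[OF K(1)]) (use K(2) in fastforce)
  finally show ?thesis .
qed

lemma mcoef_mwedge_pair:
  assumes A: "homog 1 A" and B: "homog 1 B" and K: "finite K"
    "\<And>k. k \<notin> K \<Longrightarrow> mcoef A {g} k = 0 \<and> mcoef A {h} k = 0" and gh: "pos g < pos h"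
  shows "mcoef (mwedge A B) {g, h} n =
    (\<Sum>k\<in>K. mcoef A {g} k * mcoef B {h} (n - k) - mcoef A {h} k * mcoef B {g} (n - k))"
proof -
  have 0: "A i j k {g} = 0 \<and> A i j k {h} = 0" if "k \<notin> K" for i j k
  proof -
    from K(2)[OF that] have "\<forall>i j. A i j k {g} = 0 \<and> A i j k {h} = 0" by (simp add: mcoef_def zero_m2_def forall_two)
    then show ?thesis by blast
  qed
  have L: "lwedge (A i j) (B l m) n {g, h} =
      (\<Sum>k\<in>K. A i j k {g} * B l m (n - k) {h} - A i j k {h} * B l m (n - k) {g})" for i j l m
    by (rule lwedge_pair[OF homogD[OF A] homogD[OF B] K(1) 0 gh]; assumption)
  show ?thesis
    by (rule m2_eqI) (simp_all add: mcoef_def mwedge_apply L m2_sum sum.distrib sum_subtractf)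
qed

section \<open>The components of the extended Maurer--Cartan form\<close>

text \<open>
  The values of \<open>\<phi>\<^sub>-\<close>, \<open>\<phi>\<^sub>+\<close>, \<open>\<phi>\<^sub>0\<close> and their sum \<open>\<phi>\<close> on the vector fields dual to the rescaled coframe.
  Each is a Laurent polynomial, although \<open>\<phi>\<close> is infinite in both directions.
\<close>

definition mphi :: "fn m2 fls \<Rightarrow> coframe \<Rightarrow> fn m2 fls" where
  "mphi Y g = (case g of Xi \<Rightarrow> Upol Y 0 | DT n \<Rightarrow> Upol Y (Suc n) | _ \<Rightarrow> 0)"

definition pphi :: "fn m2 fls \<Rightarrow> coframe \<Rightarrow> fn m2 fls" where
  "pphi Y g = (case g of Xib \<Rightarrow> - Qpol Y 0 | DTb n \<Rightarrow> - Qpol Y (Suc n) | _ \<Rightarrow> 0)"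

definition sphi :: "coframe \<Rightarrow> fn m2 fls" where
  "sphi g = (case g of Rho \<Rightarrow> Srho | _ \<Rightarrow> 0)"

definition ephi :: "fn m2 fls \<Rightarrow> coframe \<Rightarrow> fn m2 fls" where
  "ephi Y g = pphi Y g + sphi g + mphi Y g"

definition ephi_star :: "fn m2 fls \<Rightarrow> coframe \<Rightarrow> fn m2 fls" where
  "ephi_star Y g = (case g of Xi \<Rightarrow> Qpol Y 0 | DT n \<Rightarrow> Qpol Y (Suc n)
     | Xib \<Rightarrow> - Upol Y 0 | DTb n \<Rightarrow> - Upol Y (Suc n) | Rho \<Rightarrow> - Srho)"

lemma phi_gT [simp]:
  "mphi Y (gT m) = Upol Y m" "pphi Y (gT m) = 0" "sphi (gT m) = 0" "ephi Y (gT m) = Upol Y m"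
  "mphi Y (gTb m) = 0" "pphi Y (gTb m) = - Qpol Y m" "sphi (gTb m) = 0" "ephi Y (gTb m) = - Qpol Y m"
  "mphi Y Rho = 0" "pphi Y Rho = 0" "sphi Rho = Srho" "ephi Y Rho = Srho"
  "ephi_star Y (gT m) = Qpol Y m" "ephi_star Y (gTb m) = - Upol Y m" "ephi_star Y Rho = - Srho"
  by (cases m; simp add: mphi_def pphi_def sphi_def ephi_def ephi_star_def)+

lemma is_star_ephi: "is_star (ephi Y g) (ephi_star Y g)"
  by (cases g rule: coframe_cases)
     (auto simp: is_star_Srho is_star_Qpol is_star_minus is_star_sym[OF is_star_Qpol])

lemma Sum_any_single: "(\<And>m. m \<noteq> m\<^sub>0 \<Longrightarrow> F m = 0) \<Longrightarrow> Sum_any F = F m\<^sub>0"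
  by (subst Sum_any.expand_superset[of "{m\<^sub>0}"]) auto

lemma homog_phi_minus: "homog 1 (phi_minus Y)" and homog_phi_plus: "homog 1 (phi_plus Y)"
  unfolding homog_def phi_minus_def phi_plus_def
  by (intro allI Omega_minus Omega_fsum Omega_smult, simp add: dt_beta dtb_beta)+

lemma homog_phi0: "homog 1 phi0"
  unfolding homog_def forall_two by (simp add: phi0_def lmono_def Omega_smult)

lemma homog_phi_ext: "homog 1 (phi_ext Y)"
  unfolding phi_ext_def by (intro homog_add homog_phi_plus homog_phi0 homog_phi_minus)

lemma ephi_finite: "finite {n. ephi Y g $$ n \<noteq> 0}" "finite {n. pphi Y g $$ n \<noteq> 0}" "finite {n. mphi Y g $$ n \<noteq> 0}"
proof -
  have fin: "finite {n. P $$ n \<noteq> 0}" if "is_star P P'" for P P'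
  proof (rule finite_subset)
    show "{n. P $$ n \<noteq> 0} \<subseteq> {fls_subdegree P..- fls_subdegree P'}"
    proof
      fix n assume n: "n \<in> {n. P $$ n \<noteq> 0}"
      have "P $$ n = adj (P' $$ (- n))" using is_star_sym[OF that] by (simp add: is_star_def)
      with n have "P' $$ (- n) \<noteq> 0" by auto
      then have "\<not> - n < fls_subdegree P'" by auto
      moreover from n have "\<not> n < fls_subdegree P" by auto
      ultimately show "n \<in> {fls_subdegree P..- fls_subdegree P'}" by simp
    qed
  qed simp
  show "finite {n. ephi Y g $$ n \<noteq> 0}" by (rule fin[OF is_star_ephi])
  show "finite {n. pphi Y g $$ n \<noteq> 0}" "finite {n. mphi Y g $$ n \<noteq> 0}"
    by (cases g rule: coframe_cases;
        simp add: fin[OF is_star_Qpol] fin[OF is_star_sym[OF is_star_Qpol]])+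
qed

lemma scalar_left_commute: "X * (scalar x * Z) = scalar x * (X * Z)" for X :: "fn m2"
  by (rule m2_eqI) (simp_all add: algebra_simps)

lemma scalar_mult: "scalar (x * y) = scalar x * scalar (y :: fn)"
  by (rule m2_eqI) simp_all

lemma scalar_eta_cancel: "scalar (eta g) * X = 0 \<longleftrightarrow> X = 0"
proof
  assume "scalar (eta g) * X = 0"
  then have "scalar (ieta g) * (scalar (eta g) * X) = 0" by simp
  then have "scalar (ieta g * eta g) * X = 0" unfolding scalar_mult mult.assoc .
  then show "X = 0" by (simp flip: one_m2_def)
qed simp

lemma scalar_eta_cancel_2: "scalar (eta g * eta h) * X = 0 \<longleftrightarrow> X = 0"
  by (simp only: scalar_mult mult.assoc scalar_eta_cancel)

lemma homog_mdiff: "antider d \<Longrightarrow> homog 1 (mdiff d (mlift F))"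
  by (simp add: homog_def mdiff_def mlift_def antider.d_fn0_Omega)

lemma homog_mcomm_lift: "homog 1 A \<Longrightarrow> homog 1 (mcomm A (mlift F))"
  unfolding mcomm_def
  using homog_diff[of "1 + 0"] homog_mwedge[of 1 A 0 "mlift F"] homog_mwedge[of 0 "mlift F" 1 A] homog_mlift
  by simp

context
  fixes Ym :: "lfn mat2" and Y :: "fn m2 fls"
  assumes Y: "\<And>n. Y $$ n = lcoef Ym n"
begin

lemma mcoef_phi_minus: "mcoef (phi_minus Ym) {g} n = scalar (eta g) * mphi Y g $$ n"
proof -
  have *: "phi_minus Ym i j n {g} = (case g of Xi \<Rightarrow> eta Xi * Umat Ym 0 i j n
      | DT l \<Rightarrow> eta (DT l) * Umat Ym (Suc l) i j n | _ \<Rightarrow> 0)" for i j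
  proof (cases g rule: coframe_cases)
    case (t m)
    have "phi_minus Ym i j n {g} = Umat Ym m i j n * eta g"
      unfolding phi_minus_def fsum_def smult_apply dt_beta beta_apply
      by (subst Sum_any_single[of m]) (auto simp: t)
    then show ?thesis by (cases m) (auto simp: t mult.commute)
  next
    case (tb m)
    have "phi_minus Ym i j n {g} = 0" by (simp add: tb phi_minus_def fsum_def dt_beta beta_apply)
    then show ?thesis by (cases m) (auto simp: tb)
  qed (simp add: phi_minus_def fsum_def dt_beta beta_apply)
  have U: "Upol Y m $$ n = M2 (Umat Ym m 1 1 n) (Umat Ym m 1 2 n) (Umat Ym m 2 1 n) (Umat Ym m 2 2 n)" for m
    by (rule m2_eqI) (auto simp: Upol_def Vser_def Y lcoef_def Umat_def algebra_simps)
  show ?thesis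
    unfolding mcoef_def * mphi_def by (cases g; rule m2_eqI) (simp_all add: U)
qed

lemma mcoef_phi_plus: "mcoef (phi_plus Ym) {g} n = scalar (eta g) * pphi Y g $$ n"
proof -
  have *: "phi_plus Ym i j n {g} = (case g of Xib \<Rightarrow> - eta Xib * mstar (Umat Ym 0) i j n
      | DTb l \<Rightarrow> - eta (DTb l) * mstar (Umat Ym (Suc l)) i j n | _ \<Rightarrow> 0)" for i j
  proof (cases g rule: coframe_cases)
    case (tb m)
    have "phi_plus Ym i j n {g} = - (mstar (Umat Ym m) i j n * eta g)"
      unfolding phi_plus_def fsum_def smult_apply dtb_beta beta_apply fun_Compl_def
      by (subst Sum_any_single[of m]) (auto simp: tb)
    then show ?thesis by (cases m) (auto simp: tb mult.commute)
  next
    case (t m)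
    have "phi_plus Ym i j n {g} = 0" by (simp add: t phi_plus_def fsum_def dtb_beta beta_apply)
    then show ?thesis by (cases m) (auto simp: t)
  qed (simp add: phi_plus_def fsum_def dtb_beta beta_apply)
  have U: "Upol Y m $$ n = M2 (Umat Ym m 1 1 n) (Umat Ym m 1 2 n) (Umat Ym m 2 1 n) (Umat Ym m 2 2 n)" for m n
    by (rule m2_eqI) (auto simp: Upol_def Vser_def Y lcoef_def Umat_def algebra_simps)
  have Q: "Qpol Y m $$ n = M2 (mstar (Umat Ym m) 1 1 n) (mstar (Umat Ym m) 1 2 n)
     (mstar (Umat Ym m) 2 1 n) (mstar (Umat Ym m) 2 2 n)" for m
    using is_star_Qpol[of Y m] by (simp add: is_star_def U adj_def mstar_def)
  show ?thesis
    unfolding mcoef_def * pphi_def by (cases g; rule m2_eqI) (simp_all add: Q)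
qed

lemma mcoef_phi0: "mcoef phi0 {g} n = scalar (eta g) * sphi g $$ n"
  by (cases g; rule m2_eqI) (simp_all add: mcoef_def phi0_def sphi_def lmono_def theta_def Srho_nth eta_def)

lemma mcoef_phi_ext: "mcoef (phi_ext Ym) {g} n = scalar (eta g) * ephi Y g $$ n"
  unfolding phi_ext_def mcoef_add mcoef_phi_minus mcoef_phi_plus mcoef_phi0
  by (simp add: ephi_def distrib_left)

lemma mcoef_mcomm_lift:
  assumes A: "homog 1 A" and P: "\<And>n. mcoef A {g} n = scalar x * P $$ n" and fin: "finite {n. P $$ n \<noteq> 0}"
  shows "mcoef (mcomm A (mlift Ym)) {g} n = scalar x * comm P Y $$ n"
proof -
  let ?K = "{n. P $$ n \<noteq> 0}"
  have K: "mcoef A {g} k = 0" if "k \<notin> ?K" for k using that by (simp add: P)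
  have 1: "(P * Y) $$ n = (\<Sum>k\<in>?K. P $$ k * lcoef Ym (n - k))"
    by (subst fls_mult_nth_sum[OF fin]) (simp_all add: Y)
  have "(Y * P) $$ n = (\<Sum>k\<in>(\<lambda>k. n - k) ` ?K. Y $$ k * P $$ (n - k))"
  proof (rule fls_mult_nth_sum)
    show "finite ((\<lambda>k. n - k) ` ?K)" using fin by simp
    fix k assume k: "k \<notin> (\<lambda>k. n - k) ` ?K"
    have "n - k \<notin> ?K"
    proof
      assume "n - k \<in> ?K"
      then have "n - (n - k) \<in> (\<lambda>k. n - k) ` ?K" by (rule imageI)
      with k show False by simp
    qed
    then show "Y $$ k * P $$ (n - k) = 0" by simp
  qed
  also have "\<dots> = (\<Sum>k\<in>?K. lcoef Ym (n - k) * P $$ k)"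
    by (simp add: sum.reindex inj_on_def Y)
  finally have 2: "(Y * P) $$ n = (\<Sum>k\<in>?K. lcoef Ym (n - k) * P $$ k)" .
  have W: "mcoef (mwedge A (mlift F)) {g} n = (\<Sum>k\<in>?K. mcoef A {g} k * lcoef F (n - k))"
    "mcoef (mwedge (mlift F) A) {g} n = (\<Sum>k\<in>?K. lcoef F (n - k) * mcoef A {g} k)" for F
    by (rule mcoef_mwedge_lift[OF A fin K]; assumption)+
  have "mcoef (mcomm A (mlift Ym)) {g} n =
     (\<Sum>k\<in>?K. scalar x * P $$ k * lcoef Ym (n - k)) - (\<Sum>k\<in>?K. lcoef Ym (n - k) * (scalar x * P $$ k))"
    unfolding mcomm_def mcoef_diff by (simp only: W P)
  also have "(\<Sum>k\<in>?K. scalar x * P $$ k * lcoef Ym (n - k)) = scalar x * (P * Y) $$ n"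
    unfolding 1 by (simp add: sum_distrib_left mult.assoc)
  also have "(\<Sum>k\<in>?K. lcoef Ym (n - k) * (scalar x * P $$ k)) = scalar x * (Y * P) $$ n"
    unfolding 2 by (simp only: scalar_left_commute sum_distrib_left)
  finally show ?thesis by (simp add: comm_def right_diff_distrib)
qed

lemma mdiff_component:
  assumes "antider d" and A: "homog 1 A" "\<And>n. mcoef A {g} n = scalar (eta g) * P $$ n" "finite {n. P $$ n \<noteq> 0}"
  shows "(\<forall>n. mcoef (mdiff d (mlift Ym) + mcomm A (mlift Ym)) {g} n = 0) \<longleftrightarrow> lact (evf d g) Y = - comm P Y"
proof -
  interpret antider d by fact
  have "mcoef (mdiff d (mlift Ym)) {g} n = scalar (eta g) * lact (evf d g) Y $$ n" for n
    by (rule m2_eqI) (simp_all add: mcoef_def mdiff_def mlift_def der_evf Y lcoef_def flip: vf_evf vf_def)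
  then have "mcoef (mdiff d (mlift Ym) + mcomm A (mlift Ym)) {g} n = scalar (eta g) * (lact (evf d g) Y + comm P Y) $$ n" for n
    unfolding mcoef_add mcoef_mcomm_lift[OF A] by (simp add: distrib_left)
  then have "(\<forall>n. mcoef (mdiff d (mlift Ym) + mcomm A (mlift Ym)) {g} n = 0) \<longleftrightarrow> lact (evf d g) Y + comm P Y = 0"
    unfolding scalar_eta_cancel by (simp add: scalar_eta_cancel fls_eq_iff)
  then show ?thesis by (simp add: eq_neg_iff_add_eq_0)
qed

text \<open>
  The conjugate of \<open>Y\<close> is a series in \<open>\<lambda>\<^sup>-\<^sup>1\<close>; conjugate transposition moves its commutator with \<open>P\<close> back to a
  commutator of \<open>Y\<close>.
\<close>

lemma mcoef_mcomm_lift_star: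
  assumes A: "homog 1 A" and P: "\<And>n. mcoef A {g} n = scalar x * P $$ n" and P': "is_star P P'"
    and fin: "finite {n. P $$ n \<noteq> 0}"
  shows "mcoef (mcomm A (mlift (- mstar Ym))) {g} n = scalar x * adj (comm P' Y $$ (- n))"
proof -
  let ?K = "{n. P $$ n \<noteq> 0}"
  have K: "mcoef A {g} k = 0" if "k \<notin> ?K" for k using that by (simp add: P)
  have Z: "lcoef (- mstar Ym) n = - adj (Y $$ (- n))" for n
    by (rule m2_eqI) (simp_all add: lcoef_def mstar_def Y)
  have P'0: "P' $$ n = adj (P $$ (- n))" for n using P' by (simp add: is_star_def)
  have "(P' * Y) $$ (- n) = (\<Sum>k\<in>uminus ` ?K. P' $$ k * Y $$ (- n - k))"
  proof (rule fls_mult_nth_sum)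
    fix k assume k: "k \<notin> uminus ` ?K"
    have "- k \<notin> ?K"
    proof
      assume "- k \<in> ?K"
      then have "- (- k) \<in> uminus ` ?K" by (rule imageI)
      with k show False by simp
    qed
    then show "P' $$ k * Y $$ (- n - k) = 0" by (simp add: P'0)
  qed (use fin in simp)
  also have "\<dots> = (\<Sum>k\<in>?K. adj (P $$ k) * Y $$ (k - n))"
    by (simp add: sum.reindex P'0)
  finally have 1: "adj ((P' * Y) $$ (- n)) = (\<Sum>k\<in>?K. adj (Y $$ (k - n)) * P $$ k)"
    by (simp add: adj_sum adj_mult)
  have "(Y * P') $$ (- n) = (\<Sum>k\<in>(\<lambda>k. k - n) ` ?K. Y $$ k * P' $$ (- n - k))"
  proof (rule fls_mult_nth_sum)
    fix k assume k: "k \<notin> (\<lambda>k. k - n) ` ?K"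
    have "k + n \<notin> ?K"
    proof
      assume "k + n \<in> ?K"
      then have "(k + n) - n \<in> (\<lambda>k. k - n) ` ?K" by (rule imageI)
      with k show False by simp
    qed
    then show "Y $$ k * P' $$ (- n - k) = 0" by (simp add: P'0 add.commute)
  qed (use fin in simp)
  also have "\<dots> = (\<Sum>k\<in>?K. Y $$ (k - n) * adj (P $$ k))"
    by (simp add: sum.reindex inj_on_def P'0)
  finally have 2: "adj ((Y * P') $$ (- n)) = (\<Sum>k\<in>?K. P $$ k * adj (Y $$ (k - n)))"
    by (simp add: adj_sum adj_mult)
  have W: "mcoef (mwedge A (mlift F)) {g} n = (\<Sum>k\<in>?K. mcoef A {g} k * lcoef F (n - k))"
    "mcoef (mwedge (mlift F) A) {g} n = (\<Sum>k\<in>?K. lcoef F (n - k) * mcoef A {g} k)" for F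
    by (rule mcoef_mwedge_lift[OF A fin K]; assumption)+
  have "mcoef (mcomm A (mlift (- mstar Ym))) {g} n =
     (\<Sum>k\<in>?K. scalar x * P $$ k * - adj (Y $$ (k - n))) - (\<Sum>k\<in>?K. - adj (Y $$ (k - n)) * (scalar x * P $$ k))"
    unfolding mcomm_def mcoef_diff by (simp only: W P Z minus_diff_eq)
  also have "(\<Sum>k\<in>?K. scalar x * P $$ k * - adj (Y $$ (k - n))) = - scalar x * adj ((Y * P') $$ (- n))"
    unfolding 2 by (simp add: sum_distrib_left mult.assoc sum_negf)
  also have "(\<Sum>k\<in>?K. - adj (Y $$ (k - n)) * (scalar x * P $$ k)) = - scalar x * adj ((P' * Y) $$ (- n))"
    unfolding 1 by (simp add: scalar_left_commute sum_distrib_left sum_negf)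
  finally have F: "mcoef (mcomm A (mlift (- mstar Ym))) {g} n =
     - scalar x * adj ((Y * P') $$ (- n)) - - scalar x * adj ((P' * Y) $$ (- n))" .
  show ?thesis unfolding F by (simp add: comm_def right_diff_distrib)
qed

lemma mdiff_component_star:
  assumes "antider d" and A: "homog 1 A" "\<And>n. mcoef A {g} n = scalar (eta g) * P $$ n"
    and P': "is_star P P'" and fin: "finite {n. P $$ n \<noteq> 0}"
  shows "(\<forall>n. mcoef (mdiff d (mlift (- mstar Ym)) + mcomm A (mlift (- mstar Ym))) {g} n = 0) \<longleftrightarrow>
    lact (conj_der (evf d g)) Y = comm P' Y"
proof -
  interpret antider d by fact
  have "mcoef (mdiff d (mlift (- mstar Ym))) {g} n = - scalar (eta g) * adj (lact (conj_der (evf d g)) Y $$ (- n))" for n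
    by (rule m2_eqI)
       (simp_all add: mcoef_def mdiff_def mlift_def der_evf der_conj_der Y lcoef_def conj_der_def mstar_def
         derivation_minus[OF der_derivation[OF der_vf]] flip: vf_evf vf_def)
  then have "mcoef (mdiff d (mlift (- mstar Ym)) + mcomm A (mlift (- mstar Ym))) {g} n =
      scalar (eta g) * adj ((comm P' Y - lact (conj_der (evf d g)) Y) $$ (- n))" for n
    unfolding mcoef_add mcoef_mcomm_lift_star[OF A P' fin] by (simp add: algebra_simps)
  then have "(\<forall>n. mcoef (mdiff d (mlift (- mstar Ym)) + mcomm A (mlift (- mstar Ym))) {g} n = 0) \<longleftrightarrow>
      (\<forall>n. adj ((comm P' Y - lact (conj_der (evf d g)) Y) $$ (- n)) = 0)"
    by (simp only: scalar_eta_cancel)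
  also have "\<dots> \<longleftrightarrow> (\<forall>n. (comm P' Y - lact (conj_der (evf d g)) Y) $$ n = 0)"
    by (metis adj_simps(1,2) add.inverse_inverse)
  also have "\<dots> \<longleftrightarrow> comm P' Y = lact (conj_der (evf d g)) Y"
    by (simp add: fls_eq_iff)
  finally show ?thesis by auto
qed

text \<open>
  Both equations of (C) are equalities of 1-forms; their components along the rescaled coframe are the two
  conditions of a flow.
\<close>

lemma killing_equations_iff_flow:
  assumes d: "antider d"
  shows "mdiff d (mlift Ym) + mcomm (phi_ext Ym) (mlift Ym) = 0 \<and>
      mdiff d (mlift (- mstar Ym)) + mcomm (phi_ext Ym) (mlift (- mstar Ym)) = 0 \<longleftrightarrow>
    (\<forall>g. flow Y (evf d g) (ephi Y g) (ephi_star Y g))"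
proof -
  interpret antider d by fact
  have h: "homog 1 (mdiff d (mlift F) + mcomm (phi_ext Ym) (mlift F))" for F
    by (intro homog_add homog_mdiff homog_mcomm_lift homog_phi_ext d)
  show ?thesis
    unfolding homog_1_eq_0_iff[OF h] flow_def
    using mdiff_component[OF d homog_phi_ext mcoef_phi_ext ephi_finite(1)]
      mdiff_component_star[OF d homog_phi_ext mcoef_phi_ext is_star_ephi ephi_finite(1)]
    by (simp add: is_star_ephi der_evf) blast
qed

text \<open>
  The equation for \<open>d\<rho>\<close>, read on two coframe elements: the wedge products of \<open>\<phi>\<^sub>+\<close> and \<open>\<phi>\<^sub>-\<close> become
  commutators of their components.
\<close>

lemma degree_0_component:
  assumes "antider d" and gh: "pos g < pos h"
  shows "mcoef (mdiff d phi0 + (mwedge (phi_plus Ym) (phi_minus Ym) + mwedge (phi_minus Ym) (phi_plus Ym))) {g, h} 0 =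
    scalar (eta g * eta h) * (cmon 0 (ieta g * ieta h * d rho {g, h}) * Srho +
      proj {0} (comm (pphi Y g) (mphi Y h) + comm (mphi Y g) (pphi Y h))) $$ 0"
proof -
  interpret antider d by fact
  have d0: "mcoef (mdiff d phi0) {g, h} 0 = scalar (d rho {g, h}) * Srho $$ 0"
  proof -
    have c: "d (smult (cst z) rho) = smult (cst z) (d rho)" for z
      by (simp add: d_smult[OF Omega_theta(1)] d_cst)
    show ?thesis
      by (rule m2_eqI) (simp_all add: mcoef_def mdiff_def phi0_def lmono_def c Srho_nth mult.commute)
  qed
  have pair: "mcoef (mwedge A B) {g, h} 0 = scalar (eta g * eta h) * (P g * Q h - P h * Q g) $$ 0"
    if "homog 1 A" "homog 1 B" "\<And>g n. mcoef A {g} n = scalar (eta g) * P g $$ n"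
      "\<And>g n. mcoef B {g} n = scalar (eta g) * Q g $$ n" "\<And>g. finite {n. P g $$ n \<noteq> 0}" for A B P Q
  proof -
    let ?K = "{n. P g $$ n \<noteq> 0} \<union> {n. P h $$ n \<noteq> 0}"
    have K: "finite ?K" using that(5) by simp
    have "mcoef (mwedge A B) {g, h} 0 = (\<Sum>k\<in>?K. scalar (eta g) * P g $$ k * (scalar (eta h) * Q h $$ (0 - k))
       - scalar (eta h) * P h $$ k * (scalar (eta g) * Q g $$ (0 - k)))"
      unfolding that(3)[symmetric] that(4)[symmetric]
      by (rule mcoef_mwedge_pair[OF that(1,2) K _ gh]) (simp add: that(3))
    also have "\<dots> = (\<Sum>k\<in>?K. scalar (eta g * eta h) * (P g $$ k * Q h $$ (0 - k) - P h $$ k * Q g $$ (0 - k)))"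
    proof (rule sum.cong[OF refl])
      have *: "scalar x * X * (scalar y * Z) = scalar (x * y) * (X * Z)" for x y :: fn and X Z
        by (rule m2_eqI) (simp_all add: algebra_simps)
      show "scalar (eta g) * P g $$ k * (scalar (eta h) * Q h $$ (0 - k))
          - scalar (eta h) * P h $$ k * (scalar (eta g) * Q g $$ (0 - k)) =
        scalar (eta g * eta h) * (P g $$ k * Q h $$ (0 - k) - P h $$ k * Q g $$ (0 - k))" for k
        unfolding * right_diff_distrib by (simp add: mult.commute[of "eta h" "eta g"])
    qed
    also have "\<dots> = scalar (eta g * eta h) *
        ((\<Sum>k\<in>?K. P g $$ k * Q h $$ (0 - k)) - (\<Sum>k\<in>?K. P h $$ k * Q g $$ (0 - k)))"
      by (simp only: sum_distrib_left flip: sum_subtractf)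
    also have "(\<Sum>k\<in>?K. P g $$ k * Q h $$ (0 - k)) = (P g * Q h) $$ 0"
      by (rule fls_mult_nth_sum[OF K, symmetric]) simp
    also have "(\<Sum>k\<in>?K. P h $$ k * Q g $$ (0 - k)) = (P h * Q g) $$ 0"
      by (rule fls_mult_nth_sum[OF K, symmetric]) simp
    finally show ?thesis by simp
  qed
  have e: "scalar (eta g * eta h) * (scalar (ieta g * ieta h * d rho {g, h}) * X) = scalar (d rho {g, h}) * X" for X
  proof -
    have "eta g * eta h * (ieta g * ieta h * d rho {g, h}) = (eta g * ieta g) * (eta h * ieta h) * d rho {g, h}"
      by (simp only: ac_simps)
    then show ?thesis by (simp flip: mult.assoc scalar_mult)
  qed
  show ?thesis
    unfolding mcoef_add d0
      pair[OF homog_phi_plus homog_phi_minus mcoef_phi_plus mcoef_phi_minus ephi_finite(2)]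
      pair[OF homog_phi_minus homog_phi_plus mcoef_phi_minus mcoef_phi_plus ephi_finite(3)]
    by (simp add: e distrib_left right_diff_distrib comm_def)
qed

end

section \<open>The canonical formal Killing field\<close>

definition jets_upto :: "nat \<Rightarrow> fn set" where
  "jets_upto N = alg ({h2pow 1, h2pow (- 1)} \<union> jet_h ` {3..N})"

lemma jets_upto_mono: "N \<le> M \<Longrightarrow> x \<in> jets_upto N \<Longrightarrow> x \<in> jets_upto M"
  unfolding jets_upto_def by (erule alg_mono) auto

lemma jets_upto_subset: "x \<in> jets_upto N \<Longrightarrow> x \<in> alg jet_gens"
  unfolding jets_upto_def by (erule alg_mono) (auto simp: jet_gens_def)

lemma h2pow_jets [simp]: "h2pow p \<in> jets_upto N"
  unfolding jets_upto_def by (rule h2pow_in_alg) auto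

lemma jet_h_jets: "2 \<le> k \<Longrightarrow> k \<le> N \<Longrightarrow> jet_h k \<in> jets_upto N"
  using h2pow_jets[of 2 N] by (cases "k = 2") (auto simp: jet_h_def jets_upto_def intro!: alg.gen)

lemma jets_cst [simp]: "cst z \<in> jets_upto N"
  and jets_0 [simp]: "0 \<in> jets_upto N"
  and jets_add: "x \<in> jets_upto N \<Longrightarrow> y \<in> jets_upto N \<Longrightarrow> x + y \<in> jets_upto N"
  and jets_mult: "x \<in> jets_upto N \<Longrightarrow> y \<in> jets_upto N \<Longrightarrow> x * y \<in> jets_upto N"
  and jets_diff: "x \<in> jets_upto N \<Longrightarrow> y \<in> jets_upto N \<Longrightarrow> x - y \<in> jets_upto N"
  and jets_minus: "x \<in> jets_upto N \<Longrightarrow> - x \<in> jets_upto N"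
  and jets_sum: "(\<And>i. i \<in> A \<Longrightarrow> f i \<in> jets_upto N) \<Longrightarrow> sum f A \<in> jets_upto N"
  unfolding jets_upto_def by (auto intro: alg.intros alg_0 alg_diff alg_minus alg_sum)

lemmas jets_intros = jets_add jets_mult jets_diff jets_minus jets_sum jets_cst jets_0 h2pow_jets

lemma cst_2: "cst 2 = 2"
  using cst_add[of 1 1] by simp

lemma cst_h2pow_cancel:
  assumes "k \<noteq> 0"
  shows "cst (1 / k) * h2pow 1 * (cst k * h2pow (- 1) * x) = x"
    and "cst (1 / k) * h2pow (- 1) * (cst k * h2pow 1 * x) = x"
proof -
  have 1: "cst (1 / k) * h2pow p * (cst k * h2pow q * x) = (cst (1 / k) * cst k) * (h2pow p * h2pow q) * x" for p q
    by (simp only: ac_simps)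
  show "cst (1 / k) * h2pow 1 * (cst k * h2pow (- 1) * x) = x"
    "cst (1 / k) * h2pow (- 1) * (cst k * h2pow 1 * x) = x"
    unfolding 1 using cst_inverse[OF assms] by simp_all
qed

text \<open>
  Up to a unit and functions of lower order, \<open>x\<close> is the jet variable \<open>h\<^sub>N\<close>.
\<close>

definition leading :: "nat \<Rightarrow> fn \<Rightarrow> bool" where
  "leading N x \<longleftrightarrow> (\<exists>k j. k \<noteq> 0 \<and> x - cst k * h2pow j * jet_h N \<in> jets_upto (N - 1))"

lemma leading_add: "leading N x \<Longrightarrow> y \<in> jets_upto (N - 1) \<Longrightarrow> leading N (x + y)"
  unfolding leading_def
proof (elim exE conjE)
  fix k j assume *: "y \<in> jets_upto (N - 1)" "k \<noteq> 0" "x - cst k * h2pow j * jet_h N \<in> jets_upto (N - 1)"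
  have "x + y - cst k * h2pow j * jet_h N = (x - cst k * h2pow j * jet_h N) + y" by simp
  then show "\<exists>k j. k \<noteq> 0 \<and> x + y - cst k * h2pow j * jet_h N \<in> jets_upto (N - 1)"
    using * jets_add by metis
qed

lemma leading_mult: "leading N x \<Longrightarrow> l \<noteq> 0 \<Longrightarrow> leading N (cst l * h2pow i * x)"
  unfolding leading_def
proof (elim exE conjE)
  fix k j assume *: "l \<noteq> 0" "k \<noteq> 0" "x - cst k * h2pow j * jet_h N \<in> jets_upto (N - 1)"
  have "cst l * h2pow i * x - cst (l * k) * h2pow (i + j) * jet_h N =
    cst l * h2pow i * (x - cst k * h2pow j * jet_h N)"
    by (simp add: cst_mult h2pow_add algebra_simps)
  also have "\<dots> \<in> jets_upto (N - 1)" by (intro jets_intros *)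
  finally show "\<exists>k j. k \<noteq> 0 \<and> cst l * h2pow i * x - cst k * h2pow j * jet_h N \<in> jets_upto (N - 1)"
    using * by (intro exI[of _ "l * k"] exI[of _ "i + j"]) simp
qed

locale killing =
  fixes \<gamma> :: real and d\<^sub>0 :: "form \<Rightarrow> form" and a b c :: "nat \<Rightarrow> fn"
  assumes \<gamma>: "\<gamma>\<^sup>2 > 0" and cmc: "cmc_structure \<gamma> d\<^sub>0" and killing: "canonical_killing \<gamma> d\<^sub>0 a b c"
begin

lemma \<gamma>_nz: "complex_of_real \<gamma> \<noteq> 0"
  using \<gamma> by auto

sublocale antider d\<^sub>0
  using cmc by (simp add: antider_def cmc_structure_def)

lemma vf_jets:
  assumes "j \<ge> 2"
  shows "vf d\<^sub>0 Xi (jet_h j) = jet_h (Suc j)" "vf d\<^sub>0 Xib (jet_h j) = Tfun \<gamma> j"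
    "vf d\<^sub>0 Rho (jet_h j) = - cst (\<i> * of_nat j) * jet_h j"
    "vf d\<^sub>0 Xib (jet_hb j) = jet_hb (Suc j)" "vf d\<^sub>0 Xi (jet_hb j) = fn_conj (Tfun \<gamma> j)"
    "vf d\<^sub>0 Rho (jet_hb j) = cst (\<i> * of_nat j) * jet_hb j"
proof -
  have "d\<^sub>0 (fn0 (jet_h j)) + smult (cst (\<i> * of_nat j) * jet_h j) rho =
        smult (jet_h (j + 1)) xi + smult (Tfun \<gamma> j) xib"
    using cmc assms by (simp add: cmc_structure_def)
  from fun_cong[OF this] have "d\<^sub>0 (fn0 (jet_h j)) {g} + cst (\<i> * of_nat j) * jet_h j * rho {g} =
      jet_h (j + 1) * xi {g} + Tfun \<gamma> j * xib {g}" for g by simp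
  from this[of Xi] this[of Xib] this[of Rho]
  show "vf d\<^sub>0 Xi (jet_h j) = jet_h (Suc j)" "vf d\<^sub>0 Xib (jet_h j) = Tfun \<gamma> j"
    "vf d\<^sub>0 Rho (jet_h j) = - cst (\<i> * of_nat j) * jet_h j"
    by (simp_all add: vf_def theta_def eq_neg_iff_add_eq_0)
  have "d\<^sub>0 (fn0 (jet_hb j)) - smult (cst (\<i> * of_nat j) * jet_hb j) rho =
        smult (jet_hb (j + 1)) xib + smult (fn_conj (Tfun \<gamma> j)) xi"
    using cmc assms by (simp add: cmc_structure_def)
  from fun_cong[OF this] have "d\<^sub>0 (fn0 (jet_hb j)) {g} - cst (\<i> * of_nat j) * jet_hb j * rho {g} =
      jet_hb (j + 1) * xib {g} + fn_conj (Tfun \<gamma> j) * xi {g}" for g by simp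
  from this[of Xi] this[of Xib] this[of Rho]
  show "vf d\<^sub>0 Xib (jet_hb j) = jet_hb (Suc j)" "vf d\<^sub>0 Xi (jet_hb j) = fn_conj (Tfun \<gamma> j)"
    "vf d\<^sub>0 Rho (jet_hb j) = cst (\<i> * of_nat j) * jet_hb j"
    by (simp_all add: vf_def theta_def)
qed

definition Y :: "fn m2 fls" where
  "Y = Abs_fls (lcoef (Ymat a b c))"

lemma Y_nth: "Y $$ n = lcoef (Ymat a b c) n"
  unfolding Y_def
  by (rule nth_Abs_fls_bounded, rule bounded_belowI[of 0])
     (simp add: lcoef_def Ymat_def zero_m2_def)

lemma a_1: "a (Suc 0) = 0" and b_2: "b 2 = cst (- \<i> * of_real \<gamma>) * h2pow (- 1)" and c_2: "c 2 = cst \<i> * h2pow 1"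
  using killing by (simp_all add: canonical_killing_def)

lemma Y_entries:
  "e11 (Y $$ n) = (if 0 \<le> n \<and> even n then cst (- \<i>) * a (nat n + 1) else 0)"
  "e12 (Y $$ n) = (if 0 \<le> n \<and> odd n then cst 2 * c (nat n + 1) else 0)"
  "e21 (Y $$ n) = (if 0 \<le> n \<and> odd n then cst 2 * b (nat n + 1) else 0)"
  "e22 (Y $$ n) = - e11 (Y $$ n)"
  by (simp_all add: Y_nth lcoef_def Ymat_def cst_minus)

lemma Y_neg: "n \<le> 0 \<Longrightarrow> Y $$ n = 0"
  by (rule m2_eqI) (auto simp: Y_entries a_1)

lemma Y_supported: "supported {1..} Y"
  by (simp add: supported_def Y_neg)

lemma Y_1: "Y $$ 1 = M2 0 (cst (2 * \<i>) * h2pow 1) (cst (- 2 * \<i> * of_real \<gamma>) * h2pow (- 1)) 0"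
proof (rule m2_eqI)
  have c: "cst 2 * (cst z * x) = cst (2 * z) * x" for z x by (simp add: cst_mult mult.assoc)
  have "e12 (Y $$ 1) = cst 2 * c 2" "e21 (Y $$ 1) = cst 2 * b 2"
    by (simp_all add: Y_entries numeral_2_eq_2)
  then show "e12 (Y $$ 1) = e12 (M2 0 (cst (2 * \<i>) * h2pow 1) (cst (- 2 * \<i> * of_real \<gamma>) * h2pow (- 1)) 0)"
    "e21 (Y $$ 1) = e21 (M2 0 (cst (2 * \<i>) * h2pow 1) (cst (- 2 * \<i> * of_real \<gamma>) * h2pow (- 1)) 0)"
    unfolding b_2 c_2 c by (simp_all add: mult.assoc)
qed (simp_all add: Y_entries)

text \<open>
  The values of \<open>a\<^sup>1\<close>, \<open>b\<^sup>2\<close>, \<open>c\<^sup>2\<close> make \<open>U\<^sub>0 dt\<^sub>0\<close> the \<open>\<xi>\<close>-part of \<open>\<phi>\<^sub>\<lambda>\<close>.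
\<close>

lemma Upol_0: "Upol Y 0 $$ n = (if n = - 1 then M2 0 (h2pow 1) (cst (- of_real \<gamma>) * h2pow (- 1)) 0 else 0)"
proof -
  have U: "Upol Y 0 $$ n = (if n < 0 then scalar (cst (1 / (2 * \<i>))) * Y $$ (n + 2) else 0)"
    by (simp add: Upol_def Vser_def)
  have c: "cst (1 / (2 * \<i>)) * (cst (2 * \<i> * z) * x) = cst z * x" for z x
    by (simp flip: mult.assoc cst_mult)
  show ?thesis
  proof (cases "n = - 1")
    case True
    then show ?thesis using c[of 1 "h2pow 1"] c[of "- of_real \<gamma>" "h2pow (- 1)"]
      unfolding U by (simp add: Y_1 times_m2_def)
  next
    case False
    then show ?thesis by (simp add: U Y_neg)
  qed
qed

lemma Qpol_0: "Qpol Y 0 $$ n =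
    (if n = 1 then M2 0 (cst (- of_real \<gamma>) * fn_conj (h2pow (- 1))) (fn_conj (h2pow 1)) 0 else 0)"
proof -
  have "Qpol Y 0 $$ n = adj (Upol Y 0 $$ (- n))" using is_star_Qpol[of Y 0] by (simp add: is_star_def)
  moreover have "- n = - 1 \<longleftrightarrow> n = 1" by auto
  ultimately show ?thesis by (simp add: Upol_0 adj_def zero_m2_def)
qed

lemma homog_phi_lambda: "homog 1 (phi_lambda \<gamma>)"
  unfolding homog_def forall_two by (simp add: phi_lambda_def lmono_def Omega_smult Omega_add)

lemma mcoef_phi_lambda:
  assumes "g \<in> {Xi, Xib, Rho}"
  shows "mcoef (phi_lambda \<gamma>) {g} n = scalar (eta g) * ephi Y g $$ n"
proof -
  have h2: "cst (- 1 / 2) * h2pow 1 * h2pow 1 = cst (- 1 / 2) * jet_h 2" by (simp add: jet_h_2 mult.assoc)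
  have hg: "cst (- 1 / 2) * x * (cst (- of_real \<gamma>) * y) = cst (of_real \<gamma> / 2) * (x * y)" for x y
  proof -
    have "cst (- 1 / 2) * x * (cst (- of_real \<gamma>) * y) = (cst (- 1 / 2) * cst (- of_real \<gamma>)) * (x * y)"
      by (simp only: ac_simps)
    also have "cst (- 1 / 2) * cst (- of_real \<gamma>) = cst (of_real \<gamma> / 2)"
      by (simp flip: cst_mult)
    finally show ?thesis .
  qed
  have hb2: "cst (- 1 / 2) * fn_conj (h2pow 1) * fn_conj (h2pow 1) = - (cst (1 / 2) * jet_hb 2)"
    by (simp add: jet_hb_def jet_h_2 mult.assoc cst_minus[of "1 / 2", simplified])
  have neg: "- cst (of_real \<gamma> / 2) = cst (- of_real \<gamma> / 2)" using cst_minus[of "of_real \<gamma> / 2"] by simp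
  have Xi: "ephi Y Xi = Upol Y 0" and Xib: "ephi Y Xib = - Qpol Y 0"
    using phi_gT(4)[of Y 0] phi_gT(8)[of Y 0] by simp_all
  from assms consider "g = Xi" | "g = Xib" | "g = Rho" by auto
  then show ?thesis
  proof cases
    case 1
    have "mcoef (phi_lambda \<gamma>) {Xi} n = (if n = - 1 then
        M2 0 (cst (- 1 / 2) * h2pow 1 * h2pow 1) (cst (- 1 / 2) * h2pow 1 * (cst (- of_real \<gamma>) * h2pow (- 1))) 0 else 0)"
      unfolding h2 hg by (intro m2_eqI) (simp_all add: mcoef_def phi_lambda_def lmono_def theta_def)
    then show ?thesis
      unfolding 1 Xi Upol_0 by (simp add: eta_def times_m2_def zero_m2_def)
  next
    case 2
    have "mcoef (phi_lambda \<gamma>) {Xib} n = (if n = 1 then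
        - M2 0 (cst (- 1 / 2) * fn_conj (h2pow 1) * (cst (- of_real \<gamma>) * fn_conj (h2pow (- 1))))
          (cst (- 1 / 2) * fn_conj (h2pow 1) * fn_conj (h2pow 1)) 0 else 0)"
      unfolding hb2 hg conj_h2pow_inverse neg
      by (intro m2_eqI) (simp_all add: mcoef_def phi_lambda_def lmono_def theta_def neg)
    then show ?thesis
      unfolding 2 Xib by (simp add: Qpol_0 eta_def times_m2_def zero_m2_def uminus_m2_def)
  next
    case 3
    then show ?thesis
      by (intro m2_eqI) (simp_all add: mcoef_def phi_lambda_def lmono_def theta_def Srho_nth eta_def)
  qed
qed

text \<open>
  On the original directions \<open>\<xi>\<close>, \<open>\<xi>bar\<close>, \<open>\<rho>\<close> the extended form restricts to \<open>\<phi>\<^sub>\<lambda>\<close>, so the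
  original Killing equation is a special case of the flow equation.
\<close>

lemma lact_Y:
  assumes "g \<in> {Xi, Xib, Rho}"
  shows "lact (evf d\<^sub>0 g) Y = - comm (ephi Y g) Y"
proof -
  have "mdiff d\<^sub>0 (mlift (Ymat a b c)) + mcomm (phi_lambda \<gamma>) (mlift (Ymat a b c)) = 0"
    using killing by (simp add: canonical_killing_def)
  then have "\<forall>n. mcoef (mdiff d\<^sub>0 (mlift (Ymat a b c)) + mcomm (phi_lambda \<gamma>) (mlift (Ymat a b c))) {g} n = 0"
    by (simp add: mcoef_def zero_m2_def)
  then show ?thesis
    using mdiff_component[OF Y_nth antider_axioms homog_phi_lambda mcoef_phi_lambda[OF assms] ephi_finite(1)]
    by blast
qed

text \<open>Entrywise, a product of matrix series is computed in the commutative ring of scalar series.\<close>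

definition entry :: "(fn m2 \<Rightarrow> fn) \<Rightarrow> fn m2 fls \<Rightarrow> fn fls" where
  "entry s F = Abs_fls (\<lambda>n. s (F $$ n))"

lemma entry_nth: "s 0 = 0 \<Longrightarrow> entry s F $$ n = s (F $$ n)"
  unfolding entry_def
  by (rule nth_Abs_fls_bounded, rule bounded_belowI[of "fls_subdegree F"]) simp

lemma entry_mult:
  "entry e11 (F * G) = entry e11 F * entry e11 G + entry e12 F * entry e21 G"
  "entry e12 (F * G) = entry e11 F * entry e12 G + entry e12 F * entry e22 G"
  "entry e21 (F * G) = entry e21 F * entry e11 G + entry e22 F * entry e21 G"
  "entry e22 (F * G) = entry e21 F * entry e12 G + entry e22 F * entry e22 G"
proof -
  let ?K = "\<lambda>n. {fls_subdegree F..n - fls_subdegree G}"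
  have K: "F $$ k = 0 \<or> G $$ (n - k) = 0" if "k \<notin> ?K n" for k n using that by auto
  have E: "(entry s F * entry t G) $$ n = (\<Sum>k\<in>?K n. s (F $$ k) * t (G $$ (n - k)))"
    if "s 0 = 0" "t 0 = 0" for s t n
    using K that by (subst fls_mult_nth_sum[of "?K n"]) (auto simp: entry_nth)
  have FG: "(F * G) $$ n = (\<Sum>k\<in>?K n. F $$ k * G $$ (n - k))" for n
    using K by (subst fls_mult_nth_sum[of "?K n"]) auto
  show "entry e11 (F * G) = entry e11 F * entry e11 G + entry e12 F * entry e21 G"
    "entry e12 (F * G) = entry e11 F * entry e12 G + entry e12 F * entry e22 G"
    "entry e21 (F * G) = entry e21 F * entry e11 G + entry e22 F * entry e21 G"
    "entry e22 (F * G) = entry e21 F * entry e12 G + entry e22 F * entry e22 G"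
    by (simp_all add: fls_eq_iff entry_nth FG E m2_sum sum.distrib)
qed

lemma entry_e22_Y: "entry e22 Y = - entry e11 Y"
  by (simp add: fls_eq_iff entry_nth Y_entries)

text \<open>
  Cayley--Hamilton for a traceless matrix: \<open>Y\<^sup>2 = - det Y\<close>.
\<close>

lemma Y_square: "Y * Y = cmon 2 (cst (4 * of_real \<gamma>))"
proof -
  have "mdet (mlift (Ymat a b c)) = lmono 2 (fn0 (cst (- 4 * of_real \<gamma>)))"
    using killing by (simp add: canonical_killing_def)
  then have "mdet (mlift (Ymat a b c)) n {} = (if n = 2 then cst (- 4 * of_real \<gamma>) else 0)" for n
    by (simp add: lmono_def fn0_def)
  moreover have "mdet (mlift (Ymat a b c)) n {} =
    (entry e11 Y * entry e22 Y - entry e12 Y * entry e21 Y) $$ n" for n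
  proof -
    have w: "(fn0 f \<and>\<^sub>f fn0 g) {} = f * g" for f g by (simp add: fn0_wedge[OF Omega_fn0] fn0_apply)
    show ?thesis
      by (simp add: mdet_def lwedge_def fsum_def mlift_def w fls_mult_nth_any entry_nth Y_nth lcoef_def)
  qed
  ultimately have det: "(entry e11 Y * entry e22 Y - entry e12 Y * entry e21 Y) $$ n =
     (if n = 2 then cst (- 4 * of_real \<gamma>) else 0)" for n by simp
  have neg: "cst (- 4 * of_real \<gamma>) = - cst (4 * of_real \<gamma>)" by (simp flip: cst_minus)
  have "entry e11 (Y * Y) = - (entry e11 Y * entry e22 Y - entry e12 Y * entry e21 Y)"
    "entry e22 (Y * Y) = - (entry e11 Y * entry e22 Y - entry e12 Y * entry e21 Y)"
    "entry e12 (Y * Y) = 0" "entry e21 (Y * Y) = 0"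
    unfolding entry_mult entry_e22_Y by (simp_all add: mult.commute)
  then have "entry e11 (Y * Y) $$ n = - ((entry e11 Y * entry e22 Y - entry e12 Y * entry e21 Y) $$ n)"
    "entry e22 (Y * Y) $$ n = - ((entry e11 Y * entry e22 Y - entry e12 Y * entry e21 Y) $$ n)"
    "entry e12 (Y * Y) $$ n = 0" "entry e21 (Y * Y) $$ n = 0" for n
    by (simp_all only: fls_uminus_nth fls_zero_nth)
  then have "entry e11 (Y * Y) $$ n = (if n = 2 then cst (4 * of_real \<gamma>) else 0)"
    "entry e22 (Y * Y) $$ n = (if n = 2 then cst (4 * of_real \<gamma>) else 0)"
    "entry e12 (Y * Y) $$ n = 0" "entry e21 (Y * Y) $$ n = 0" for n
    unfolding det by (simp_all add: cst_minus)
  then show ?thesis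
    by (intro fls_eqI m2_eqI) (simp_all add: entry_nth)
qed

lemma comm_Upol_0:
  "comm (Upol Y 0) F $$ n = comm (M2 0 (h2pow 1) (cst (- of_real \<gamma>) * h2pow (- 1)) 0) (F $$ (n + 1))"
proof -
  have "(Upol Y 0 * F) $$ n = (\<Sum>k\<in>{- 1}. Upol Y 0 $$ k * F $$ (n - k))"
    by (rule fls_mult_nth_sum) (simp_all add: Upol_0)
  moreover have "(F * Upol Y 0) $$ n = (\<Sum>k\<in>{n + 1}. F $$ k * Upol Y 0 $$ (n - k))"
    by (rule fls_mult_nth_sum) (auto simp: Upol_0)
  ultimately show ?thesis by (simp add: comm_def Upol_0)
qed

abbreviation "e\<^sub>0 \<equiv> evf d\<^sub>0 Xi"

text \<open>
  Since \<open>U\<^sub>0\<close> is concentrated in degree \<open>-1\<close>, the Killing equation along \<open>\<xi>\<close> expresses the next coefficient of \<open>Y\<close>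
  by a derivative of the present one; it fixes only a combination of the two off-diagonal entries.
\<close>

lemma recursion:
  "e\<^sub>0 (e11 (Y $$ n)) = - (h2pow 1 * e21 (Y $$ (n + 1)) + cst (of_real \<gamma>) * h2pow (- 1) * e12 (Y $$ (n + 1)))"
  "e\<^sub>0 (e12 (Y $$ n)) = cst 2 * h2pow 1 * e11 (Y $$ (n + 1))"
proof -
  have "ephi Y Xi = Upol Y 0" using phi_gT(4)[of Y 0] by simp
  then have "lact e\<^sub>0 Y $$ n = - (comm (Upol Y 0) Y $$ n)" using lact_Y[of Xi] by simp
  then have "map_m2 e\<^sub>0 (Y $$ n) = - comm (M2 0 (h2pow 1) (cst (- of_real \<gamma>) * h2pow (- 1)) 0) (Y $$ (n + 1))"
    by (simp add: comm_Upol_0 der_evf)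
  then have "e11 (map_m2 e\<^sub>0 (Y $$ n)) = e11 (- comm (M2 0 (h2pow 1) (cst (- of_real \<gamma>) * h2pow (- 1)) 0) (Y $$ (n + 1)))"
    "e12 (map_m2 e\<^sub>0 (Y $$ n)) = e12 (- comm (M2 0 (h2pow 1) (cst (- of_real \<gamma>) * h2pow (- 1)) 0) (Y $$ (n + 1)))"
    by simp_all
  moreover have "e11 (comm (M2 0 (h2pow 1) (cst (- of_real \<gamma>) * h2pow (- 1)) 0) X) =
      h2pow 1 * e21 X + cst (of_real \<gamma>) * h2pow (- 1) * e12 X" for X
    by (simp add: comm_def cst_minus algebra_simps)
  moreover have "e12 (comm (M2 0 (h2pow 1) (cst (- of_real \<gamma>) * h2pow (- 1)) 0) (Y $$ m)) =
      - (cst 2 * h2pow 1 * e11 (Y $$ m))" for m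
    unfolding cst_2 by (simp add: comm_def Y_entries(4) algebra_simps)
  ultimately show "e\<^sub>0 (e11 (Y $$ n)) = - (h2pow 1 * e21 (Y $$ (n + 1)) + cst (of_real \<gamma>) * h2pow (- 1) * e12 (Y $$ (n + 1)))"
    "e\<^sub>0 (e12 (Y $$ n)) = cst 2 * h2pow 1 * e11 (Y $$ (n + 1))"
    by simp_all
qed

definition lower :: "int \<Rightarrow> fn" where
  "lower n = (\<Sum>k\<in>{2..n}. e11 (Y $$ k) * e11 (Y $$ (n + 2 - k)) + e12 (Y $$ k) * e21 (Y $$ (n + 2 - k)))"

text \<open>
  The complementary combination of the off-diagonal entries comes from the coefficient of \<open>\<lambda>\<^bsup>n+2\<^esup>\<close> in
  \<open>Y\<^sup>2 = 4 \<gamma> \<lambda>\<^sup>2\<close>, in which \<open>Y\<^sub>n\<^sub>+\<^sub>1\<close> is multiplied by the explicitly known \<open>Y\<^sub>1\<close>.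
\<close>

lemma det_recursion:
  assumes "n \<ge> 1"
  shows "h2pow 1 * e21 (Y $$ (n + 1)) - cst (of_real \<gamma>) * h2pow (- 1) * e12 (Y $$ (n + 1)) = cst (\<i> / 2) * lower n"
proof -
  have "(Y * Y) $$ (n + 2) = (\<Sum>k\<in>{1..n + 1}. Y $$ k * Y $$ (n + 2 - k))"
    by (rule fls_mult_nth_sum) (auto simp: Y_neg)
  also have "{1..n + 1} = insert 1 (insert (n + 1) {2..n})" using assms by auto
  finally have "(Y * Y) $$ (n + 2) = Y $$ 1 * Y $$ (n + 1) + (Y $$ (n + 1) * Y $$ 1 + (\<Sum>k\<in>{2..n}. Y $$ k * Y $$ (n + 2 - k)))"
    using assms by (simp add: algebra_simps)
  moreover have "(Y * Y) $$ (n + 2) = 0" using assms by (simp add: Y_square)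
  ultimately have "e11 (Y $$ 1 * Y $$ (n + 1) + (Y $$ (n + 1) * Y $$ 1 + (\<Sum>k\<in>{2..n}. Y $$ k * Y $$ (n + 2 - k)))) = 0"
    by simp
  then have 0: "cst (2 * \<i>) * h2pow 1 * e21 (Y $$ (n + 1)) +
      (e12 (Y $$ (n + 1)) * (cst (- 2 * \<i> * of_real \<gamma>) * h2pow (- 1)) + lower n) = 0"
    by (simp add: Y_1 m2_sum lower_def)
  have c: "cst (- 2 * \<i> * of_real \<gamma>) = - cst (2 * \<i>) * cst (of_real \<gamma>)"
    by (simp add: cst_minus flip: cst_mult)
  have "cst (2 * \<i>) * (h2pow 1 * e21 (Y $$ (n + 1)) - cst (of_real \<gamma>) * h2pow (- 1) * e12 (Y $$ (n + 1))) + lower n = 0"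
    using 0 unfolding c by (simp add: algebra_simps)
  then have "cst (2 * \<i>) * (h2pow 1 * e21 (Y $$ (n + 1)) - cst (of_real \<gamma>) * h2pow (- 1) * e12 (Y $$ (n + 1))) = - lower n"
    by (simp add: eq_neg_iff_add_eq_0)
  then have "cst (- \<i> / 2) * (cst (2 * \<i>) * (h2pow 1 * e21 (Y $$ (n + 1)) - cst (of_real \<gamma>) * h2pow (- 1) * e12 (Y $$ (n + 1))))
      = cst (\<i> / 2) * lower n"
    using cst_minus[of "\<i> / 2"] by simp
  then show ?thesis by (simp flip: mult.assoc cst_mult)
qed

lemma solved_recursion:
  assumes "n \<ge> 1"
  defines "X \<equiv> - e\<^sub>0 (e11 (Y $$ n))" and "Z \<equiv> cst (\<i> / 2) * lower n"
  shows "e11 (Y $$ (n + 1)) = cst (1 / 2) * h2pow (- 1) * e\<^sub>0 (e12 (Y $$ n))"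
    and "e12 (Y $$ (n + 1)) = cst (1 / (2 * of_real \<gamma>)) * h2pow 1 * (X - Z)"
    and "e21 (Y $$ (n + 1)) = cst (1 / 2) * h2pow (- 1) * (X + Z)"
proof -
  show "e11 (Y $$ (n + 1)) = cst (1 / 2) * h2pow (- 1) * e\<^sub>0 (e12 (Y $$ n))"
    unfolding recursion(2) by (rule cst_h2pow_cancel(2)[symmetric]) simp
  have X: "X = h2pow 1 * e21 (Y $$ (n + 1)) + cst (of_real \<gamma>) * h2pow (- 1) * e12 (Y $$ (n + 1))"
    unfolding X_def recursion(1) by simp
  have Z: "Z = h2pow 1 * e21 (Y $$ (n + 1)) - cst (of_real \<gamma>) * h2pow (- 1) * e12 (Y $$ (n + 1))"
    unfolding Z_def det_recursion[OF assms(1)] ..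
  have "X - Z = cst (2 * of_real \<gamma>) * h2pow (- 1) * e12 (Y $$ (n + 1))"
    unfolding X Z cst_mult cst_2 by (simp add: algebra_simps)
  then show "e12 (Y $$ (n + 1)) = cst (1 / (2 * of_real \<gamma>)) * h2pow 1 * (X - Z)"
    using cst_h2pow_cancel(1)[of "2 * of_real \<gamma>"] \<gamma>_nz by simp
  have "X + Z = cst 2 * h2pow 1 * e21 (Y $$ (n + 1))"
    unfolding X Z cst_2 by (simp add: algebra_simps)
  then show "e21 (Y $$ (n + 1)) = cst (1 / 2) * h2pow (- 1) * (X + Z)"
    using cst_h2pow_cancel(2)[of 2] by simp
qed

abbreviation "del_xi \<equiv> vf d\<^sub>0 Xi"

lemma del_xi_h2pow_1: "del_xi (h2pow 1) = cst (1 / 2) * h2pow (- 1) * jet_h 3"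
  using der_h2pow_1[OF der_vf, of Xi] vf_jets(1)[of 2] by (simp add: numeral_3_eq_3 numeral_2_eq_2)

lemma del_xi_jets:
  assumes "N \<ge> 2" "x \<in> jets_upto N"
  shows "del_xi x \<in> jets_upto (Suc N)"
  using assms(2) unfolding jets_upto_def[of N]
proof (induction rule: alg.induct)
  case (gen g)
  have u: "del_xi (h2pow 1) \<in> jets_upto (Suc N)"
    unfolding del_xi_h2pow_1 by (intro jets_intros jet_h_jets) (use assms(1) in auto)
  then have "del_xi (h2pow (- 1)) \<in> jets_upto (Suc N)"
    unfolding der_h2pow_neg[OF der_vf] by (intro jets_intros)
  moreover have "del_xi (jet_h k) \<in> jets_upto (Suc N)" if "3 \<le> k" "k \<le> N" for k
    using vf_jets(1)[of k] jet_h_jets[of "Suc k" "Suc N"] that by simp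
  ultimately show ?case using u gen by auto
next
  case (mult f g)
  have "f \<in> jets_upto (Suc N)" "g \<in> jets_upto (Suc N)"
    using mult(1,2) jets_upto_mono[of N "Suc N"] by (simp_all add: jets_upto_def)
  with mult show ?case
    unfolding der_mult[OF der_vf] by (intro jets_intros)
qed (simp_all add: der_cst[OF der_vf] der_add[OF der_vf] jets_intros)

lemma e\<^sub>0_jets: "N \<ge> 2 \<Longrightarrow> x \<in> jets_upto N \<Longrightarrow> e\<^sub>0 x \<in> jets_upto (Suc N)"
  unfolding evf_def ieta_def using del_xi_jets by (auto intro!: jets_intros)

text \<open>
  The derivative along \<open>\<xi>\<close> raises the order by one and sends \<open>h\<^sub>N\<close> to \<open>h\<^sub>N\<^sub>+\<^sub>1\<close>; differentiating the unit
  only produces \<open>h\<^sub>3\<close>, which has lower order.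
\<close>

lemma leading_e\<^sub>0:
  assumes "leading N x" "N \<ge> 3"
  shows "leading (Suc N) (e\<^sub>0 x)"
proof -
  obtain k j where kj: "k \<noteq> 0" "x - cst k * h2pow j * jet_h N \<in> jets_upto (N - 1)"
    using assms(1) by (auto simp: leading_def)
  have "del_xi x = del_xi (x - cst k * h2pow j * jet_h N) + cst k * del_xi (h2pow j) * jet_h N + cst k * h2pow j * jet_h (Suc N)"
    using vf_jets(1)[of N] assms(2) by (simp add: der_diff[OF der_vf] der_mult[OF der_vf] der_cst[OF der_vf] algebra_simps)
  moreover have "del_xi (x - cst k * h2pow j * jet_h N) \<in> jets_upto N"
    using del_xi_jets[OF _ kj(2)] assms(2) by simp
  moreover have "del_xi (h2pow j) \<in> jets_upto N"
    using del_xi_jets[of 2 "h2pow j"] assms(2) by (auto intro: jets_upto_mono[of 3 N] simp: eval_nat_numeral)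
  moreover have "jet_h N \<in> jets_upto N" using assms(2) by (auto intro: jet_h_jets)
  ultimately have "del_xi x - cst k * h2pow j * jet_h (Suc N) \<in> jets_upto N"
    by (auto intro!: jets_intros)
  then have "leading (Suc N) (del_xi x)" using kj(1) by (auto simp: leading_def)
  then show ?thesis unfolding evf_def ieta_def by (simp add: leading_mult)
qed

lemma Y_jets:
  "e11 (Y $$ int n) \<in> jets_upto (n + 1) \<and> e12 (Y $$ int n) \<in> jets_upto (n + 1) \<and> e21 (Y $$ int n) \<in> jets_upto (n + 1)"
proof (induction n rule: less_induct)
  case (less n)
  consider "n = 0" | "n = 1" | m where "n = Suc m" "m \<ge> 1"
    by (metis One_nat_def Suc_leI not0_implies_Suc neq0_conv)
  then show ?case
  proof cases
    case 3
    have mem: "e11 (Y $$ k) \<in> jets_upto (n + 1)" "e12 (Y $$ k) \<in> jets_upto (n + 1)" "e21 (Y $$ k) \<in> jets_upto (n + 1)"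
      if "0 \<le> k" "k \<le> int m" for k
      using less[of "nat k"] that 3 jets_upto_mono[of "nat k + 1" "n + 1"] by auto
    have low: "lower (int m) \<in> jets_upto (n + 1)"
      unfolding lower_def by (intro jets_intros mem) auto
    have e: "e\<^sub>0 (e11 (Y $$ int m)) \<in> jets_upto (n + 1)" "e\<^sub>0 (e12 (Y $$ int m)) \<in> jets_upto (n + 1)"
      using e\<^sub>0_jets[of "m + 1"] less[of m] 3 by auto
    have n: "int n = int m + 1" using 3 by simp
    have m1: "int m \<ge> 1" using 3 by simp
    show ?thesis
      unfolding n solved_recursion[OF m1] by (intro conjI jets_intros low e)
  qed (simp_all add: Y_neg Y_1 jets_intros)
qed

lemma Y_in_jets:
  "e11 (Y $$ n) \<in> alg jet_gens" "e12 (Y $$ n) \<in> alg jet_gens" "e21 (Y $$ n) \<in> alg jet_gens" "e22 (Y $$ n) \<in> alg jet_gens"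
proof -
  show *: "e11 (Y $$ n) \<in> alg jet_gens" "e12 (Y $$ n) \<in> alg jet_gens" "e21 (Y $$ n) \<in> alg jet_gens"
    using Y_jets[of "nat n"] jets_upto_subset by (cases "n \<ge> 0"; fastforce simp: Y_neg alg_0)+
  show "e22 (Y $$ n) \<in> alg jet_gens" using alg_minus[OF *(1)] by (simp add: Y_entries(4))
qed

text \<open>
  Even degrees of \<open>Y\<close> are diagonal and odd ones are off-diagonal, so the entry carrying the new jet variable alternates.
  Each step of the recursion differentiates once and multiplies by a unit.
\<close>

lemma Y_leading:
  "leading (n + 3) (if even n then e11 (Y $$ (int n + 2)) else e12 (Y $$ (int n + 2)))"
proof (induction n)
  case 0
  have "e11 (Y $$ 2) = cst (1 / 2) * h2pow (- 1) * e\<^sub>0 (e12 (Y $$ 1))"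
    using solved_recursion(1)[of 1] by simp
  also have "\<dots> = cst (- \<i>) * h2pow (- 3) * jet_h 3"
  proof -
    have h: "h2pow (- 3) = h2pow (- 1) * h2pow (- 1) * h2pow (- 1)" by (simp flip: h2pow_add)
    have k: "cst (- \<i>) = cst (1 / 2) * cst (- 2) * cst (2 * \<i>) * cst (1 / 2)" by (simp flip: cst_mult)
    show ?thesis
      unfolding h k by (simp add: Y_1 der_mult[OF der_evf] der_cst[OF der_evf] evf_def ieta_def del_xi_h2pow_1)
        (simp only: der_mult[OF der_vf] der_cst[OF der_vf] del_xi_h2pow_1 ac_simps mult_zero_left mult_zero_right add_0_left)
  qed
  finally have "e11 (Y $$ 2) - cst (- \<i>) * h2pow (- 3) * jet_h 3 \<in> jets_upto 2" by simp
  then show ?case unfolding leading_def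
    by (intro exI[of _ "- \<i>"] exI[of _ "- 3"]) simp
next
  case (Suc n)
  have n: "int n + 2 \<ge> 1" by simp
  have idx: "int (Suc n) + 2 = (int n + 2) + 1" by simp
  show ?case
  proof (cases "even n")
    case True
    then have "leading (n + 3) (e11 (Y $$ (int n + 2)))" using Suc by simp
    then have "leading (Suc n + 3) (e\<^sub>0 (e11 (Y $$ (int n + 2))))" using leading_e\<^sub>0 by fastforce
    then have L: "leading (Suc n + 3) (cst (- 1) * h2pow 0 * e\<^sub>0 (e11 (Y $$ (int n + 2))))"
      by (rule leading_mult) simp
    have "lower (int n + 2) \<in> jets_upto (n + 3)"
      unfolding lower_def
    proof (intro jets_intros)
      fix k assume k: "k \<in> {2..int n + 2}"
      have mem: "e11 (Y $$ k) \<in> jets_upto (n + 3)" "e12 (Y $$ k) \<in> jets_upto (n + 3)" "e21 (Y $$ k) \<in> jets_upto (n + 3)"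
        if "0 \<le> k" "k \<le> int n + 2" for k
        using Y_jets[of "nat k"] that jets_upto_mono[of "nat k + 1" "n + 3"] by auto
      show "e11 (Y $$ k) \<in> jets_upto (n + 3)" "e11 (Y $$ (int n + 2 + 2 - k)) \<in> jets_upto (n + 3)"
        "e12 (Y $$ k) \<in> jets_upto (n + 3)" "e21 (Y $$ (int n + 2 + 2 - k)) \<in> jets_upto (n + 3)"
        using k by (intro mem; simp)+
    qed
    then have "- (cst (\<i> / 2) * lower (int n + 2)) \<in> jets_upto (n + 3)" by (intro jets_intros)
    moreover have "Suc n + 3 - 1 = n + 3" by simp
    ultimately have "- (cst (\<i> / 2) * lower (int n + 2)) \<in> jets_upto (Suc n + 3 - 1)" by (simp only:)
    from leading_mult[OF leading_add[OF L this], of "1 / (2 * of_real \<gamma>)" 1]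
    show ?thesis
      using True \<gamma>_nz unfolding idx solved_recursion[OF n] by (simp add: cst_minus)
  next
    case False
    then have "leading (n + 3) (e12 (Y $$ (int n + 2)))" using Suc by simp
    then have "leading (Suc n + 3) (e\<^sub>0 (e12 (Y $$ (int n + 2))))" using leading_e\<^sub>0 by fastforce
    then show ?thesis
      using False leading_mult[of _ _ "1 / 2" "- 1"] unfolding idx solved_recursion[OF n] by simp
  qed
qed

text \<open>
  The coefficients of \<open>Y\<close> contain \<open>h\<^sub>2\<^sup>1\<^sup>/\<^sup>2\<close> in degree 1, and then one new jet variable after the other with a
  unit coefficient.
\<close>

lemma kills_jets:
  assumes K: "der K" and KY: "lact K Y = 0" and f: "f \<in> alg jet_gens"
  shows "K f = 0"
proof -
  have K0: "map_m2 K (Y $$ n) = 0" for n using K lact_nth_der[OF K, of Y n] by (simp add: KY)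
  have Kp: "K (e11 (Y $$ n)) = 0" and Kq: "K (e12 (Y $$ n)) = 0" for n
    using arg_cong[OF K0[of n], of e11] arg_cong[OF K0[of n], of e12] by simp_all
  have u: "K (h2pow 1) = 0"
  proof -
    have "cst (2 * \<i>) * K (h2pow 1) = 0" using Kq[of 1] by (simp add: Y_1 der_mult[OF K] der_cst[OF K])
    then have "cst (1 / (2 * \<i>)) * (cst (2 * \<i>) * K (h2pow 1)) = 0" by simp
    then show ?thesis by (simp flip: mult.assoc cst_mult)
  qed
  have hp: "K (h2pow p) = 0" for p
  proof (rule der_eq_on_alg[OF K der_zero _ h2pow_in_alg[OF order_refl]])
    show "K g = 0" if "g \<in> {h2pow 1, h2pow (- 1)}" for g
      using that u by (auto simp: der_h2pow_neg[OF K])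
  qed
  have "\<forall>x \<in> jets_upto N. K x = 0" for N
  proof (induction N)
    case 0
    show ?case
    proof
      fix x assume "x \<in> jets_upto 0"
      then show "K x = 0" unfolding jets_upto_def
        by (rule der_eq_on_alg[OF K der_zero, rotated]) (auto simp: hp)
    qed
  next
    case (Suc N)
    have new: "K (jet_h (Suc N)) = 0" if "Suc N \<ge> 3"
    proof -
      from that have "2 \<le> N" by simp
      then obtain M where M: "N = 2 + M" using le_Suc_ex by blast
      define x where "x = (if even M then e11 (Y $$ (int M + 2)) else e12 (Y $$ (int M + 2)))"
      have "leading (Suc N) x" using Y_leading[of M] by (simp add: x_def M eval_nat_numeral)
      moreover have "K x = 0" by (simp add: x_def Kp Kq)
      ultimately obtain k j where x: "K x = 0" "k \<noteq> 0" "x - cst k * h2pow j * jet_h (Suc N) \<in> jets_upto N"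
        unfolding leading_def by auto
      from Suc x(3) have "K (x - cst k * h2pow j * jet_h (Suc N)) = 0" by blast
      then have "cst k * h2pow j * K (jet_h (Suc N)) = 0"
        by (simp add: der_diff[OF K] der_mult[OF K] der_cst[OF K] x(1) hp)
      then have "cst (1 / k) * h2pow (- j) * (cst k * h2pow j * K (jet_h (Suc N))) = 0" by simp
      moreover have "cst (1 / k) * h2pow (- j) * (cst k * h2pow j * K (jet_h (Suc N))) =
         (cst (1 / k) * cst k) * (h2pow (- j) * h2pow j) * K (jet_h (Suc N))" by (simp only: ac_simps)
      ultimately show ?thesis using x(2) by (simp flip: cst_mult h2pow_add)
    qed
    have gens: "K g = 0" if "g \<in> {h2pow 1, h2pow (- 1)} \<union> jet_h ` {3..Suc N}" for g
    proof -
      from that consider "g = h2pow 1 \<or> g = h2pow (- 1)" | "g = jet_h (Suc N)" "Suc N \<ge> 3"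
        | k where "g = jet_h k" "3 \<le> k" "k \<le> N" by (auto simp: le_Suc_eq)
      then show ?thesis
        using new Suc jet_h_jets[of _ N] by cases (auto simp: hp)
    qed
    show ?case
    proof
      fix x assume "x \<in> jets_upto (Suc N)"
      then show "K x = 0" unfolding jets_upto_def
        by (rule der_eq_on_alg[OF K der_zero, rotated]) (rule gens)
    qed
  qed
  then have "K (jet_h k) = 0" if "k \<ge> 3" for k using jet_h_jets[of k k] that by auto
  then show ?thesis
    using der_eq_on_jets[OF K der_zero _ _ f] u by simp
qed

end

section \<open>The square of the exterior derivative of the hierarchy\<close>

lemma curvature_antisym: "curvature f Q e P (- Z) = - curvature e P f Q Z"
  by (simp add: curvature_def comm_def)

text \<open>
  The extended form is flat along any two directions; pairs of two barred directions follow from unbarred ones by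
  conjugation.
\<close>

lemma flat_ephi:
  assumes flow: "\<And>g. flow Y (e g) (ephi Y g) (ephi_star Y g)"
  shows "curvature (e g) (ephi Y g) (e h) (ephi Y h)
     (- proj {0} (comm (pphi Y g) (mphi Y h) + comm (mphi Y g) (pphi Y h))) = 0"
proof -
  have der: "der (e g)" and eq: "lact (e g) Y = - comm (ephi Y g) Y"
    and eq': "lact (conj_der (e g)) Y = comm (ephi_star Y g) Y" for g
    using flow[of g] by (auto simp: flow_def)
  have p0: "proj {0} (0 :: fn m2 fls) = 0" by (simp add: fls_eq_iff)
  have c0: "comm 0 X = 0" "comm X 0 = 0" for X :: "fn m2 fls" by (simp_all add: comm_def)
  have tb_t: "curvature (e (gT m)) (Upol Y m) (e (gTb l)) (- Qpol Y l) (- proj {0} (comm (Qpol Y l) (Upol Y m))) = 0" for m l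
    by (rule flat_ttb[OF der der]) (use eq'[of "gT m"] eq[of "gTb l"] in \<open>simp_all add: comm_simps\<close>)
  have rho_t: "curvature (e Rho) Srho (e (gT m)) (Upol Y m) 0 = 0" for m
    by (rule flat_rho[OF der der]) (use eq[of Rho] in simp)
  have rho_tb: "curvature (e Rho) Srho (e (gTb m)) (- Qpol Y m) 0 = 0" for m
  proof -
    have "curvature (conj_der (e Rho)) Srho (conj_der (e (gTb m))) (Upol Y m) 0 = 0"
      by (rule flat_rho) (use eq'[of Rho] in \<open>simp_all add: der der_conj_der comm_simps\<close>)
    from curvature_conj[OF this _ _ is_star_Srho is_star_Qpol is_star_0] show ?thesis
      by (simp add: der der_conj_der)
  qed
  have tb_tb: "curvature (e (gTb m)) (- Qpol Y m) (e (gTb l)) (- Qpol Y l) 0 = 0" for m l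
  proof -
    have "curvature (conj_der (e (gTb m))) (Upol Y m) (conj_der (e (gTb l))) (Upol Y l) 0 = 0"
      by (rule flat_tt) (use eq'[of "gTb m"] eq'[of "gTb l"] in \<open>simp_all add: der der_conj_der comm_simps\<close>)
    from curvature_conj[OF this _ _ is_star_Qpol is_star_Qpol is_star_0] show ?thesis
      by (simp add: der der_conj_der)
  qed
  note sym = curvature_antisym[of _ _ _ _ 0, simplified]
  show ?thesis
  proof (cases g rule: coframe_cases)
    case rho
    then show ?thesis
    proof (cases h rule: coframe_cases)
      case rho
      with \<open>g = Rho\<close> show ?thesis by (simp add: p0 c0) (simp add: curvature_def comm_def)
    qed (simp_all add: p0 c0 rho_t rho_tb)
  next
    case (t m)
    then show ?thesis
    proof (cases h rule: coframe_cases)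
      case (t l)
      with \<open>g = gT m\<close> show ?thesis
        using flat_tt[OF der der, of "gT m" Y m "gT l" l] eq[of "gT m"] eq[of "gT l"] by (simp add: p0 c0)
    next
      case (tb l)
      have "comm (Upol Y m) (- Qpol Y l) = comm (Qpol Y l) (Upol Y m)" by (simp add: comm_def)
      with \<open>g = gT m\<close> tb show ?thesis using tb_t[of m l] by (simp add: c0)
    next
      case rho
      with \<open>g = gT m\<close> show ?thesis using rho_t[of m] by (simp add: p0 c0 sym[of "e (gT m)"])
    qed
  next
    case (tb m)
    then show ?thesis
    proof (cases h rule: coframe_cases)
      case (t l)
      have "curvature (e (gTb m)) (- Qpol Y m) (e (gT l)) (Upol Y l)
          (- (- proj {0} (comm (Qpol Y m) (Upol Y l)))) = 0"
        by (simp only: curvature_antisym[of _ _ _ _ "- proj {0} (comm (Qpol Y m) (Upol Y l))"] tb_t minus_zero)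
      with \<open>g = gTb m\<close> t show ?thesis by (simp add: c0 comm_simps proj_simps)
    next
      case (tb l)
      with \<open>g = gTb m\<close> show ?thesis using tb_tb[of m l] by (simp add: p0 c0)
    next
      case rho
      with \<open>g = gTb m\<close> show ?thesis using rho_tb[of m] by (simp add: p0 c0 sym[of "e (gTb m)"])
    qed
  qed
qed

text \<open>
  The infinite sums in the structure equations are wedge products of one 1-form with \<open>\<xi>\<close>; each coefficient
  receives at most two contributions.
\<close>

lemma fsum_wedge:
  fixes f :: "nat \<Rightarrow> fn" and k :: "nat \<Rightarrow> coframe" and e :: coframe
  assumes "inj k"
  shows "smult x (rho \<and>\<^sub>f theta e) + fsum (\<lambda>m. smult (f m) (theta (k m) \<and>\<^sub>f theta e)) =
    (smult x rho + fsum (\<lambda>m. smult (f m) (theta (k m)))) \<and>\<^sub>f theta e" (is "?L = ?R")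
proof (rule Omega_2_eqI)
  have 1: "theta g \<and>\<^sub>f theta e \<in> Omega 2" for g
    using Omega_wedge[OF Omega_theta(1)[of g] Omega_theta(1)[of e]] by (simp add: numeral_2_eq_2)
  show "?L \<in> Omega 2" by (intro Omega_add Omega_smult Omega_fsum 1)
  have \<omega>: "smult x rho + fsum (\<lambda>m. smult (f m) (theta (k m))) \<in> Omega 1"
    by (intro Omega_add Omega_smult Omega_fsum Omega_theta)
  show "?R \<in> Omega 2" using Omega_wedge[OF \<omega> Omega_theta(1)] by (simp add: numeral_2_eq_2)
  fix g h assume gh: "pos g < pos h"
  let ?M = "{m. k m = g} \<union> {m. k m = h}"
  have fin: "finite ?M"
    using finite_vimageI[OF _ assms, of "{g}"] finite_vimageI[OF _ assms, of "{h}"] by (simp add: vimage_def)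
  have s: "Sum_any F = sum F ?M" if "\<And>m. m \<notin> ?M \<Longrightarrow> F m = 0" for F :: "nat \<Rightarrow> fn"
    using that by (intro Sum_any.expand_superset fin) auto
  have "Sum_any (\<lambda>m. f m * (theta (k m) {g} * theta e {h} - theta (k m) {h} * theta e {g})) =
      sum (\<lambda>m. f m * (theta (k m) {g} * theta e {h} - theta (k m) {h} * theta e {g})) ?M"
    "Sum_any (\<lambda>m. f m * theta (k m) {g}) = sum (\<lambda>m. f m * theta (k m) {g}) ?M"
    "Sum_any (\<lambda>m. f m * theta (k m) {h}) = sum (\<lambda>m. f m * theta (k m) {h}) ?M"
    by (intro s; auto simp: theta_def)+
  note sums = this
  have L: "?L {g, h} = x * (rho {g} * theta e {h} - rho {h} * theta e {g}) +
      Sum_any (\<lambda>m. f m * (theta (k m) {g} * theta e {h} - theta (k m) {h} * theta e {g}))"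
    by (simp add: fsum_def wedge_pair[OF Omega_theta(1) Omega_theta(1) gh])
  have R: "?R {g, h} = (x * rho {g} + Sum_any (\<lambda>m. f m * theta (k m) {g})) * theta e {h} -
      (x * rho {h} + Sum_any (\<lambda>m. f m * theta (k m) {h})) * theta e {g}"
    unfolding wedge_pair[OF \<omega> Omega_theta(1) gh] by (simp add: fsum_def)
  show "?L {g, h} = ?R {g, h}"
    unfolding L R sums by (simp add: sum_distrib_left sum_distrib_right sum_subtractf algebra_simps)
qed

lemma fsum_theta_apply: "inj k \<Longrightarrow> fsum (\<lambda>m. smult (f m) (theta (k m))) {k m} = f m"
  unfolding fsum_def by (subst Sum_any_single[of m]) (auto simp: theta_def inj_eq)

lemma fsum_theta_apply_0: "g \<notin> range k \<Longrightarrow> fsum (\<lambda>m. smult (f m) (theta (k m))) {g} = 0"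
proof -
  assume "g \<notin> range k"
  then have "smult (f m) (theta (k m)) {g} = 0" for m by (auto simp: theta_def)
  then show ?thesis by (simp add: fsum_def)
qed

lemma inj_DT: "inj DT" "inj DTb"
  by (simp_all add: inj_def)

lemma dt_Suc: "dt (Suc m) = theta (DT m)" "dtb (Suc m) = theta (DTb m)"
  by (simp_all add: dt_def dtb_def)

text \<open>
  \<open>d (x \<theta>) = (dx + x \<omega>) \<and> \<theta>\<close>, and \<open>dx + x \<omega>\<close> is a multiple of \<open>\<theta>\<close>. With \<open>x = - h\<^sub>2\<^sup>1\<^sup>/\<^sup>2 / 2\<close> and \<open>\<theta> = \<xi>\<close> this shows that
  \<open>dt\<^sub>0\<close> is closed.
\<close>

lemma (in antider) closed_smult_theta:
  assumes \<omega>: "\<omega> \<in> Omega 1" and e: "d (theta e) = \<omega> \<and>\<^sub>f theta e"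
    and x: "\<And>h. h \<noteq> e \<Longrightarrow> vf d h x = - x * \<omega> {h}"
  shows "d (smult x (theta e)) = 0"
proof (rule Omega_2_eqI)
  show "d (smult x (theta e)) \<in> Omega 2"
    using d_Omega[OF Omega_smult[OF Omega_theta(1)]] by (simp add: numeral_2_eq_2)
  fix g h assume gh: "pos g < pos h"
  then have "g \<noteq> h" by auto
  have "d (smult x (theta e)) {g, h} =
     vf d g x * theta e {h} - vf d h x * theta e {g} + x * (\<omega> {g} * theta e {h} - \<omega> {h} * theta e {g})"
    by (simp add: d_smult[OF Omega_theta(1)] e wedge_pair[OF d_fn0_Omega(1) Omega_theta(1) gh]
        wedge_pair[OF \<omega> Omega_theta(1) gh] vf_def)
  also have "\<dots> = 0"
    using x[of g] x[of h] \<open>g \<noteq> h\<close> by (cases "e = g"; cases "e = h") (simp_all add: theta_def)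
  finally show "d (smult x (theta e)) {g, h} = 0 {g, h}" by simp
qed simp

lemma fn_conj_jet_h: "fn_conj (jet_h j) = jet_hb j" "fn_conj (jet_hb j) = jet_h j"
  by (simp_all add: jet_hb_def)

lemma fn_conj_inject: "fn_conj x = fn_conj y \<longleftrightarrow> x = y"
  by (metis fn_conj_fn_conj)

lemma square_root_rate:
  assumes D: "der D"
  shows "D (jet_h 2) = - cst 2 * jet_h 2 * w \<longleftrightarrow> D (h2pow 1) = - h2pow 1 * w"
    and "D (jet_hb 2) = - cst 2 * jet_hb 2 * w \<longleftrightarrow> D (fn_conj (h2pow 1)) = - fn_conj (h2pow 1) * w"
proof -
  have *: "D (jet_h 2) = - cst 2 * jet_h 2 * w \<longleftrightarrow> D (h2pow 1) = - h2pow 1 * w" if D: "der D" for D w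
  proof
    assume "D (jet_h 2) = - cst 2 * jet_h 2 * w"
    then have "D (h2pow 1) = cst (1 / 2) * h2pow (- 1) * (cst 2 * h2pow 1 * (- h2pow 1 * w))"
      unfolding der_h2pow_1[OF D] jet_h_2 by (simp add: algebra_simps)
    then show "D (h2pow 1) = - h2pow 1 * w" unfolding cst_h2pow_cancel(2)[of 2, simplified] .
  next
    assume "D (h2pow 1) = - h2pow 1 * w"
    then show "D (jet_h 2) = - cst 2 * jet_h 2 * w"
      unfolding der_jet_h_2[OF D] by (simp add: jet_h_2 algebra_simps)
  qed
  show "D (jet_h 2) = - cst 2 * jet_h 2 * w \<longleftrightarrow> D (h2pow 1) = - h2pow 1 * w" by (rule *[OF D])
  have "D (jet_hb 2) = - cst 2 * jet_hb 2 * w \<longleftrightarrow> conj_der D (jet_h 2) = - cst 2 * jet_h 2 * fn_conj w"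
    using fn_conj_inject[of "D (jet_hb 2)" "- cst 2 * jet_hb 2 * w"] by (simp add: conj_der_def fn_conj_jet_h)
  also have "\<dots> \<longleftrightarrow> conj_der D (h2pow 1) = - h2pow 1 * fn_conj w"
    by (rule *[OF der_conj_der[OF D]])
  also have "\<dots> \<longleftrightarrow> D (fn_conj (h2pow 1)) = - fn_conj (h2pow 1) * w"
    using fn_conj_inject[of "D (fn_conj (h2pow 1))" "- fn_conj (h2pow 1) * w"] by (simp add: conj_der_def)
  finally show "D (jet_hb 2) = - cst 2 * jet_hb 2 * w \<longleftrightarrow> D (fn_conj (h2pow 1)) = - fn_conj (h2pow 1) * w" .
qed

text \<open>
  The 1-form \<open>\<omega>\<close> with \<open>d\<xi> = \<omega> \<and> \<xi>\<close>, and its conjugate.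
\<close>

definition (in killing) omega :: form where
  "omega = smult (cst \<i>) rho + fsum (\<lambda>m. smult (a (2 * Suc m + 3)) (theta (DT m)))"

definition (in killing) omegab :: form where
  "omegab = smult (- cst \<i>) rho + fsum (\<lambda>m. smult (fn_conj (a (2 * Suc m + 3))) (theta (DTb m)))"

lemma smult_fsum: "(\<And>S. finite {m. F m S \<noteq> 0}) \<Longrightarrow> smult x (fsum F) = fsum (\<lambda>m. smult x (F m))"
  by (simp add: fun_eq_iff fsum_def Sum_any_right_distrib)

lemma finite_theta_family: "inj k \<Longrightarrow> finite {m. smult (f m) (theta (k m)) S \<noteq> 0}"
proof (rule finite_subset)
  show "{m. smult (f m) (theta (k m)) S \<noteq> 0} \<subseteq> {m. S = {k m}}" by (auto simp: theta_def)
  assume k: "inj k"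
  show "finite {m. S = {k m}}"
  proof (cases "\<exists>m. S = {k m}")
    case True
    then obtain m where "S = {k m}" by blast
    then have "{m. S = {k m}} = {m}" using k by (auto simp: inj_eq)
    then show ?thesis by simp
  qed simp
qed

lemma fsum_pull:
  "inj k \<Longrightarrow> fsum (\<lambda>m. smult (x * f m) (theta (k m))) = smult x (fsum (\<lambda>m. smult (f m) (theta (k m))))"
  unfolding smult_fsum[of "\<lambda>m. smult (f m) (theta (k m))", OF finite_theta_family] smult_smult ..

context killing
begin

lemma omega_Omega: "omega \<in> Omega 1" "omegab \<in> Omega 1"
  unfolding omega_def omegab_def by (intro Omega_add Omega_smult Omega_fsum Omega_theta)+

text \<open>
  Read through \<open>\<omega>\<close>, the equations (A) say that \<open>\<xi>\<close> and \<open>h\<^sub>2\<^sup>-\<^sup>1\<^sup>/\<^sup>2\<close> have the same logarithmic derivative outside \<open>\<xi>\<close>.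
\<close>

lemma system_A_structure:
  assumes "system_A \<gamma> a b c d" and d: "antider d"
  shows "d xi = omega \<and>\<^sub>f xi" "d xib = omegab \<and>\<^sub>f xib"
    "h \<noteq> Xi \<Longrightarrow> vf d h (h2pow 1) = - h2pow 1 * omega {h}"
    "h \<noteq> Xib \<Longrightarrow> vf d h (fn_conj (h2pow 1)) = - fn_conj (h2pow 1) * omegab {h}"
proof -
  interpret D: antider d by fact
  have A: "d xi - smult (cst \<i>) (rho \<and>\<^sub>f xi) =
       fsum (\<lambda>m. smult (a (2 * Suc m + 3)) (dt (Suc m) \<and>\<^sub>f xi))"
    "d xib + smult (cst \<i>) (rho \<and>\<^sub>f xib) =
       fsum (\<lambda>m. smult (fn_conj (a (2 * Suc m + 3))) (dtb (Suc m) \<and>\<^sub>f xib))"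
    "d (fn0 (jet_h 2)) + smult (cst (2 * \<i>) * jet_h 2) rho =
       smult (jet_h 3) xi
       - smult (cst 2) (fsum (\<lambda>m. smult (jet_h 2 * a (2 * Suc m + 3)) (dt (Suc m))))"
    "d (fn0 (jet_hb 2)) - smult (cst (2 * \<i>) * jet_hb 2) rho =
       smult (jet_hb 3) xib
       - smult (cst 2) (fsum (\<lambda>m. smult (jet_hb 2 * fn_conj (a (2 * Suc m + 3))) (dtb (Suc m))))"
    using assms(1) unfolding system_A_def by blast+
  have "d xi = smult (cst \<i>) (rho \<and>\<^sub>f xi) + fsum (\<lambda>m. smult (a (2 * Suc m + 3)) (dt (Suc m) \<and>\<^sub>f xi))"
    using A(1) by (simp add: diff_eq_eq add.commute)
  then show "d xi = omega \<and>\<^sub>f xi"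
    unfolding dt_Suc fsum_wedge[OF inj_DT(1)] omega_def .
  have "smult (- cst \<i>) x = - smult (cst \<i>) x" for x by (simp add: fun_eq_iff)
  then have "d xib = smult (- cst \<i>) (rho \<and>\<^sub>f xib) + fsum (\<lambda>m. smult (fn_conj (a (2 * Suc m + 3))) (dtb (Suc m) \<and>\<^sub>f xib))"
    using A(2) by (simp add: algebra_simps)
  then show "d xib = omegab \<and>\<^sub>f xib"
    unfolding dt_Suc fsum_wedge[OF inj_DT(2)] omegab_def .
  have c2: "cst (2 * \<i>) = cst 2 * cst \<i>" by (simp add: cst_mult)
  show "vf d h (h2pow 1) = - h2pow 1 * omega {h}" if "h \<noteq> Xi"
  proof -
    have xi0: "xi {h} = 0" using that by (simp add: theta_def)
    have "d (fn0 (jet_h 2)) {h} = - cst 2 * jet_h 2 * omega {h}"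
      using fun_cong[OF A(3), of "{h}"] xi0
      unfolding dt_Suc fsum_pull[OF inj_DT(1)] omega_def c2 by (simp add: algebra_simps eq_neg_iff_add_eq_0)
    then show ?thesis using square_root_rate(1)[OF D.der_vf] by (simp add: vf_def)
  qed
  show "vf d h (fn_conj (h2pow 1)) = - fn_conj (h2pow 1) * omegab {h}" if "h \<noteq> Xib"
  proof -
    have xi0: "xib {h} = 0" using that by (simp add: theta_def)
    have "d (fn0 (jet_hb 2)) {h} = - cst 2 * jet_hb 2 * omegab {h}"
      using fun_cong[OF A(4), of "{h}"] xi0
      unfolding dt_Suc fsum_pull[OF inj_DT(2)] omegab_def c2 by (simp add: algebra_simps eq_neg_iff_add_eq_0)
    then show ?thesis using square_root_rate(2)[OF D.der_vf] by (simp add: vf_def)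
  qed
qed

text \<open>
  The bracket of two frame fields, corrected by a multiple of the rotation field, annihilates \<open>Y\<close> and its
  conjugate by flatness and the time variables trivially, hence all functions. The multiple is the
  coefficient of \<open>d\<rho>\<close>, and the equation of degree 0 identifies it with the correction in the curvature.
\<close>

theorem hierarchy_square_zero:
  assumes "cmc_hierarchy \<gamma> a b c d" and \<alpha>: "\<alpha> \<in> Omega k"
  shows "d (d \<alpha>) = 0"
proof -
  have d: "antider d" and t: "\<And>m. d (fn0 (var_t m)) = dt m" "\<And>m. d (fn0 (var_tb m)) = dtb m"
    and ddt: "\<And>m. m \<ge> 1 \<Longrightarrow> d (dt m) = 0" "\<And>m. m \<ge> 1 \<Longrightarrow> d (dtb m) = 0"
    and A: "system_A \<gamma> a b c d" and C: "system_C a b c d"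
    using assms(1) by (simp_all add: cmc_hierarchy_def antider_def)
  interpret D: antider d by fact
  have flow: "flow Y (evf d g) (ephi Y g) (ephi_star Y g)" for g
    using C killing_equations_iff_flow[OF Y_nth d] by (simp add: system_C_def Let_def)
  note S = system_A_structure[OF A d]
  have closed: "d (beta g) = 0" if "g \<noteq> Rho" for g
  proof (cases g rule: coframe_cases)
    case rho
    with that show ?thesis by simp
  next
    case (t m)
    show ?thesis
    proof (cases m)
      case 0
      have "d (smult (eta Xi) xi) = 0"
      proof (rule D.closed_smult_theta[OF omega_Omega(1) S(1)])
        show "vf d h (eta Xi) = - eta Xi * omega {h}" if "h \<noteq> Xi" for h
          using S(3)[OF that] by (simp add: eta_def der_cst_mult[OF D.der_vf] mult.assoc)
      qed
      then show ?thesis using t 0 by (simp add: beta_def)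
    next
      case (Suc n)
      then show ?thesis using ddt(1)[of m] t by (simp add: dt_beta)
    qed
  next
    case (tb m)
    show ?thesis
    proof (cases m)
      case 0
      have "d (smult (eta Xib) xib) = 0"
      proof (rule D.closed_smult_theta[OF omega_Omega(2) S(2)])
        show "vf d h (eta Xib) = - eta Xib * omegab {h}" if "h \<noteq> Xib" for h
          using S(4)[OF that] by (simp add: eta_def der_cst_mult[OF D.der_vf] mult.assoc)
      qed
      then show ?thesis using tb 0 by (simp add: beta_def)
    next
      case (Suc n)
      then show ?thesis using ddt(2)[of m] tb by (simp add: dtb_beta)
    qed
  qed
  have evf_t: "evf d g (var_t m) = cst (if g = gT m then 1 else 0)" "evf d g (var_tb m) = cst (if g = gTb m then 1 else 0)" for g m
    by (auto simp: evf_def vf_def t dt_beta dtb_beta beta_apply)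
  have ddf: "d (d (fn0 f)) = 0" for f
  proof (rule D.dd_fn0[OF closed])
    fix g h assume gh: "pos g < pos h"
    define \<kappa> where "\<kappa> = ieta g * ieta h * d rho {g, h}"
    define K where "K = (\<lambda>x. evf d g (evf d h x) - evf d h (evf d g x) + \<kappa> * evf d Rho x)"
    have "(\<lambda>x. K x) = (\<lambda>x. 0)"
    proof -
      let ?X = "comm (pphi Y g) (mphi Y h) + comm (mphi Y g) (pphi Y h)"
      have "mcoef (mdiff d phi0 + (mwedge (phi_plus (Ymat a b c)) (phi_minus (Ymat a b c))
           + mwedge (phi_minus (Ymat a b c)) (phi_plus (Ymat a b c)))) {g, h} 0 = 0"
        using A by (simp add: system_A_def mcoef_def zero_m2_def)
      then have "(cmon 0 \<kappa> * Srho + proj {0} ?X) $$ 0 = 0"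
        unfolding degree_0_component[OF Y_nth d gh] \<kappa>_def[symmetric] scalar_eta_cancel_2 .
      then have "cmon 0 \<kappa> * Srho + proj {0} ?X = 0"
        by (simp add: fls_eq_iff Srho_nth)
      then have \<kappa>: "cmon 0 \<kappa> * Srho = - proj {0} ?X"
        by (simp add: eq_neg_iff_add_eq_0)
      have flat: "curvature (evf d g) (ephi Y g) (evf d h) (ephi Y h) (cmon 0 \<kappa> * Srho) = 0"
        unfolding \<kappa> by (rule flat_ephi[OF flow])
      have h: "flow Y (evf d Rho) Srho (- Srho)" using flow[of Rho] by simp
      note KY = flat_flows_commute[OF flow flow h flat, folded K_def]
      have derK: "der K"
        unfolding K_def by (intro der_plus der_commutator der_scale D.der_evf)
      have Kt: "K (var_t m) = 0" "K (var_tb m) = 0" for m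
        unfolding K_def evf_t by (simp_all only: der_cst[OF D.der_evf] evf_t) simp_all
      show ?thesis
      proof (rule der_eqI[OF derK der_zero])
        show "K f = 0" if "f \<in> alg jet_gens" for f by (rule kills_jets[OF derK KY(1) that])
        show "conj_der K f = conj_der (\<lambda>x. 0) f" if "f \<in> alg jet_gens" for f
          using kills_jets[OF der_conj_der[OF derK] KY(2) that] by (simp add: conj_der_def)
      qed (simp_all add: Kt)
    qed
    from fun_cong[OF this, of f] show "evf d g (evf d h f) - evf d h (evf d g f) +
        ieta g * ieta h * d rho {g, h} * evf d Rho f = 0"
      by (simp add: K_def \<kappa>_def)
  qed
  \<comment> \<open>The coefficient of \<open>\<rho>\<close> in \<open>dh\<^sub>2\<close> is the unit \<open>-2i h\<^sub>2\<close>.\<close>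
  have "cst (\<i> / 2) * h2pow (- 2) * vf d Rho (jet_h 2) = 1"
  proof -
    have "omega {Rho} = cst \<i>"
      by (simp add: omega_def fsum_theta_apply_0[of Rho DT] image_iff) (simp add: theta_def)
    then have "vf d Rho (jet_h 2) = - cst 2 * h2pow 2 * cst \<i>"
      using S(3)[of Rho] square_root_rate(1)[OF D.der_vf] by (simp add: jet_h_def)
    then have "cst (\<i> / 2) * h2pow (- 2) * vf d Rho (jet_h 2) =
        - (cst (\<i> / 2) * cst 2 * cst \<i>) * (h2pow (- 2) * h2pow 2)" by (simp add: ac_simps)
    then show ?thesis by (simp add: cst_minus flip: cst_mult h2pow_add)
  qed
  from D.dd_eq_0[OF closed ddf this \<alpha>] show ?thesis .
qed

end

section \<open>Antiderivations with prescribed structure equations\<close>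

subsection \<open>The exterior algebra\<close>

definition inversions :: "coframe set \<Rightarrow> coframe set \<Rightarrow> (coframe \<times> coframe) set" where
  "inversions T U = {(x, y). x \<in> T \<and> y \<in> U \<and> pos y < pos x}"

lemma wsign_inversions: "wsign T U = (- 1) ^ card (inversions T U)"
  by (simp add: wsign_def inversions_def)

lemma finite_inversions: "finite T \<Longrightarrow> finite U \<Longrightarrow> finite (inversions T U)"
  by (rule finite_subset[of _ "T \<times> U"]) (auto simp: inversions_def)

lemma wsign_union_left:
  assumes "finite T" "finite T'" "finite U" "T \<inter> T' = {}"
  shows "wsign (T \<union> T') U = wsign T U * wsign T' U"
proof -
  have "inversions (T \<union> T') U = inversions T U \<union> inversions T' U" "inversions T U \<inter> inversions T' U = {}"
    using assms by (auto simp: inversions_def)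
  then show ?thesis
    using assms by (simp add: wsign_inversions card_Un_disjoint finite_inversions power_add)
qed

lemma wsign_union_right:
  assumes "finite T" "finite U" "finite U'" "U \<inter> U' = {}"
  shows "wsign T (U \<union> U') = wsign T U * wsign T U'"
proof -
  have "inversions T (U \<union> U') = inversions T U \<union> inversions T U'" "inversions T U \<inter> inversions T U' = {}"
    using assms by (auto simp: inversions_def)
  then show ?thesis
    using assms by (simp add: wsign_inversions card_Un_disjoint finite_inversions power_add)
qed

lemma wsign_square: "wsign T U * wsign T U = 1"
  by (simp add: wsign_inversions flip: power_add mult_2) 

text \<open>
  Every pair of distinct coframe elements is an inversion in exactly one of the two orders.
\<close>

lemma wsign_swap:
  assumes "finite T" "finite U" "T \<inter> U = {}"
  shows "wsign T U * wsign U T = (- 1) ^ (card T * card U)"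
proof -
  have "T \<times> U = inversions T U \<union> prod.swap ` inversions U T"
  proof
    show "T \<times> U \<subseteq> inversions T U \<union> prod.swap ` inversions U T"
    proof
      fix p assume "p \<in> T \<times> U"
      then obtain x y where p: "p = (x, y)" "x \<in> T" "y \<in> U" by auto
      then have "x \<noteq> y" using assms(3) by auto
      then show "p \<in> inversions T U \<union> prod.swap ` inversions U T"
        using pos_linear[of x y] p by (auto simp: inversions_def image_iff)
    qed
  qed (auto simp: inversions_def)
  moreover have "inversions T U \<inter> prod.swap ` inversions U T = {}"
    by (auto simp: inversions_def)
  ultimately have "card T * card U = card (inversions T U) + card (prod.swap ` inversions U T)"
    using assms by (metis card_Un_disjoint card_cartesian_product finite_imageI finite_inversions)
  also have "card (prod.swap ` inversions U T) = card (inversions U T)"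
    by (rule card_image, rule inj_on_inverseI[of _ prod.swap]) simp
  finally show ?thesis by (simp add: wsign_inversions power_add)
qed

lemma wsign_commute:
  assumes "finite T" "finite U" "T \<inter> U = {}"
  shows "wsign T U = (- 1) ^ (card T * card U) * wsign U T"
proof -
  have "(- 1) ^ (card T * card U) * wsign U T = wsign T U * (wsign U T * wsign U T)"
    unfolding wsign_swap[OF assms, symmetric] by (simp only: mult.assoc)
  then show ?thesis by (simp add: wsign_square)
qed

lemma wedge_infinite: "infinite S \<Longrightarrow> (\<alpha> \<and>\<^sub>f \<beta>) S = 0"
  by (simp add: wedge_def)

lemma wedge_assoc: "(\<alpha> \<and>\<^sub>f \<beta>) \<and>\<^sub>f \<gamma> = \<alpha> \<and>\<^sub>f (\<beta> \<and>\<^sub>f \<gamma>)"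
proof
  fix S
  show "((\<alpha> \<and>\<^sub>f \<beta>) \<and>\<^sub>f \<gamma>) S = (\<alpha> \<and>\<^sub>f (\<beta> \<and>\<^sub>f \<gamma>)) S"
  proof (cases "finite S")
    case True
    have fin: "finite T" if "T \<subseteq> S" for T using that True by (rule finite_subset)
    have "((\<alpha> \<and>\<^sub>f \<beta>) \<and>\<^sub>f \<gamma>) S =
      (\<Sum>T\<in>Pow S. \<Sum>A\<in>Pow T. wsign T (S - T) * wsign A (T - A) * (\<alpha> A * \<beta> (T - A) * \<gamma> (S - T)))"
      by (simp add: wedge_def sum_distrib_left sum_distrib_right ac_simps)
    also have "\<dots> = (\<Sum>(T, A)\<in>Sigma (Pow S) Pow. wsign T (S - T) * wsign A (T - A) * (\<alpha> A * \<beta> (T - A) * \<gamma> (S - T)))"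
      using True fin by (intro sum.Sigma) auto
    also have "\<dots> = (\<Sum>(A, B)\<in>Sigma (Pow S) (\<lambda>A. Pow (S - A)).
        wsign A (S - A) * wsign B (S - A - B) * (\<alpha> A * \<beta> B * \<gamma> (S - A - B)))"
    proof (rule sum.reindex_bij_witness[of _ "\<lambda>(A, B). (A \<union> B, A)" "\<lambda>(T, A). (A, T - A)"])
      fix p assume "p \<in> Sigma (Pow S) Pow"
      then obtain T A where p: "p = (T, A)" "T \<subseteq> S" "A \<subseteq> T" by auto
      define B C where "B = T - A" and "C = S - T"
      have T: "T = A \<union> B" "S - A = B \<union> C" "S - A - B = C" using p by (auto simp: B_def C_def)
      have disj: "A \<inter> B = {}" "B \<inter> C = {}" by (auto simp: B_def C_def)
      have f: "finite A" "finite B" "finite C" using p fin by (auto simp: B_def C_def)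
      have BC: "B \<union> C - B = C" using disj by auto
      have key: "wsign T C * wsign A B = wsign A (B \<union> C) * wsign B C"
        unfolding T(1) wsign_union_left[OF f disj(1)] wsign_union_right[OF f disj(2)] by (simp add: ac_simps)
      show "(case case p of (T, A) \<Rightarrow> (A, T - A) of (A, B) \<Rightarrow>
          wsign A (S - A) * wsign B (S - A - B) * (\<alpha> A * \<beta> B * \<gamma> (S - A - B))) =
        (case p of (T, A) \<Rightarrow> wsign T (S - T) * wsign A (T - A) * (\<alpha> A * \<beta> (T - A) * \<gamma> (S - T)))"
        unfolding p prod.case B_def[symmetric] C_def[symmetric] T(2) BC key ..
    qed auto
    also have "\<dots> = (\<Sum>A\<in>Pow S. \<Sum>B\<in>Pow (S - A).
        wsign A (S - A) * wsign B (S - A - B) * (\<alpha> A * \<beta> B * \<gamma> (S - A - B)))"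
      using True by (intro sum.Sigma[symmetric]) auto
    also have "\<dots> = (\<alpha> \<and>\<^sub>f (\<beta> \<and>\<^sub>f \<gamma>)) S"
      by (simp add: wedge_def sum_distrib_left sum_distrib_right ac_simps)
    finally show ?thesis .
  qed (simp add: wedge_infinite)
qed

lemma wedge_commute:
  assumes "\<alpha> \<in> Omega j" "\<beta> \<in> Omega k"
  shows "\<beta> \<and>\<^sub>f \<alpha> = smult ((- 1) ^ (j * k)) (\<alpha> \<and>\<^sub>f \<beta>)"
proof
  fix S
  show "(\<beta> \<and>\<^sub>f \<alpha>) S = smult ((- 1) ^ (j * k)) (\<alpha> \<and>\<^sub>f \<beta>) S"
  proof (cases "finite S")
    case True
    have "(\<beta> \<and>\<^sub>f \<alpha>) S = (\<Sum>T\<in>Pow S. wsign (S - T) T * \<beta> (S - T) * \<alpha> T)"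
      unfolding wedge_def by (rule sum.reindex_bij_witness[of _ "\<lambda>T. S - T" "\<lambda>T. S - T"]) (auto simp: double_diff)
    also have "\<dots> = (\<Sum>T\<in>Pow S. (- 1) ^ (j * k) * (wsign T (S - T) * \<alpha> T * \<beta> (S - T)))"
    proof (rule sum.cong[OF refl])
      fix T assume T: "T \<in> Pow S"
      show "wsign (S - T) T * \<beta> (S - T) * \<alpha> T = (- 1) ^ (j * k) * (wsign T (S - T) * \<alpha> T * \<beta> (S - T))"
      proof (cases "\<alpha> T = 0 \<or> \<beta> (S - T) = 0")
        case False
        then have "card T = j" "card (S - T) = k" "finite T" "finite (S - T)"
          using OmegaD[OF assms(1), of T] OmegaD[OF assms(2), of "S - T"] by auto
        then have "wsign (S - T) T = (- 1) ^ (j * k) * wsign T (S - T)"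
          using wsign_commute[of "S - T" T] by (auto simp: mult.commute)
        then show ?thesis by (simp add: ac_simps)
      qed auto
    qed
    also have "\<dots> = smult ((- 1) ^ (j * k)) (\<alpha> \<and>\<^sub>f \<beta>) S"
      by (simp add: wedge_def sum_distrib_left)
    finally show ?thesis .
  qed (simp add: wedge_infinite)
qed

lemma wedge_add_right: "\<gamma> \<and>\<^sub>f (\<alpha> + \<beta>) = \<gamma> \<and>\<^sub>f \<alpha> + \<gamma> \<and>\<^sub>f \<beta>"
  by (simp add: wedge_def fun_eq_iff algebra_simps sum.distrib)

lemma wedge_smult_left: "smult f \<alpha> \<and>\<^sub>f \<beta> = smult f (\<alpha> \<and>\<^sub>f \<beta>)"
  and wedge_smult_right: "\<alpha> \<and>\<^sub>f smult f \<beta> = smult f (\<alpha> \<and>\<^sub>f \<beta>)"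
  by (simp_all add: wedge_def fun_eq_iff sum_distrib_left ac_simps)

lemma theta_wedge: "(theta g \<and>\<^sub>f \<alpha>) S = (if finite S \<and> g \<in> S then wsign {g} (S - {g}) * \<alpha> (S - {g}) else 0)"
proof (cases "finite S")
  case True
  have "(theta g \<and>\<^sub>f \<alpha>) S = (\<Sum>T\<in>Pow S. if T = {g} then wsign {g} (S - {g}) * \<alpha> (S - {g}) else 0)"
    unfolding wedge_def theta_def by (intro sum.cong) auto
  also have "\<dots> = (if {g} \<in> Pow S then wsign {g} (S - {g}) * \<alpha> (S - {g}) else 0)"
    using True by (subst sum.delta) auto
  finally show ?thesis using True by simp
qed (simp add: wedge_infinite)

subsection \<open>Covariant derivatives and contraction with the dual of \<open>\<rho>\<close>\<close>

text \<open>
  A vector field acts on a form through its coefficients and, by \<open>w\<close> and \<open>wb\<close>, on the coframe elements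
  \<open>\<xi>\<close> and \<open>\<xi>bar\<close>, which it multiplies by functions. The result is a degree 0 derivation of the
  exterior algebra because the number of factors \<open>\<xi>\<close>, \<open>\<xi>bar\<close> is additive.
\<close>

definition xi_weight :: "fn \<Rightarrow> fn \<Rightarrow> coframe set \<Rightarrow> fn" where
  "xi_weight w wb S = (if Xi \<in> S then w else 0) + (if Xib \<in> S then wb else 0)"

definition nabla :: "(fn \<Rightarrow> fn) \<Rightarrow> fn \<Rightarrow> fn \<Rightarrow> form \<Rightarrow> form" where
  "nabla D w wb \<alpha> = (\<lambda>S. D (\<alpha> S) + xi_weight w wb S * \<alpha> S)"

lemma der_sum: "der D \<Longrightarrow> D (sum f A) = (\<Sum>x\<in>A. D (f x))"
  by (rule derivation_sum[OF der_derivation])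

lemma der_wsign: "der D \<Longrightarrow> D (wsign T U * x) = wsign T U * D x"
  by (simp add: wsign_inversions minus_one_power_iff der_minus)

lemma nabla_wedge:
  assumes D: "der D"
  shows "nabla D w wb (\<alpha> \<and>\<^sub>f \<beta>) = nabla D w wb \<alpha> \<and>\<^sub>f \<beta> + \<alpha> \<and>\<^sub>f nabla D w wb \<beta>"
proof
  fix S
  show "nabla D w wb (\<alpha> \<and>\<^sub>f \<beta>) S = (nabla D w wb \<alpha> \<and>\<^sub>f \<beta> + \<alpha> \<and>\<^sub>f nabla D w wb \<beta>) S"
  proof -
    have x: "xi_weight w wb S = xi_weight w wb T + xi_weight w wb (S - T)" if "T \<in> Pow S" for T
      using that by (auto simp: xi_weight_def)
    have "nabla D w wb (\<alpha> \<and>\<^sub>f \<beta>) S = (\<Sum>T\<in>Pow S. wsign T (S - T) * D (\<alpha> T * \<beta> (S - T)) +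
        xi_weight w wb S * (wsign T (S - T) * \<alpha> T * \<beta> (S - T)))"
      by (simp add: nabla_def wedge_def der_sum[OF D] der_wsign[OF D] mult.assoc sum_distrib_left sum.distrib)
    also have "\<dots> = (\<Sum>T\<in>Pow S. wsign T (S - T) * nabla D w wb \<alpha> T * \<beta> (S - T) +
        wsign T (S - T) * \<alpha> T * nabla D w wb \<beta> (S - T))"
    proof (rule sum.cong[OF refl])
      fix T assume "T \<in> Pow S"
      show "wsign T (S - T) * D (\<alpha> T * \<beta> (S - T)) + xi_weight w wb S * (wsign T (S - T) * \<alpha> T * \<beta> (S - T)) =
        wsign T (S - T) * nabla D w wb \<alpha> T * \<beta> (S - T) + wsign T (S - T) * \<alpha> T * nabla D w wb \<beta> (S - T)"
        unfolding x[OF \<open>T \<in> Pow S\<close>] nabla_def der_mult[OF D] by (simp only: algebra_simps)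
    qed
    finally show ?thesis by (simp add: wedge_def sum.distrib)
  qed
qed

lemma nabla_Omega:
  assumes "der D" "\<alpha> \<in> Omega k" shows "nabla D w wb \<alpha> \<in> Omega k"
proof (rule OmegaI)
  fix S assume "nabla D w wb \<alpha> S \<noteq> 0"
  then have "\<alpha> S \<noteq> 0" using der_0[OF assms(1)] by (auto simp: nabla_def)
  then show "finite S \<and> card S = k" using OmegaD[OF assms(2)] by blast
qed

lemma nabla_add: "der D \<Longrightarrow> nabla D w wb (\<alpha> + \<beta>) = nabla D w wb \<alpha> + nabla D w wb \<beta>"
  by (simp add: nabla_def fun_eq_iff der_add algebra_simps)

text \<open>
  Contraction with the vector field dual to \<open>\<rho>\<close>.
\<close>

definition iota :: "form \<Rightarrow> form" where
  "iota \<alpha> = (\<lambda>S. if Rho \<in> S then 0 else wsign {Rho} S * \<alpha> (insert Rho S))"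

lemma iota_add: "iota (\<alpha> + \<beta>) = iota \<alpha> + iota \<beta>"
  by (simp add: iota_def fun_eq_iff algebra_simps)

text \<open>
  If \<open>\<rho>\<close> is absent from the index set \<open>S\<close>, it is restored to exactly one of the two factors, and the two possibilities
  give the two terms. If \<open>\<rho>\<close> lies in \<open>S\<close>, both terms contain \<open>\<rho>\<close> twice before the contraction and cancel.
\<close>

lemma iota_wedge:
  assumes \<alpha>: "\<alpha> \<in> Omega j"
  shows "iota (\<alpha> \<and>\<^sub>f \<beta>) = iota \<alpha> \<and>\<^sub>f \<beta> + smult ((- 1) ^ j) (\<alpha> \<and>\<^sub>f iota \<beta>)"
proof
  fix S
  show "iota (\<alpha> \<and>\<^sub>f \<beta>) S = (iota \<alpha> \<and>\<^sub>f \<beta> + smult ((- 1) ^ j) (\<alpha> \<and>\<^sub>f iota \<beta>)) S"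
  proof (cases "finite S \<and> Rho \<notin> S")
    case True
    then have fin: "finite S" and r: "Rho \<notin> S" by auto
    let ?r = "wsign {Rho}"
    have Pow: "Pow (insert Rho S) = Pow S \<union> insert Rho ` Pow S" by (rule Pow_insert)
    have disj: "Pow S \<inter> insert Rho ` Pow S = {}" using r by auto
    have inj: "inj_on (insert Rho) (Pow S)"
      by (rule inj_on_inverseI[of _ "\<lambda>T. T - {Rho}"]) (use r in auto)
    have "iota (\<alpha> \<and>\<^sub>f \<beta>) S = (\<Sum>T\<in>Pow S. ?r S * (wsign T (insert Rho S - T) * \<alpha> T * \<beta> (insert Rho S - T))) +
       (\<Sum>T\<in>Pow S. ?r S * (wsign (insert Rho T) (insert Rho S - insert Rho T) * \<alpha> (insert Rho T) * \<beta> (insert Rho S - insert Rho T)))"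
      unfolding iota_def wedge_def Pow using r fin disj inj
      by (simp add: sum.union_disjoint sum.reindex distrib_left sum_distrib_left)
    also have "(\<Sum>T\<in>Pow S. ?r S * (wsign (insert Rho T) (insert Rho S - insert Rho T) * \<alpha> (insert Rho T) * \<beta> (insert Rho S - insert Rho T)))
      = (iota \<alpha> \<and>\<^sub>f \<beta>) S"
      unfolding wedge_def
    proof (rule sum.cong[OF refl])
      fix T assume "T \<in> Pow S"
      then have T: "T \<subseteq> S" "Rho \<notin> T" "finite T" "finite (S - T)" and D: "insert Rho S - insert Rho T = S - T"
        using r fin finite_subset by auto
      have S: "?r S = ?r T * ?r (S - T)"
        using wsign_union_right[of "{Rho}" T "S - T"] T by (simp add: Un_absorb1)
      have I: "wsign (insert Rho T) (S - T) = ?r (S - T) * wsign T (S - T)"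
        using wsign_union_left[of "{Rho}" T "S - T"] T by simp
      have "?r S * wsign (insert Rho T) (S - T) = ?r T * wsign T (S - T) * (?r (S - T) * ?r (S - T))"
        unfolding S I by (simp only: ac_simps)
      then have "?r S * wsign (insert Rho T) (S - T) = ?r T * wsign T (S - T)" by (simp add: wsign_square)
      then show "?r S * (wsign (insert Rho T) (insert Rho S - insert Rho T) * \<alpha> (insert Rho T) * \<beta> (insert Rho S - insert Rho T)) =
        wsign T (S - T) * iota \<alpha> T * \<beta> (S - T)"
        unfolding D iota_def using T by (simp add: mult.assoc[symmetric])
    qed
    also have "(\<Sum>T\<in>Pow S. ?r S * (wsign T (insert Rho S - T) * \<alpha> T * \<beta> (insert Rho S - T))) =
       smult ((- 1) ^ j) (\<alpha> \<and>\<^sub>f iota \<beta>) S"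
      unfolding wedge_def smult_apply sum_distrib_left
    proof (rule sum.cong[OF refl])
      fix T assume "T \<in> Pow S"
      then have T: "T \<subseteq> S" "Rho \<notin> T" "Rho \<notin> S - T" "finite T" "finite (S - T)" and D: "insert Rho S - T = insert Rho (S - T)"
        using r fin finite_subset by auto
      show "?r S * (wsign T (insert Rho S - T) * \<alpha> T * \<beta> (insert Rho S - T)) =
        (- 1) ^ j * (wsign T (S - T) * \<alpha> T * iota \<beta> (S - T))"
      proof (cases "\<alpha> T = 0")
        case False
        then have j: "card T = j" using OmegaD[OF \<alpha>] by blast
        have S: "?r S = ?r T * ?r (S - T)"
          using wsign_union_right[of "{Rho}" T "S - T"] T by (simp add: Un_absorb1)
        have I: "wsign T (insert Rho (S - T)) = wsign T {Rho} * wsign T (S - T)"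
          using wsign_union_right[of T "{Rho}" "S - T"] T by simp
        have "?r T * wsign T {Rho} = (- 1) ^ j"
          using wsign_swap[of "{Rho}" T] T j by simp
        then have "?r S * wsign T (insert Rho (S - T)) = (- 1) ^ j * (wsign T (S - T) * ?r (S - T))"
          unfolding S I by (simp add: ac_simps) (simp flip: mult.assoc)
        then show ?thesis
          unfolding D iota_def using T by (simp add: mult.assoc[symmetric])
      qed simp
    qed
    finally show ?thesis by (simp add: add.commute)
  next
    case False
    then consider "infinite S" | "Rho \<in> S" by auto
    then show ?thesis
    proof cases
      case 1
      then show ?thesis by (simp add: iota_def wedge_infinite)
    next
      case 2
      show ?thesis
      proof (cases "finite S")
        case True
        define R where "R = S - {Rho}"
        have S: "S = insert Rho R" and r: "Rho \<notin> R" and fin: "finite R"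
          using 2 True by (auto simp: R_def)
        have Pow: "Pow S = Pow R \<union> insert Rho ` Pow R" unfolding S by (rule Pow_insert)
        have disj: "Pow R \<inter> insert Rho ` Pow R = {}" using r by auto
        have inj: "inj_on (insert Rho) (Pow R)"
          by (rule inj_on_inverseI[of _ "\<lambda>T. T - {Rho}"]) (use r in auto)
        have D: "S - insert Rho T = R - T" "S - T = insert Rho (R - T)" "Rho \<notin> T" "Rho \<notin> R - T"
          "finite T" "finite (R - T)" if "T \<in> Pow R" for T
          using that r S fin finite_subset by auto
        have first: "(iota \<alpha> \<and>\<^sub>f \<beta>) S = (\<Sum>T\<in>Pow R. wsign T (S - T) * iota \<alpha> T * \<beta> (S - T))"
        proof -
          have "(iota \<alpha> \<and>\<^sub>f \<beta>) S = (\<Sum>T\<in>Pow R. wsign T (S - T) * iota \<alpha> T * \<beta> (S - T)) +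
             (\<Sum>T\<in>insert Rho ` Pow R. wsign T (S - T) * iota \<alpha> T * \<beta> (S - T))"
            unfolding wedge_def Pow using fin disj by (simp add: sum.union_disjoint)
          also have "(\<Sum>T\<in>insert Rho ` Pow R. wsign T (S - T) * iota \<alpha> T * \<beta> (S - T)) = 0"
            by (rule sum.neutral) (auto simp: iota_def)
          finally show ?thesis by simp
        qed
        have second: "(\<alpha> \<and>\<^sub>f iota \<beta>) S = (\<Sum>T\<in>Pow R. wsign (insert Rho T) (R - T) * \<alpha> (insert Rho T) * iota \<beta> (R - T))"
        proof -
          have "(\<alpha> \<and>\<^sub>f iota \<beta>) S = (\<Sum>T\<in>Pow R. wsign T (S - T) * \<alpha> T * iota \<beta> (S - T)) +
             (\<Sum>T\<in>insert Rho ` Pow R. wsign T (S - T) * \<alpha> T * iota \<beta> (S - T))"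
            unfolding wedge_def Pow using fin disj by (simp add: sum.union_disjoint)
          also have "(\<Sum>T\<in>Pow R. wsign T (S - T) * \<alpha> T * iota \<beta> (S - T)) = 0"
            by (rule sum.neutral) (auto simp: iota_def D)
          finally show ?thesis using inj by (simp add: sum.reindex D)
        qed
        have "iota (\<alpha> \<and>\<^sub>f \<beta>) S = 0" using \<open>Rho \<in> S\<close> by (simp add: iota_def)
        moreover have "(iota \<alpha> \<and>\<^sub>f \<beta>) S + (- 1) ^ j * (\<alpha> \<and>\<^sub>f iota \<beta>) S = 0"
          unfolding first second sum_distrib_left sum.distrib[symmetric]
        proof (rule sum.neutral, rule ballI)
          fix T assume T: "T \<in> Pow R"
          note D = D[OF T]
          show "wsign T (S - T) * iota \<alpha> T * \<beta> (S - T) +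
            (- 1) ^ j * (wsign (insert Rho T) (R - T) * \<alpha> (insert Rho T) * iota \<beta> (R - T)) = 0"
          proof (cases "\<alpha> (insert Rho T) = 0")
            case False
            then have "card (insert Rho T) = j" using OmegaD[OF \<alpha>] by blast
            then have j: "j = Suc (card T)" using D by simp
            let ?r = "wsign {Rho}"
            have "wsign T (S - T) * ?r T = wsign T (R - T) * (?r T * wsign T {Rho})"
              using wsign_union_right[of T "{Rho}" "R - T"] D by (simp add: ac_simps)
            also have "?r T * wsign T {Rho} = (- 1) ^ card T"
              using wsign_swap[of "{Rho}" T] D by simp
            finally have A: "wsign T (S - T) * ?r T = wsign T (R - T) * (- 1) ^ card T" .
            have "wsign (insert Rho T) (R - T) * ?r (R - T) = wsign T (R - T) * (?r (R - T) * ?r (R - T))"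
              using wsign_union_left[of "{Rho}" T "R - T"] D by (simp add: ac_simps)
            then have B: "wsign (insert Rho T) (R - T) * ?r (R - T) = wsign T (R - T)" by (simp add: wsign_square)
            have "wsign T (S - T) * iota \<alpha> T * \<beta> (S - T) +
                (- 1) ^ j * (wsign (insert Rho T) (R - T) * \<alpha> (insert Rho T) * iota \<beta> (R - T)) =
              (wsign T (S - T) * ?r T) * (\<alpha> (insert Rho T) * \<beta> (S - T)) +
                (- 1) ^ j * ((wsign (insert Rho T) (R - T) * ?r (R - T)) * (\<alpha> (insert Rho T) * \<beta> (S - T)))"
              using D by (simp add: iota_def ac_simps)
            also have "\<dots> = 0" unfolding A B j by (simp add: ac_simps)
            finally show ?thesis .
          qed (use D in \<open>simp add: iota_def\<close>)
        qed
        ultimately show ?thesis by simp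
      qed (simp add: iota_def wedge_infinite)
    qed
  qed
qed

lemma iota_fn0 [simp]: "iota (fn0 f) = 0"
  by (auto simp: iota_def fn0_def fun_eq_iff)

lemma iota_Omega: "\<alpha> \<in> Omega (Suc k) \<Longrightarrow> iota \<alpha> \<in> Omega k"
proof (rule OmegaI)
  fix S assume \<alpha>: "\<alpha> \<in> Omega (Suc k)" and "iota \<alpha> S \<noteq> 0"
  then have "Rho \<notin> S" "\<alpha> (insert Rho S) \<noteq> 0" by (auto simp: iota_def split: if_splits)
  then show "finite S \<and> card S = k" using OmegaD[OF \<alpha>, of "insert Rho S"] by (auto simp: card_insert_if)
qed

lemma iota_Omega_0: "\<alpha> \<in> Omega 0 \<Longrightarrow> iota \<alpha> = 0"
proof
  fix S assume \<alpha>: "\<alpha> \<in> Omega 0"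
  have "\<alpha> (insert Rho S) = 0"
    by (rule ccontr) (use OmegaD[OF \<alpha>, of "insert Rho S"] in auto)
  then show "iota \<alpha> S = 0 S" by (simp add: iota_def)
qed

subsection \<open>The exterior derivative of a frame\<close>

text \<open>
  The data of an exterior derivative: the vector fields \<open>E g\<close>, the rates \<open>w\<close>, \<open>wb\<close> with
  \<open>d\<xi> = (\<Sum>\<^sub>g w g \<theta>\<^sup>g) \<and> \<xi>\<close> and its conjugate, and \<open>\<tau> = d\<rho>\<close>; the remaining coframe elements are closed.
\<close>

locale frame =
  fixes E :: "coframe \<Rightarrow> fn \<Rightarrow> fn" and w wb :: "coframe \<Rightarrow> fn" and \<tau> :: form
  assumes der_E: "\<And>g. der (E g)" and \<tau>: "\<tau> \<in> Omega 2"
begin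

abbreviation "cov g \<equiv> nabla (E g) (w g) (wb g)"

text \<open>
  \<open>d = \<Sum>\<^sub>g \<theta>\<^sup>g \<and> \<nabla>\<^sub>g + \<tau> \<and> \<iota>\<close>. The sum is infinite, but only the \<open>g \<in> S\<close> contribute to the coefficient on \<open>S\<close>.
\<close>

definition ext :: "form \<Rightarrow> form" where
  "ext \<alpha> = (\<lambda>S. (\<Sum>g\<in>S. (theta g \<and>\<^sub>f cov g \<alpha>) S) + (\<tau> \<and>\<^sub>f iota \<alpha>) S)"

lemma ext_superset:
  assumes "finite G" "S \<subseteq> G"
  shows "ext \<alpha> S = (\<Sum>g\<in>G. (theta g \<and>\<^sub>f cov g \<alpha>) S) + (\<tau> \<and>\<^sub>f iota \<alpha>) S"
proof -
  have "(\<Sum>g\<in>S. (theta g \<and>\<^sub>f cov g \<alpha>) S) = (\<Sum>g\<in>G. (theta g \<and>\<^sub>f cov g \<alpha>) S)"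
    using assms by (intro sum.mono_neutral_left) (auto simp: theta_wedge)
  then show ?thesis by (simp add: ext_def)
qed

lemma ext_infinite: "infinite S \<Longrightarrow> ext \<alpha> S = 0"
  by (simp add: ext_def wedge_infinite)

lemma ext_Omega:
  assumes "\<alpha> \<in> Omega k" shows "ext \<alpha> \<in> Omega (Suc k)"
proof (rule OmegaI)
  fix S assume nz: "ext \<alpha> S \<noteq> 0"
  have 1: "theta g \<and>\<^sub>f cov g \<alpha> \<in> Omega (Suc k)" for g
    using Omega_wedge[OF Omega_theta(1) nabla_Omega[OF der_E assms]] by simp
  have 2: "\<tau> \<and>\<^sub>f iota \<alpha> \<in> Omega (Suc k)"
  proof (cases k)
    case 0
    then show ?thesis using iota_Omega_0 assms by simp
  next
    case (Suc l)
    then show ?thesis using Omega_wedge[OF \<tau> iota_Omega, of \<alpha> l] assms by (simp add: eval_nat_numeral)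
  qed
  have "(\<tau> \<and>\<^sub>f iota \<alpha>) S \<noteq> 0 \<or> (\<exists>g\<in>S. (theta g \<and>\<^sub>f cov g \<alpha>) S \<noteq> 0)"
  proof (rule ccontr)
    assume "\<not> ?thesis"
    then have "(\<tau> \<and>\<^sub>f iota \<alpha>) S = 0" "(\<Sum>g\<in>S. (theta g \<and>\<^sub>f cov g \<alpha>) S) = 0" by (auto intro: sum.neutral)
    with nz show False by (simp add: ext_def)
  qed
  then show "finite S \<and> card S = Suc k" using OmegaD[OF 1] OmegaD[OF 2] by blast
qed

lemma ext_add: "ext (\<alpha> + \<beta>) = ext \<alpha> + ext \<beta>"
  by (simp add: ext_def fun_eq_iff nabla_add[OF der_E] iota_add wedge_add_right sum.distrib)

lemma nabla_cst: "nabla (E g) x y (fn0 (cst z)) = 0"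
proof
  fix S
  show "nabla (E g) x y (fn0 (cst z)) S = 0 S"
    using der_cst[OF der_E] der_0[OF der_E] by (simp add: nabla_def fn0_apply xi_weight_def)
qed

lemma ext_cst: "ext (fn0 (cst z)) = 0"
  by (simp add: ext_def fun_eq_iff nabla_cst)

lemma theta_wedge_Leibniz:
  assumes "\<alpha> \<in> Omega j" "\<beta> \<in> Omega k"
  shows "theta g \<and>\<^sub>f cov g (\<alpha> \<and>\<^sub>f \<beta>) =
    (theta g \<and>\<^sub>f cov g \<alpha>) \<and>\<^sub>f \<beta> + smult ((- 1) ^ j) (\<alpha> \<and>\<^sub>f (theta g \<and>\<^sub>f cov g \<beta>))"
proof -
  have "theta g \<and>\<^sub>f (\<alpha> \<and>\<^sub>f cov g \<beta>) = smult ((- 1) ^ j) (\<alpha> \<and>\<^sub>f (theta g \<and>\<^sub>f cov g \<beta>))"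
    using wedge_commute[OF assms(1) Omega_theta(1)[of g]]
    by (simp add: wedge_smult_left flip: wedge_assoc)
  then show ?thesis by (simp add: nabla_wedge[OF der_E] wedge_add_right wedge_assoc)
qed

lemma tau_wedge_Leibniz:
  assumes "\<alpha> \<in> Omega j"
  shows "\<tau> \<and>\<^sub>f iota (\<alpha> \<and>\<^sub>f \<beta>) = (\<tau> \<and>\<^sub>f iota \<alpha>) \<and>\<^sub>f \<beta> + smult ((- 1) ^ j) (\<alpha> \<and>\<^sub>f (\<tau> \<and>\<^sub>f iota \<beta>))"
proof -
  have one: "smult 1 x = x" for x by (simp add: fun_eq_iff)
  have "\<tau> \<and>\<^sub>f \<alpha> = \<alpha> \<and>\<^sub>f \<tau>"
    using wedge_commute[OF assms \<tau>] by (simp add: one)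
  then have "\<tau> \<and>\<^sub>f (\<alpha> \<and>\<^sub>f iota \<beta>) = \<alpha> \<and>\<^sub>f (\<tau> \<and>\<^sub>f iota \<beta>)" by (simp flip: wedge_assoc)
  then show ?thesis
    unfolding iota_wedge[OF assms] by (simp add: wedge_add_right wedge_smult_right wedge_assoc)
qed

text \<open>
  Each summand of \<open>ext\<close> is an odd operator of the form \<open>\<theta>\<^sup>g \<and> derivation\<close> or (even form) \<open>\<and> antiderivation\<close>. All
  index sets occurring below \<open>S\<close> are contained in \<open>S\<close>, so the infinite sum may be restricted to
  \<open>g \<in> S\<close> throughout.
\<close>

lemma ext_wedge:
  assumes \<alpha>: "\<alpha> \<in> Omega j" and \<beta>: "\<beta> \<in> Omega k"
  shows "ext (\<alpha> \<and>\<^sub>f \<beta>) = ext \<alpha> \<and>\<^sub>f \<beta> + smult ((- 1) ^ j) (\<alpha> \<and>\<^sub>f ext \<beta>)"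
proof
  fix S
  show "ext (\<alpha> \<and>\<^sub>f \<beta>) S = (ext \<alpha> \<and>\<^sub>f \<beta> + smult ((- 1) ^ j) (\<alpha> \<and>\<^sub>f ext \<beta>)) S"
  proof (cases "finite S")
    case True
    have fin: "finite T" if "T \<subseteq> S" for T using that True by (rule finite_subset)
    have L: "(ext \<alpha> \<and>\<^sub>f \<beta>) S = (\<Sum>g\<in>S. ((theta g \<and>\<^sub>f cov g \<alpha>) \<and>\<^sub>f \<beta>) S) + ((\<tau> \<and>\<^sub>f iota \<alpha>) \<and>\<^sub>f \<beta>) S"
    proof -
      have "(ext \<alpha> \<and>\<^sub>f \<beta>) S = (\<Sum>T\<in>Pow S. wsign T (S - T) *
          ((\<Sum>g\<in>S. (theta g \<and>\<^sub>f cov g \<alpha>) T) + (\<tau> \<and>\<^sub>f iota \<alpha>) T) * \<beta> (S - T))"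
        unfolding wedge_def[of "ext \<alpha>"] by (intro sum.cong refl, subst ext_superset[OF True]) auto
      also have "\<dots> = (\<Sum>T\<in>Pow S. \<Sum>g\<in>S. wsign T (S - T) * (theta g \<and>\<^sub>f cov g \<alpha>) T * \<beta> (S - T)) + ((\<tau> \<and>\<^sub>f iota \<alpha>) \<and>\<^sub>f \<beta>) S"
        unfolding wedge_def[of "\<tau> \<and>\<^sub>f iota \<alpha>"]
        by (simp add: distrib_left distrib_right sum.distrib sum_distrib_left sum_distrib_right)
      also have "(\<Sum>T\<in>Pow S. \<Sum>g\<in>S. wsign T (S - T) * (theta g \<and>\<^sub>f cov g \<alpha>) T * \<beta> (S - T)) =
          (\<Sum>g\<in>S. ((theta g \<and>\<^sub>f cov g \<alpha>) \<and>\<^sub>f \<beta>) S)"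
        unfolding wedge_def[of "theta _ \<and>\<^sub>f cov _ \<alpha>"] by (rule sum.swap)
      finally show ?thesis .
    qed
    have R: "(\<alpha> \<and>\<^sub>f ext \<beta>) S = (\<Sum>g\<in>S. (\<alpha> \<and>\<^sub>f (theta g \<and>\<^sub>f cov g \<beta>)) S) + (\<alpha> \<and>\<^sub>f (\<tau> \<and>\<^sub>f iota \<beta>)) S"
    proof -
      have "(\<alpha> \<and>\<^sub>f ext \<beta>) S = (\<Sum>T\<in>Pow S. wsign T (S - T) * \<alpha> T *
          ((\<Sum>g\<in>S. (theta g \<and>\<^sub>f cov g \<beta>) (S - T)) + (\<tau> \<and>\<^sub>f iota \<beta>) (S - T)))"
        unfolding wedge_def[of \<alpha> "ext \<beta>"] by (intro sum.cong refl, subst ext_superset[OF True]) auto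
      also have "\<dots> = (\<Sum>T\<in>Pow S. \<Sum>g\<in>S. wsign T (S - T) * \<alpha> T * (theta g \<and>\<^sub>f cov g \<beta>) (S - T)) + (\<alpha> \<and>\<^sub>f (\<tau> \<and>\<^sub>f iota \<beta>)) S"
        unfolding wedge_def[of \<alpha> "\<tau> \<and>\<^sub>f iota \<beta>"]
        by (simp add: distrib_left distrib_right sum.distrib sum_distrib_left sum_distrib_right)
      also have "(\<Sum>T\<in>Pow S. \<Sum>g\<in>S. wsign T (S - T) * \<alpha> T * (theta g \<and>\<^sub>f cov g \<beta>) (S - T)) =
          (\<Sum>g\<in>S. (\<alpha> \<and>\<^sub>f (theta g \<and>\<^sub>f cov g \<beta>)) S)"
        unfolding wedge_def[of \<alpha> "theta _ \<and>\<^sub>f cov _ \<beta>"] by (rule sum.swap)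
      finally show ?thesis .
    qed
    have "ext (\<alpha> \<and>\<^sub>f \<beta>) S = (\<Sum>g\<in>S. ((theta g \<and>\<^sub>f cov g \<alpha>) \<and>\<^sub>f \<beta>) S + (- 1) ^ j * (\<alpha> \<and>\<^sub>f (theta g \<and>\<^sub>f cov g \<beta>)) S)
        + (((\<tau> \<and>\<^sub>f iota \<alpha>) \<and>\<^sub>f \<beta>) S + (- 1) ^ j * (\<alpha> \<and>\<^sub>f (\<tau> \<and>\<^sub>f iota \<beta>)) S)"
      by (simp add: ext_def theta_wedge_Leibniz[OF \<alpha> \<beta>] tau_wedge_Leibniz[OF \<alpha>])
    then show ?thesis
      by (simp add: L R sum.distrib sum_distrib_left distrib_left)
  qed (simp add: ext_infinite wedge_infinite)
qed

lemma ext_continuous: "\<exists>F. finite F \<and> (\<forall>\<alpha>\<in>Omega k. (\<forall>T\<in>F. \<alpha> T = 0) \<longrightarrow> ext \<alpha> S = 0)"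
proof (cases "finite S")
  case True
  let ?F = "(\<lambda>g. S - {g}) ` S \<union> insert Rho ` Pow S"
  have "ext \<alpha> S = 0" if \<alpha>: "\<And>T. T \<in> ?F \<Longrightarrow> \<alpha> T = 0" for \<alpha>
  proof -
    have "(theta g \<and>\<^sub>f cov g \<alpha>) S = 0" if "g \<in> S" for g
      using \<alpha>[of "S - {g}"] that der_0[OF der_E] by (simp add: theta_wedge nabla_def)
    moreover have "iota \<alpha> T = 0" if "T \<in> Pow S" for T
      using \<alpha>[of "insert Rho T"] that by (simp add: iota_def)
    ultimately show ?thesis
      by (simp add: ext_def wedge_def[of \<tau>])
  qed
  then show ?thesis using True by (intro exI[of _ ?F]) simp
next
  case False
  then show ?thesis by (intro exI[of _ "{}"]) (simp add: ext_infinite)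
qed

lemma antiderivation_ext: "antiderivation ext"
  unfolding antiderivation_def
  by (intro conjI allI ballI; (rule ext_add | erule ext_Omega | rule ext_cst | erule (1) ext_wedge | rule ext_continuous))

sublocale ext: antider ext
  by (simp add: antider_def antiderivation_ext)

lemma vf_ext: "vf ext g f = E g f"
  by (simp add: vf_def ext_def theta_wedge nabla_def fn0_apply xi_weight_def)

lemma ext_rho: "ext rho = \<tau>"
proof -
  have r: "iota rho = fn0 1"
    by (auto simp: iota_def fn0_def theta_def fun_eq_iff)
  have "cov g rho = 0" for g
    using der_1[OF der_E] der_0[OF der_E] by (auto simp: nabla_def theta_def xi_weight_def fun_eq_iff)
  then have "theta g \<and>\<^sub>f cov g rho = 0" for g by simp
  then have "ext rho S = (\<tau> \<and>\<^sub>f fn0 1) S" for S by (simp add: ext_def r)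
  then have "ext rho = \<tau> \<and>\<^sub>f fn0 1" by blast
  also have "\<dots> = \<tau>" by (simp add: wedge_fn0[OF \<tau>] fun_eq_iff)
  finally show ?thesis .
qed

lemma ext_theta:
  assumes "e \<noteq> Rho" and \<omega>: "\<omega> \<in> Omega 1" "\<And>g. \<omega> {g} = xi_weight (w g) (wb g) {e}"
  shows "ext (theta e) = \<omega> \<and>\<^sub>f theta e"
proof (rule Omega_2_eqI)
  show "ext (theta e) \<in> Omega 2" using ext_Omega[OF Omega_theta(1)] by (simp add: eval_nat_numeral)
  show "\<omega> \<and>\<^sub>f theta e \<in> Omega 2" using Omega_wedge[OF \<omega>(1) Omega_theta(1)] by (simp add: eval_nat_numeral)
  fix g h assume gh: "pos g < pos h"
  then have ne: "g \<noteq> h" by auto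
  have i: "iota (theta e) = 0"
    using assms(1) by (auto simp: iota_def theta_def fun_eq_iff)
  have c: "cov x (theta e) S = (if S = {e} then \<omega> {x} else 0)" for x S
    using der_1[OF der_E] der_0[OF der_E] by (simp add: nabla_def theta_def \<omega>(2))
  have D: "{g, h} - {g} = {h}" "{g, h} - {h} = {g}" using ne by auto
  have "ext (theta e) {g, h} = wsign {g} {h} * cov g (theta e) {h} + wsign {h} {g} * cov h (theta e) {g}"
    using ne by (simp add: ext_def i theta_wedge D)
  also have "\<dots> = \<omega> {g} * theta e {h} - \<omega> {h} * theta e {g}"
    unfolding c unfolding wsign_pair theta_def using gh by auto
  also have "\<dots> = (\<omega> \<and>\<^sub>f theta e) {g, h}" by (rule wedge_pair[OF \<omega>(1) Omega_theta(1) gh, symmetric])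
  finally show "ext (theta e) {g, h} = (\<omega> \<and>\<^sub>f theta e) {g, h}" .
qed

end

section \<open>Flows of the Killing field on the jet functions\<close>

context killing
begin

abbreviation Ulead :: "fn m2" where
  "Ulead \<equiv> M2 0 (h2pow 1) (cst (- of_real \<gamma>) * h2pow (- 1)) 0"

lemma Y_1_Ulead: "Y $$ 1 = scalar (cst (2 * \<i>)) * Ulead"
proof -
  have "cst (2 * \<i>) * (cst (- of_real \<gamma>) * x) = cst (- 2 * \<i> * of_real \<gamma>) * x" for x
    by (simp flip: mult.assoc cst_mult)
  then show ?thesis unfolding Y_1 by (intro m2_eqI) simp_all
qed

lemma Ulead_square: "Ulead * Ulead = scalar (cst (- of_real \<gamma>))"
proof -
  have "h2pow 1 * (x * h2pow (- 1)) = x" "x * h2pow (- 1) * h2pow 1 = x" for x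
    using h2pow_inverse by (simp_all add: mult.commute mult.left_commute mult.assoc flip: h2pow_add)
  then show ?thesis by (intro m2_eqI) simp_all
qed

text \<open>
  Let \<open>Z\<close> be the lowest coefficient of \<open>X\<close>. The first equation in the degree below says that \<open>Z\<close> commutes with the
  leading matrix of \<open>U\<^sub>0\<close>, the second one that it anticommutes with the leading matrix of \<open>Y\<close>, which is
  proportional to it. As that matrix has an invertible scalar square, \<open>Z = 0\<close>.
\<close>

lemma series_unique:
  assumes X: "supported {1..} X" and e: "lact e\<^sub>0 X = - comm (Upol Y 0) X" and anti: "X * Y + Y * X = 0"
  shows "X = 0"
proof -
  have "\<forall>k \<le> int n. X $$ k = 0" for n
  proof (induction n)
    case 0
    then show ?case using X by (auto simp: supported_def)
  next
    case (Suc n)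
    \<comment> \<open>\<open>N\<close> is the last degree in which \<open>X\<close> is known to vanish, \<open>Z\<close> the next coefficient.\<close>
    define N where "N = int n"
    define Z where "Z = X $$ (N + 1)"
    have low: "X $$ k = 0" if "k \<le> N" for k using Suc that by (simp add: N_def)
    have "lact e\<^sub>0 X $$ N = 0" by (simp add: der_evf low map_m2_0 der_0)
    then have "comm Ulead Z = 0" by (simp add: e comm_Upol_0 Z_def)
    then have MZ: "Z * Ulead = Ulead * Z" by (simp add: comm_def)
    have "(X * Y) $$ (N + 2) = (\<Sum>k\<in>{N + 1}. X $$ k * Y $$ (N + 2 - k))"
    proof (rule fls_mult_nth_sum)
      fix k assume "k \<notin> {N + 1}"
      then consider "k \<le> N" | "N + 2 - k \<le> 0" by fastforce
      then show "X $$ k * Y $$ (N + 2 - k) = 0" using low Y_neg by cases simp_all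
    qed simp
    moreover have "(Y * X) $$ (N + 2) = (\<Sum>k\<in>{1}. Y $$ k * X $$ (N + 2 - k))"
    proof (rule fls_mult_nth_sum)
      fix k :: int assume "k \<notin> {1}"
      then consider "k \<le> 0" | "N + 2 - k \<le> N" by fastforce
      then show "Y $$ k * X $$ (N + 2 - k) = 0" using low Y_neg by cases simp_all
    qed simp
    moreover have "(X * Y + Y * X) $$ (N + 2) = 0" by (simp add: anti)
    moreover have "N + 2 - (N + 1) = 1" "N + 2 - 1 = N + 1" by simp_all
    ultimately have "Z * Y $$ 1 + Y $$ 1 * Z = 0" by (simp add: Z_def)
    then have "scalar (cst (2 * \<i>)) * (Ulead * Z + Ulead * Z) = 0"
      unfolding Y_1_Ulead scalar_left_commute MZ mult.assoc by (simp add: distrib_left)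
    then have "Ulead * (scalar (cst (2 * \<i>)) * (Ulead * Z + Ulead * Z)) = 0" by simp
    then have "scalar (cst (2 * \<i>)) * (Ulead * Ulead * Z + Ulead * Ulead * Z) = 0"
      unfolding scalar_left_commute by (simp only: distrib_left mult.assoc)
    then have "scalar (cst (2 * \<i>)) * (scalar (cst (- of_real \<gamma>)) * Z + scalar (cst (- of_real \<gamma>)) * Z) = 0"
      unfolding Ulead_square .
    also have "scalar (cst (- of_real \<gamma>)) * Z + scalar (cst (- of_real \<gamma>)) * Z = scalar (cst (2 * - of_real \<gamma>)) * Z"
      unfolding cst_mult cst_2 by (intro m2_eqI) (simp_all add: algebra_simps)
    also have "scalar (cst (2 * \<i>)) * (scalar (cst (2 * - of_real \<gamma>)) * Z) =
        scalar (cst (2 * \<i> * (2 * - of_real \<gamma>))) * Z"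
      by (simp only: cst_mult scalar_mult mult.assoc)
    finally have "scalar (cst (2 * \<i> * (2 * - of_real \<gamma>))) * Z = 0" .
    define q where "q = 2 * \<i> * (2 * - complex_of_real \<gamma>)"
    then have q: "q \<noteq> 0" using \<gamma>_nz by simp
    have "scalar (cst (1 / q)) * (scalar (cst q) * Z) = 0"
      using \<open>scalar (cst (2 * \<i> * (2 * - of_real \<gamma>))) * Z = 0\<close> by (simp add: q_def)
    also have "scalar (cst (1 / q)) * (scalar (cst q) * Z) = scalar (cst (1 / q) * cst q) * Z"
      by (simp only: scalar_mult mult.assoc)
    finally have "Z = 0" by (simp add: cst_inverse[OF q] flip: one_m2_def)
    show ?case
    proof (intro allI impI)
      fix k assume "k \<le> int (Suc n)"
      then consider "k \<le> N" | "k = N + 1" unfolding N_def by linarith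
      then show "X $$ k = 0" using low \<open>Z = 0\<close> by cases (simp_all add: Z_def)
    qed
  qed
  then have "X $$ k = 0" for k using nat_le_iff[of k "nat k"] by blast
  then show ?thesis by (simp add: fls_eq_iff)
qed

lemma der_eq_on_jets_2:
  assumes "der D" "der E" "\<And>k. k \<ge> 2 \<Longrightarrow> D (jet_h k) = E (jet_h k)" "f \<in> alg jet_gens"
  shows "D f = E f"
  by (rule der_eq_on_jets[OF assms(1,2) _ _ assms(4)])
     (simp_all add: der_h2pow_1[OF assms(1)] der_h2pow_1[OF assms(2)] assms(3))

lemma lact_cong_jets:
  assumes "der D" "der E" "\<And>f. f \<in> alg jet_gens \<Longrightarrow> D f = E f"
  shows "lact D Y = lact E Y"
  by (intro fls_eqI m2_eqI) (simp_all add: assms Y_in_jets)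

text \<open>The derivative of the leading polynomial \<open>U\<^sub>0\<close> along a flow with \<open>h\<^sub>2\<^sup>1\<^sup>/\<^sup>2 \<mapsto> x\<close>.\<close>

definition Ulead_rate :: "fn \<Rightarrow> fn m2 fls" where
  "Ulead_rate x = fls_shift 1 (fls_const (M2 0 x (cst (of_real \<gamma>) * h2pow (- 1) * h2pow (- 1) * x) 0))"

lemma Ulead_rate_nth:
  "Ulead_rate x $$ n = (if n = - 1 then M2 0 x (cst (of_real \<gamma>) * h2pow (- 1) * h2pow (- 1) * x) 0 else 0)"
  by (auto simp: Ulead_rate_def)

lemma lact_Upol_0: "der D \<Longrightarrow> lact D (Upol Y 0) = Ulead_rate (D (h2pow 1))"
  by (rule fls_eqI)
     (simp add: Ulead_rate_nth Upol_0 map_m2_0 der_0 der_minus der_cst_mult der_h2pow_neg cst_minus mult.assoc)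

lemma e\<^sub>0_jet: "k \<ge> 2 \<Longrightarrow> jet_h (Suc k) = cst (- 1 / 2) * h2pow 1 * e\<^sub>0 (jet_h k)"
proof -
  assume "k \<ge> 2"
  then have "e\<^sub>0 (jet_h k) = cst (- 2) * h2pow (- 1) * jet_h (Suc k)"
    by (simp add: evf_def ieta_def vf_jets)
  then show ?thesis using cst_h2pow_cancel(1)[of "- 2" "jet_h (Suc k)"] by simp
qed

text \<open>
  The jet variables are the iterated derivatives of \<open>h\<^sub>2\<close> along \<open>\<partial>\<^sub>0\<close>, up to the factor \<open>h\<^sub>2\<^sup>1\<^sup>/\<^sup>2\<close>. So the prescribed
  commutator with \<open>\<partial>\<^sub>0\<close> is a recursion for the values of \<open>D\<close> on \<open>h\<^sub>3, h\<^sub>4, \<dots>\<close>.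
\<close>

lemma ex_commuting_derivation:
  "\<exists>D. der D \<and> D (h2pow 1) = x \<and>
     (\<forall>f \<in> alg jet_gens. e\<^sub>0 (D f) - D (e\<^sub>0 f) + \<kappa> * evf d\<^sub>0 Rho f = 0)"
proof -
  \<comment> \<open>\<open>w n\<close> is the value on \<open>h\<^bsub>n+2\<^esub>\<close>; the step differentiates \<open>h\<^bsub>k+1\<^esub> = - h\<^sub>2\<^sup>1\<^sup>/\<^sup>2 \<partial>\<^sub>0 h\<^sub>k / 2\<close> and exchanges \<open>D\<close> with \<open>\<partial>\<^sub>0\<close>.\<close>
  define w where "w = rec_nat (cst 2 * h2pow 1 * x)
    (\<lambda>n y. cst (- 1 / 2) * (x * e\<^sub>0 (jet_h (n + 2)) + h2pow 1 * (e\<^sub>0 y + \<kappa> * evf d\<^sub>0 Rho (jet_h (n + 2)))))"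
  obtain D where D: "der D" "D (h2pow 1) = x" "\<And>k. k \<ge> 3 \<Longrightarrow> D (jet_h k) = w (k - 2)"
    using ex_der[of x "\<lambda>k. w (k - 2)"] by blast
  define K where "K = (\<lambda>f. e\<^sub>0 (D f) - D (e\<^sub>0 f) + \<kappa> * evf d\<^sub>0 Rho f)"
  have derK: "der K" unfolding K_def by (intro der_plus der_commutator der_scale der_evf D(1))
  have Dw: "D (jet_h (n + 2)) = w n" for n
    using D(3)[of "n + 2"] by (cases n) (simp_all add: der_jet_h_2[OF D(1)] D(2) w_def flip: numeral_2_eq_2)
  have "K (jet_h k) = 0" if "k \<ge> 2" for k
  proof -
    from that obtain n where k: "k = n + 2" using le_Suc_ex[of 2 k] by (auto simp: add.commute)
    let ?h = "jet_h k" and ?u = "h2pow 1"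
    have "D (jet_h (Suc k)) = cst (- 1 / 2) * (x * e\<^sub>0 ?h + ?u * D (e\<^sub>0 ?h))"
      unfolding e\<^sub>0_jet[OF that] mult.assoc der_cst_mult[OF D(1)] by (simp add: der_mult[OF D(1)] D(2))
    moreover have "D (jet_h (Suc k)) = cst (- 1 / 2) * (x * e\<^sub>0 ?h + ?u * (e\<^sub>0 (D ?h) + \<kappa> * evf d\<^sub>0 Rho ?h))"
      using Dw[of n] Dw[of "Suc n"] by (simp add: w_def k)
    ultimately have "cst (- 1 / 2) * (?u * K ?h) = 0"
      unfolding K_def by (simp add: algebra_simps)
    then have "cst (- 2) * h2pow (- 1) * (cst (- 1 / 2) * ?u * K ?h) = 0" by (simp add: mult.assoc)
    then show ?thesis using cst_h2pow_cancel(2)[of "- 1 / 2" "K ?h"] by simp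
  qed
  then have "K f = 0" if "f \<in> alg jet_gens" for f
    using der_eq_on_jets_2[OF derK der_zero _ that] by simp
  then show ?thesis using D(1,2) by (auto simp: K_def)
qed

text \<open>
  Vanishing curvature with \<open>\<partial>\<^sub>0\<close> makes the defect \<open>X = D Y + [P, Y]\<close> parallel along \<open>\<partial>\<^sub>0\<close>, and the
  constancy of \<open>Y\<^sup>2\<close> makes it anticommute with \<open>Y\<close>, so \<open>series_unique\<close> applies.
\<close>

lemma ex_flow:
  assumes P: "supported {1..} (comm P Y)"
    and flat: "lact e\<^sub>0 P - Ulead_rate x + comm (Upol Y 0) P + cmon 0 \<kappa> * Srho = 0"
  shows "\<exists>D. der D \<and> D (h2pow 1) = x \<and> lact D Y = - comm P Y"
proof -
  obtain D where D: "der D" "D (h2pow 1) = x"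
    and K: "\<And>f. f \<in> alg jet_gens \<Longrightarrow> e\<^sub>0 (D f) - D (e\<^sub>0 f) + \<kappa> * evf d\<^sub>0 Rho f = 0"
    using ex_commuting_derivation[of x \<kappa>] by blast
  let ?H = "evf d\<^sub>0 Rho" and ?U = "Upol Y 0"
  have "lact (\<lambda>f. e\<^sub>0 (D f) - D (e\<^sub>0 f) + \<kappa> * ?H f) Y = lact (\<lambda>f. 0) Y"
    by (rule lact_cong_jets) (auto intro!: der_plus der_commutator der_scale der_evf D(1) der_zero K)
  also have "\<dots> = 0" by (intro fls_eqI m2_eqI) (simp_all add: der_zero)
  finally have commute: "lact e\<^sub>0 (lact D Y) - lact D (lact e\<^sub>0 Y) + cmon 0 \<kappa> * lact ?H Y = 0"
    by (simp add: lact_lincomb der_evf D(1))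
  have e0Y: "lact e\<^sub>0 Y = - comm ?U Y" and HY: "lact ?H Y = - comm Srho Y"
    using lact_Y[of Xi] lact_Y[of Rho] phi_gT(4)[of Y 0] by simp_all
  have C: "cmon 0 \<kappa> * comm S Y = comm (cmon 0 \<kappa> * S) Y" for S
    by (simp add: comm_def right_diff_distrib mult.assoc) (simp flip: mult.assoc add: cmon_commute[of 0 \<kappa> Y])
  define X where "X = lact D Y + comm P Y"
  have DU: "lact D ?U = Ulead_rate x" using lact_Upol_0[OF D(1)] D(2) by simp
  have "lact e\<^sub>0 (lact D Y) = - comm (Ulead_rate x) Y - comm ?U (lact D Y) + comm (cmon 0 \<kappa> * Srho) Y"
    using commute by (simp add: e0Y HY lact_simps D(1) lact_comm DU C[symmetric] comm_simps algebra_simps)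
  moreover have "lact e\<^sub>0 (comm P Y) = comm (lact e\<^sub>0 P) Y - comm P (comm ?U Y)"
    by (simp add: lact_comm der_evf e0Y comm_simps)
  ultimately have "lact e\<^sub>0 X = - comm ?U X +
      comm (lact e\<^sub>0 P - Ulead_rate x + comm ?U P + cmon 0 \<kappa> * Srho) Y"
    by (simp add: X_def lact_simps der_evf comm_simps comm_Jacobi)
  then have 1: "lact e\<^sub>0 X = - comm ?U X" unfolding flat by (simp add: comm_def)
  have "lact D (Y * Y) = 0" unfolding Y_square by (rule lact_cmon_cst[OF D(1)])
  then have "lact D Y * Y + Y * lact D Y = 0" by (simp add: lact_simps D(1))
  moreover have "comm P Y * Y + Y * comm P Y = 0"
  proof -
    have "comm P Y * Y + Y * comm P Y = P * (Y * Y) - (Y * Y) * P" by (simp add: comm_def algebra_simps)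
    then show ?thesis unfolding Y_square by (simp add: cmon_commute)
  qed
  ultimately have 2: "X * Y + Y * X = 0"
    unfolding X_def by (simp add: distrib_left distrib_right add_ac)
  have "supported {1..} (lact D Y)"
    using Y_supported by (auto simp: supported_def D(1) map_m2_0 der_0)
  then have 3: "supported {1..} X" unfolding X_def using P by (rule supported_add)
  have "X = 0" by (rule series_unique[OF 3 1 2])
  then have "lact D Y = - comm P Y" by (simp add: X_def eq_neg_iff_add_eq_0)
  with D show ?thesis by blast
qed

text \<open>
  The rate of \<open>h\<^sub>2\<^sup>1\<^sup>/\<^sup>2\<close> is forced: in degree \<open>-1\<close>, flatness says that the derivative of \<open>U\<^sub>0\<close> is minus the commutator of \<open>U\<^sub>0\<close>
  with the degree 0 part of \<open>V\<^sub>m\<close>, which is diagonal with entries \<open>\<mp>a\<^bsup>2m+3\<^esup>/2\<close>.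
\<close>

lemma ex_t_flow: "\<exists>D. der D \<and> D (h2pow 1) = - h2pow 1 * a (2 * m + 3) \<and> lact D Y = - comm (Upol Y m) Y"
proof (rule ex_flow)
  let ?p = "proj {..<0 :: int}" and ?U = "Upol Y 0"
  define W where "W = proj {0..} (Vser Y m)"
  have V: "Vser Y m = Upol Y m + W" unfolding W_def by (rule Vser_split)
  have "comm (Vser Y m) Y = 0"
    by (simp add: comm_def Vser_def cmon_commute[of _ _ Y] mult.assoc)
  then have "comm (Upol Y m) Y = - comm W Y" by (simp add: V comm_simps eq_neg_iff_add_eq_0)
  moreover have "supported {1..} (comm W Y)"
    by (rule supported_comm[OF _ Y_supported, of "{0..}"]) (simp_all add: W_def)
  ultimately show "supported {1..} (comm (Upol Y m) Y)" by (simp add: supported_minus)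
  let ?a = "a (2 * m + 3)"
  have W0: "W $$ 0 = M2 (cst (- 1 / 2) * ?a) 0 0 (cst (1 / 2) * ?a)"
  proof -
    have n: "nat (2 * int m + 2) + 1 = 2 * m + 3" by simp
    have y: "e11 (Y $$ (2 * int m + 2)) = cst (- \<i>) * ?a" "e12 (Y $$ (2 * int m + 2)) = 0" "e21 (Y $$ (2 * int m + 2)) = 0"
      unfolding Y_entries n by simp_all
    have V0: "Vser Y m $$ 0 = scalar (cst (1 / (2 * \<i>))) * Y $$ (2 * int m + 2)"
    proof -
      have "0 - (- 2 * int m - 2) = 2 * int m + 2" by simp
      then show ?thesis by (simp only: Vser_def cmon_mult_nth)
    qed
    have c: "cst (1 / (2 * \<i>)) * (cst (- \<i>) * x) = cst (- 1 / 2) * x" for x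
      by (simp flip: mult.assoc cst_mult)
    have m: "- cst (- 1 / 2) = cst (1 / 2)" by (simp flip: cst_minus)
    have "W $$ 0 = scalar (cst (1 / (2 * \<i>))) * Y $$ (2 * int m + 2)" by (simp add: W_def V0)
    also have "Y $$ (2 * int m + 2) = M2 (cst (- \<i>) * ?a) 0 0 (- (cst (- \<i>) * ?a))"
      by (intro m2_eqI) (simp_all add: y Y_entries(4))
    also have "scalar (cst (1 / (2 * \<i>))) * M2 (cst (- \<i>) * ?a) 0 0 (- (cst (- \<i>) * ?a)) =
      M2 (cst (1 / (2 * \<i>)) * (cst (- \<i>) * ?a)) 0 0 (- (cst (1 / (2 * \<i>)) * (cst (- \<i>) * ?a)))"
      by (intro m2_eqI) simp_all
    also have "\<dots> = M2 (cst (- 1 / 2) * ?a) 0 0 (cst (1 / 2) * ?a)"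
      unfolding c m[symmetric] by simp
    finally show ?thesis .
  qed
  have neg: "?p (comm ?U (Upol Y m)) = comm ?U (Upol Y m)"
    by (rule proj_supported, rule supported_comm[OF Upol_supported Upol_supported]) auto
  have "lact e\<^sub>0 (Upol Y m) = - ?p (comm ?U (Vser Y m))"
    by (rule lact_Upol[OF der_evf]) (use lact_Y[of Xi] phi_gT(4)[of Y 0] in simp)
  then have "lact e\<^sub>0 (Upol Y m) + comm ?U (Upol Y m) = - ?p (comm ?U W)"
    by (simp add: V comm_simps proj_simps neg)
  moreover have "?p (comm ?U W) = - Ulead_rate (- h2pow 1 * ?a)"
  proof (rule fls_eqI)
    fix n :: int
    have half: "cst (1 / 2) * x + cst (1 / 2) * x = x" for x
    proof -
      have "cst (1 / 2) * x + cst (1 / 2) * x = (cst (1 / 2) + cst (1 / 2)) * x" by (simp only: distrib_right)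
      then show ?thesis by (simp flip: cst_add)
    qed
    have A: "comm Ulead (M2 (cst (- 1 / 2) * ?a) 0 0 (cst (1 / 2) * ?a)) =
      M2 0 (h2pow 1 * ?a) (cst (of_real \<gamma>) * h2pow (- 1) * ?a) 0"
    proof (intro m2_eqI)
      have "e12 (comm Ulead (M2 (cst (- 1 / 2) * ?a) 0 0 (cst (1 / 2) * ?a))) =
          cst (1 / 2) * (h2pow 1 * ?a) + cst (1 / 2) * (h2pow 1 * ?a)"
        by (simp add: comm_def cst_minus ac_simps)
      then show "e12 (comm Ulead (M2 (cst (- 1 / 2) * ?a) 0 0 (cst (1 / 2) * ?a))) =
          e12 (M2 0 (h2pow 1 * ?a) (cst (of_real \<gamma>) * h2pow (- 1) * ?a) 0)"
        unfolding half by simp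
      have "e21 (comm Ulead (M2 (cst (- 1 / 2) * ?a) 0 0 (cst (1 / 2) * ?a))) =
          cst (1 / 2) * (cst (of_real \<gamma>) * h2pow (- 1) * ?a) + cst (1 / 2) * (cst (of_real \<gamma>) * h2pow (- 1) * ?a)"
        by (simp add: comm_def cst_minus ac_simps)
      then show "e21 (comm Ulead (M2 (cst (- 1 / 2) * ?a) 0 0 (cst (1 / 2) * ?a))) =
          e21 (M2 0 (h2pow 1 * ?a) (cst (of_real \<gamma>) * h2pow (- 1) * ?a) 0)"
        unfolding half by simp
    qed (simp_all add: comm_def)
    have B: "- Ulead_rate (- h2pow 1 * ?a) $$ (- 1) = M2 0 (h2pow 1 * ?a) (cst (of_real \<gamma>) * h2pow (- 1) * ?a) 0"
    proof -
      have "cst (of_real \<gamma>) * h2pow (- 1) * h2pow (- 1) * (- h2pow 1 * ?a) =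
        - (cst (of_real \<gamma>) * h2pow (- 1) * ?a * (h2pow (- 1) * h2pow 1))"
        by (simp only: mult_minus_left mult_minus_right ac_simps)
      also have "\<dots> = - (cst (of_real \<gamma>) * h2pow (- 1) * ?a)" by simp
      finally have "Ulead_rate (- h2pow 1 * ?a) $$ (- 1) =
          M2 0 (- h2pow 1 * ?a) (- (cst (of_real \<gamma>) * h2pow (- 1) * ?a)) 0"
        unfolding Ulead_rate_nth by simp
      then show ?thesis by (simp add: uminus_m2_def)
    qed
    consider "n = - 1" | "n < - 1" | "n \<ge> 0" by linarith
    then show "?p (comm ?U W) $$ n = (- Ulead_rate (- h2pow 1 * ?a)) $$ n"
    proof cases
      case 1
      then show ?thesis using A B by (simp add: comm_Upol_0 W0)
    next
      case 2
      then have "W $$ (n + 1) = 0" by (simp add: W_def)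
      moreover have "comm Ulead 0 = 0" by (simp add: comm_def)
      ultimately show ?thesis using 2 by (simp add: comm_Upol_0 Ulead_rate_nth)
    next
      case 3
      then show ?thesis by (simp add: Ulead_rate_nth)
    qed
  qed
  ultimately have "lact e\<^sub>0 (Upol Y m) + comm ?U (Upol Y m) = Ulead_rate (- h2pow 1 * ?a)" by simp
  then show "lact e\<^sub>0 (Upol Y m) - Ulead_rate (- h2pow 1 * ?a) + comm ?U (Upol Y m) + cmon 0 0 * Srho = 0"
    by (simp add: cmon_def algebra_simps flip: zero_m2_def)
qed

text \<open>
  The structure equations of the barred jet functions are the conjugates of the unbarred ones.
\<close>

lemma vf_conj:
  assumes "f \<in> alg jet_gens"
  shows "conj_der (vf d\<^sub>0 Xi) f = vf d\<^sub>0 Xib f" "conj_der (vf d\<^sub>0 Xib) f = vf d\<^sub>0 Xi f"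
    "conj_der (vf d\<^sub>0 Rho) f = vf d\<^sub>0 Rho f"
  by (intro der_eq_on_jets_2[OF der_conj_der[OF der_vf] der_vf _ assms];
      simp add: conj_der_def fn_conj_jet_h vf_jets cst_minus)+

text \<open>
  Invariance under \<open>\<lambda> \<mapsto> -\<lambda>\<close> combined with conjugation by \<open>diag (1, -1)\<close>, a symmetry of \<open>Y\<close>.
\<close>

definition parity :: "fn m2 fls \<Rightarrow> bool" where
  "parity F \<longleftrightarrow> (\<forall>n. (even n \<longrightarrow> e12 (F $$ n) = 0 \<and> e21 (F $$ n) = 0) \<and>
     (odd n \<longrightarrow> e11 (F $$ n) = 0 \<and> e22 (F $$ n) = 0))"

lemma parity_Upol: "parity (Upol Y m)" and parity_Qpol: "parity (Qpol Y m)"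
proof -
  show U: "parity (Upol Y m)" by (auto simp: parity_def Upol_def Vser_def Y_entries)
  have "Qpol Y m $$ n = adj (Upol Y m $$ (- n))" for n using is_star_Qpol[of Y m] by (simp add: is_star_def)
  then show "parity (Qpol Y m)" using U by (auto simp: parity_def)
qed

lemma parity_mult_0:
  assumes "parity F" "parity G"
  shows "e12 ((F * G) $$ 0) = 0" "e21 ((F * G) $$ 0) = 0"
proof -
  have z: "e11 (F $$ k) * e12 (G $$ (- k)) = 0" "e12 (F $$ k) * e22 (G $$ (- k)) = 0"
    "e21 (F $$ k) * e11 (G $$ (- k)) = 0" "e22 (F $$ k) * e21 (G $$ (- k)) = 0" for k
    using assms by (cases "even k"; simp add: parity_def)+
  have "(entry e11 F * entry e12 G) $$ 0 = 0" "(entry e12 F * entry e22 G) $$ 0 = 0"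
    "(entry e21 F * entry e11 G) $$ 0 = 0" "(entry e22 F * entry e21 G) $$ 0 = 0"
    by (simp_all add: fls_mult_nth_any entry_nth z)
  then have "entry e12 (F * G) $$ 0 = 0" "entry e21 (F * G) $$ 0 = 0" by (simp_all add: entry_mult)
  then show "e12 ((F * G) $$ 0) = 0" "e21 ((F * G) $$ 0) = 0" by (simp_all add: entry_nth)
qed

lemma trace_comm: "e22 (comm F (G :: fn m2 fls) $$ n) = - e11 (comm F G $$ n)"
proof -
  have t: "e11 ((F * G) $$ n) + e22 ((F * G) $$ n) = (entry e11 (F * G) + entry e22 (F * G)) $$ n" for F G :: "fn m2 fls"
    by (simp add: entry_nth)
  have "entry e11 (F * G) + entry e22 (F * G) = entry e11 (G * F) + entry e22 (G * F)"
    unfolding entry_mult by (simp add: algebra_simps)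
  then have "e11 ((F * G) $$ n) + e22 ((F * G) $$ n) = e11 ((G * F) $$ n) + e22 ((G * F) $$ n)"
    unfolding t by simp
  then show ?thesis by (simp add: comm_def algebra_simps eq_neg_iff_add_eq_0)
qed

lemma cmon_Srho_nth: "(cmon 0 x * Srho) $$ n = (if n = 0 then M2 (x * cst (\<i> / 2)) 0 0 (- (x * cst (\<i> / 2))) else 0)"
proof -
  have "x * cst (- \<i> / 2) = - (x * cst (\<i> / 2))" using cst_minus[of "\<i> / 2"] by simp
  then show ?thesis by (auto simp: Srho_nth intro!: m2_eqI)
qed

text \<open>
  By parity the degree 0 part of the commutator is diagonal, and a commutator is traceless; so it is a
  multiple of \<open>s\<close>.
\<close>

lemma comm_QU_rho: "\<exists>x. cmon 0 x * Srho = proj {0} (comm (Qpol Y l) (Upol Y m))"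
proof -
  let ?C = "comm (Qpol Y l) (Upol Y m) $$ 0"
  have "e12 ?C = 0" "e21 ?C = 0" "e22 ?C = - e11 ?C"
    using parity_mult_0[OF parity_Qpol[of l] parity_Upol[of m]] parity_mult_0[OF parity_Upol[of m] parity_Qpol[of l]]
    by (simp_all add: trace_comm) (simp_all add: comm_def)
  moreover have "cst (- 2 * \<i>) * y * cst (\<i> / 2) = y" for y
  proof -
    have "cst (- 2 * \<i>) * y * cst (\<i> / 2) = (cst (- 2 * \<i>) * cst (\<i> / 2)) * y" by (simp only: ac_simps)
    then show ?thesis by (simp flip: cst_mult)
  qed
  ultimately have "cmon 0 (cst (- 2 * \<i>) * e11 ?C) * Srho = proj {0} (comm (Qpol Y l) (Upol Y m))"
    by (intro fls_eqI, unfold cmon_Srho_nth) (auto intro!: m2_eqI)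
  then show ?thesis by blast
qed

lemma cmon_minus: "cmon k (- x) = - cmon k (x :: fn)"
  by (rule fls_eqI) (simp add: uminus_m2_def zero_m2_def)

text \<open>
  \<open>h\<^sub>2\<close> does not depend on \<open>tbar\<^sub>m\<close>. The curvature with \<open>\<partial>\<^sub>0\<close> reduces to the degree 0 part of \<open>[Q\<^sub>m, U\<^sub>0]\<close>, a multiple of
  \<open>s\<close>, which a rotation term in the commutator with \<open>\<partial>\<^sub>0\<close> absorbs.
\<close>

lemma ex_tb_flow: "\<exists>D. der D \<and> D (h2pow 1) = 0 \<and> lact D Y = - comm (- Qpol Y m) Y"
proof -
  let ?C = "comm (Qpol Y m) (Upol Y 0)"
  obtain x where x: "cmon 0 x * Srho = proj {0} ?C" using comm_QU_rho by blast
  show ?thesis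
  proof (rule ex_flow)
    show "supported {1..} (comm (- Qpol Y m) Y)"
      by (rule supported_comm[OF supported_minus[OF Qpol_supported] Y_supported]) auto
    have "lact (conj_der e\<^sub>0) Y = lact (evf d\<^sub>0 Xib) Y"
      by (rule lact_cong_jets)
         (use vf_conj(1) in \<open>simp_all add: der_conj_der der_evf conj_der_def evf_def ieta_def\<close>)
    also have "\<dots> = comm (Qpol Y 0) Y"
      using lact_Y[of Xib] phi_gT(8)[of Y 0] by (simp add: comm_simps)
    finally have "lact e\<^sub>0 (Qpol Y m) = proj {0<..} ?C"
      by (rule lact_Qpol[OF der_evf Qpol_supported is_star_Qpol])
    moreover have "- proj {0<..} ?C + ?C - proj {0} ?C = 0"
    proof -
      have "supported {0..} ?C"
      proof (rule supported_comm)
        show "supported {1..} (Qpol Y m)" by (rule supported_mono[OF Qpol_supported]) auto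
        show "supported {- 1} (Upol Y 0)" by (simp add: supported_def Upol_0)
      qed auto
      then show ?thesis by (auto simp: fls_eq_iff supported_def)
    qed
    moreover have "Ulead_rate 0 = 0" by (rule fls_eqI) (simp add: Ulead_rate_nth flip: zero_m2_def)
    moreover have "comm (Upol Y 0) (- Qpol Y m) = ?C" by (simp add: comm_def)
    ultimately show "lact e\<^sub>0 (- Qpol Y m) - Ulead_rate 0 + comm (Upol Y 0) (- Qpol Y m) + cmon 0 (- x) * Srho = 0"
      by (simp add: lact_simps der_evf cmon_minus x)
  qed
qed

lemma omega_apply:
  "omega {g} = (case g of Rho \<Rightarrow> cst \<i> | DT n \<Rightarrow> a (2 * Suc n + 3) | _ \<Rightarrow> 0)"
  "omegab {g} = (case g of Rho \<Rightarrow> - cst \<i> | DTb n \<Rightarrow> fn_conj (a (2 * Suc n + 3)) | _ \<Rightarrow> 0)"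
proof -
  have "omega {g} = cst \<i> * rho {g} + fsum (\<lambda>m. smult (a (2 * Suc m + 3)) (theta (DT m))) {g}"
    "omegab {g} = - cst \<i> * rho {g} + fsum (\<lambda>m. smult (fn_conj (a (2 * Suc m + 3))) (theta (DTb m))) {g}"
    by (simp_all add: omega_def omegab_def)
  then show "omega {g} = (case g of Rho \<Rightarrow> cst \<i> | DT n \<Rightarrow> a (2 * Suc n + 3) | _ \<Rightarrow> 0)"
    "omegab {g} = (case g of Rho \<Rightarrow> - cst \<i> | DTb n \<Rightarrow> fn_conj (a (2 * Suc n + 3)) | _ \<Rightarrow> 0)"
    using fsum_theta_apply[OF inj_DT(1)] fsum_theta_apply[OF inj_DT(2)]
      fsum_theta_apply_0[of g DT] fsum_theta_apply_0[of g DTb]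
    by (cases g; force simp: theta_def)+
qed

lemma omega_wedge:
  "omega \<and>\<^sub>f xi = smult (cst \<i>) (rho \<and>\<^sub>f xi) + fsum (\<lambda>m. smult (a (2 * Suc m + 3)) (theta (DT m) \<and>\<^sub>f xi))"
  "omegab \<and>\<^sub>f xib = smult (- cst \<i>) (rho \<and>\<^sub>f xib) +
     fsum (\<lambda>m. smult (fn_conj (a (2 * Suc m + 3))) (theta (DTb m) \<and>\<^sub>f xib))"
  unfolding fsum_wedge[OF inj_DT(1)] fsum_wedge[OF inj_DT(2)] omega_def omegab_def by (rule refl)+

text \<open>
  The original vector fields serve for \<open>\<xi>\<close>, \<open>\<xi>bar\<close>, \<open>\<rho>\<close> and the constructed ones for the higher times. The
  last clause is the content of (A) on \<open>h\<^sub>2\<close>.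
\<close>

lemma ex_jet_flow:
  "\<exists>D. der D \<and> lact (\<lambda>f. ieta g * D f) Y = - comm (ephi Y g) Y \<and>
     (if g = Xi then D (jet_h 2) = jet_h 3 else D (h2pow 1) = - h2pow 1 * omega {g})"
proof (cases g)
  case Xi
  show ?thesis
    using lact_Y[of Xi] vf_jets(1)[of 2] Xi der_vf by (intro exI[of _ "vf d\<^sub>0 Xi"]) (simp add: evf_def[abs_def])
next
  case Xib
  have "vf d\<^sub>0 Xib (jet_h 2) = - cst 2 * jet_h 2 * 0"
    using vf_jets(2)[of 2] by (simp add: Tfun_def)
  then have "vf d\<^sub>0 Xib (h2pow 1) = - h2pow 1 * 0" using square_root_rate(1)[OF der_vf] by blast
  then show ?thesis
    using lact_Y[of Xib] Xib der_vf omega_apply(1)[of Xib]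
    by (intro exI[of _ "vf d\<^sub>0 Xib"]) (simp add: evf_def[abs_def])
next
  case Rho
  have "cst (\<i> * of_nat 2) = cst 2 * cst \<i>" by (simp add: mult.commute flip: cst_mult)
  then have "vf d\<^sub>0 Rho (jet_h 2) = - cst 2 * jet_h 2 * cst \<i>"
    using vf_jets(3)[of 2] by (simp add: ac_simps)
  then have "vf d\<^sub>0 Rho (h2pow 1) = - h2pow 1 * cst \<i>" using square_root_rate(1)[OF der_vf] by blast
  then show ?thesis
    using lact_Y[of Rho] Rho der_vf omega_apply(1)[of Rho]
    by (intro exI[of _ "vf d\<^sub>0 Rho"]) (simp add: evf_def[abs_def])
next
  case (DT n)
  show ?thesis
    using ex_t_flow[of "Suc n"] DT omega_apply(1)[of "DT n"] phi_gT(4)[of Y "Suc n"] by (simp add: ieta_def) blast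
next
  case (DTb n)
  show ?thesis
    using ex_tb_flow[of "Suc n"] DTb omega_apply(1)[of "DTb n"] phi_gT(8)[of Y "Suc n"] by (simp add: ieta_def) blast
qed

text \<open>
  The conjugate of a flow along \<open>g\<close> is a flow along \<open>conj_dir g\<close>, so one family of derivations of the unbarred
  jet functions determines the action on the barred ones.
\<close>

fun conj_dir :: "coframe \<Rightarrow> coframe" where
  "conj_dir Xi = Xib" | "conj_dir Xib = Xi" | "conj_dir Rho = Rho" | "conj_dir (DT n) = DTb n" | "conj_dir (DTb n) = DT n"

lemma conj_dir_facts:
  "fn_conj (ieta g) = ieta (conj_dir g)" "ephi_star Y' g = - ephi Y' (conj_dir g)"
  "fn_conj (omega {conj_dir g}) = omegab {g}" "conj_dir g = Xi \<longleftrightarrow> g = Xib"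
  by (cases g; simp add: ieta_def ephi_star_def ephi_def pphi_def mphi_def sphi_def omega_apply flip: cst_minus)+

lemma ex_two_sided:
  assumes "der D" "der D'"
  shows "\<exists>E. der E \<and> (\<forall>f \<in> alg jet_gens. E f = D f) \<and> (\<forall>f \<in> alg jet_gens. conj_der E f = D' f) \<and>
     (\<forall>m. E (var_t m) = vt m) \<and> (\<forall>m. E (var_tb m) = vtb m)"
proof -
  obtain E where E: "der E" "E (h2pow 1) = D (h2pow 1)" "\<And>k. k \<ge> 3 \<Longrightarrow> E (jet_h k) = D (jet_h k)"
    "\<And>m. E (var_t m) = vt m" "E (fn_conj (h2pow 1)) = fn_conj (D' (h2pow 1))"
    "\<And>k. k \<ge> 3 \<Longrightarrow> E (jet_hb k) = fn_conj (D' (jet_h k))" "\<And>m. E (var_tb m) = vtb m"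
    using ex_der[of "D (h2pow 1)" "\<lambda>k. D (jet_h k)" vt "fn_conj (D' (h2pow 1))" "\<lambda>k. fn_conj (D' (jet_h k))" vtb]
    by blast
  have "E f = D f" if "f \<in> alg jet_gens" for f
    by (rule der_eq_on_jets[OF E(1) assms(1) E(2,3) that])
  moreover have "conj_der E f = D' f" if "f \<in> alg jet_gens" for f
    by (rule der_eq_on_jets[OF der_conj_der[OF E(1)] assms(2) _ _ that])
       (simp_all add: conj_der_def E(5) fn_conj_jet_h E(6))
  ultimately show ?thesis using E(1,4,7) by blast
qed

section \<open>Existence of the hierarchy\<close>

text \<open>
  This is the degree 0 equation, to be solved for the component \<open>\<kappa>\<close> of \<open>d\<rho>\<close>. Its right-hand side is nonzero only if one
  direction is barred and the other is not, and then it is a multiple of \<open>s\<close>.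
\<close>

lemma ex_kappa:
  "\<exists>\<kappa>. cmon 0 \<kappa> * Srho = - proj {0} (comm (pphi Y g) (mphi Y h) + comm (mphi Y g) (pphi Y h))"
proof -
  have c0: "comm 0 X = 0" "comm X 0 = 0" for X :: "fn m2 fls" by (simp_all add: comm_def)
  have z: "\<exists>\<kappa>. cmon 0 \<kappa> * Srho = - proj {0} 0"
    by (rule exI[of _ 0]) (simp add: fls_eq_iff flip: zero_m2_def)
  have 1: "\<exists>\<kappa>. cmon 0 \<kappa> * Srho = - proj {0} (comm (Upol Y m) (- Qpol Y l))" for m l
  proof -
    obtain x where "cmon 0 x * Srho = proj {0} (comm (Qpol Y l) (Upol Y m))" using comm_QU_rho by blast
    moreover have "comm (Upol Y m) (- Qpol Y l) = comm (Qpol Y l) (Upol Y m)" by (simp add: comm_def)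
    ultimately show ?thesis by (intro exI[of _ "- x"]) (simp add: cmon_minus)
  qed
  have 2: "\<exists>\<kappa>. cmon 0 \<kappa> * Srho = - proj {0} (comm (- Qpol Y l) (Upol Y m))" for m l
  proof -
    obtain x where "cmon 0 x * Srho = proj {0} (comm (Qpol Y l) (Upol Y m))" using comm_QU_rho by blast
    then show ?thesis by (intro exI[of _ x]) (simp add: comm_simps proj_simps)
  qed
  show ?thesis
    by (cases g rule: coframe_cases; cases h rule: coframe_cases) (simp_all add: c0 z 1 2)
qed

definition kappa :: "coframe \<Rightarrow> coframe \<Rightarrow> fn" where
  "kappa g h = (SOME \<kappa>. cmon 0 \<kappa> * Srho = - proj {0} (comm (pphi Y g) (mphi Y h) + comm (mphi Y g) (pphi Y h)))"

lemma kappa: "cmon 0 (kappa g h) * Srho = - proj {0} (comm (pphi Y g) (mphi Y h) + comm (mphi Y g) (pphi Y h))"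
  unfolding kappa_def by (rule someI_ex[OF ex_kappa])

text \<open>
  The value of \<open>d\<rho>\<close>, back on the given coframe. The choice of \<open>p\<close> only recovers the ordered pair from the set \<open>S\<close>.
\<close>

definition tau :: form where
  "tau S = (if \<exists>g h. pos g < pos h \<and> S = {g, h}
     then (let p = (SOME p. pos (fst p) < pos (snd p) \<and> S = {fst p, snd p})
       in eta (fst p) * eta (snd p) * kappa (fst p) (snd p)) else 0)"

lemma tau_pair: "pos g < pos h \<Longrightarrow> tau {g, h} = eta g * eta h * kappa g h"
proof -
  assume gh: "pos g < pos h"
  have "(SOME p. pos (fst p) < pos (snd p) \<and> {g, h} = {fst p, snd p}) = (g, h)"
  proof (rule some_equality)
    fix p assume "pos (fst p) < pos (snd p) \<and> {g, h} = {fst p, snd p}"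
    then show "p = (g, h)" using gh by (cases p) (auto simp: doubleton_eq_iff)
  qed (use gh in simp)
  moreover have "\<exists>g' h'. pos g' < pos h' \<and> {g, h} = {g', h'}" using gh by blast
  ultimately show ?thesis by (simp add: tau_def)
qed

lemma tau_Omega: "tau \<in> Omega 2"
proof (rule OmegaI)
  fix S assume "tau S \<noteq> 0"
  then have "\<exists>g h. pos g < pos h \<and> S = {g, h}" by (auto simp: tau_def split: if_splits)
  then obtain g h where "pos g < pos h" "S = {g, h}" by blast
  then show "finite S \<and> card S = 2" by (auto simp: card_insert_if)
qed

text \<open>
  The only pair among \<open>\<xi>\<close>, \<open>\<xi>bar\<close>, \<open>\<rho>\<close> with a nonzero coefficient: \<open>[U\<^sub>0, Q\<^sub>0]\<close> yields the curvature \<open>R\<close>.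
\<close>

lemma tau_xi_xib: "tau {Xi, Xib} = curvR \<gamma> * cst (\<i> / 2)"
proof -
  let ?u = "h2pow 1" and ?v = "h2pow (- 1)" and ?g = "cst (of_real \<gamma>)"
  have ph: "pphi Y Xi = 0" "mphi Y Xib = 0" "mphi Y Xi = Upol Y 0" "pphi Y Xib = - Qpol Y 0"
    by (simp_all add: pphi_def mphi_def)
  have "kappa Xi Xib * cst (\<i> / 2) = e11 ((cmon 0 (kappa Xi Xib) * Srho) $$ 0)" by (simp add: Srho_nth)
  also have "\<dots> = e11 (comm (Upol Y 0) (Qpol Y 0) $$ 0)"
    unfolding kappa ph by (simp add: comm_def)
  also have "\<dots> = e11 (comm Ulead (M2 0 (cst (- of_real \<gamma>) * fn_conj ?v) (fn_conj ?u) 0))"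
    unfolding comm_Upol_0 by (simp add: Qpol_0)
  also have "\<dots> = ?u * fn_conj ?u - ?g * ?g * (?v * fn_conj ?v)"
    by (simp add: comm_def cst_minus ac_simps)
  finally have k: "kappa Xi Xib * cst (\<i> / 2) = ?u * fn_conj ?u - ?g * ?g * (?v * fn_conj ?v)" .
  have i: "kappa Xi Xib = cst (- 2 * \<i>) * (kappa Xi Xib * cst (\<i> / 2))"
  proof -
    have "cst (- 2 * \<i>) * (kappa Xi Xib * cst (\<i> / 2)) = (cst (- 2 * \<i>) * cst (\<i> / 2)) * kappa Xi Xib"
      by (simp only: ac_simps)
    then show ?thesis by (simp flip: cst_mult)
  qed
  have "tau {Xi, Xib} = eta Xi * eta Xib * kappa Xi Xib" by (rule tau_pair) simp
  also have "\<dots> = cst (- 1 / 2) * ?u * (cst (- 1 / 2) * fn_conj ?u) *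
      (cst (- 2 * \<i>) * (?u * fn_conj ?u - ?g * ?g * (?v * fn_conj ?v)))"
    by (subst i, unfold k) (simp add: eta_def)
  also have "\<dots> = (cst (- 1 / 2) * cst (- 1 / 2) * cst (- 2 * \<i>)) *
      ((?u * ?u) * (fn_conj ?u * fn_conj ?u) - ?g * ?g * ((?u * ?v) * (fn_conj ?u * fn_conj ?v)))"
    by (simp only: right_diff_distrib ac_simps)
  also have "\<dots> = cst (- \<i> / 2) * (jet_h 2 * jet_hb 2 - ?g * ?g)"
    by (simp add: conj_h2pow_inverse jet_h_2 jet_hb_def flip: cst_mult)
  also have "\<dots> = curvR \<gamma> * cst (\<i> / 2)"
  proof -
    have "cst (of_real (\<gamma>\<^sup>2)) = ?g * ?g" by (simp add: power2_eq_square flip: cst_mult)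
    moreover have "cst (- \<i> / 2) = - cst (\<i> / 2)" using cst_minus[of "\<i> / 2"] by simp
    ultimately show ?thesis by (simp add: curvR_def algebra_simps)
  qed
  finally show ?thesis .
qed

lemma tau_rho: "g \<in> {Xi, Xib} \<Longrightarrow> tau {g, Rho} = 0"
proof -
  assume g: "g \<in> {Xi, Xib}"
  have "cmon 0 (kappa g Rho) * Srho = - proj {0} 0"
    unfolding kappa by (simp add: comm_def)
  then have "e11 ((cmon 0 (kappa g Rho) * Srho) $$ 0) = 0" by simp
  then have "kappa g Rho * cst (\<i> / 2) = 0" by (simp add: Srho_nth)
  then have "kappa g Rho * cst (\<i> / 2) * cst (- 2 * \<i>) = 0" by simp
  then have "kappa g Rho = 0" by (simp add: mult.assoc flip: cst_mult)
  moreover have "pos g < pos Rho" using g by auto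
  ultimately show ?thesis by (simp add: tau_pair)
qed

text \<open>
  On jet functions and their conjugates the vector fields are the flows found above; on the time variables they are
  dual to \<open>dt\<^sub>m\<close>, \<open>dtbar\<^sub>m\<close>. The rates of \<open>\<xi>\<close> and \<open>\<xi>bar\<close> are taken from \<open>\<omega>\<close>, which makes \<open>dt\<^sub>0\<close> closed.
\<close>

theorem hierarchy_exists: "\<exists>d. cmc_hierarchy \<gamma> a b c d"
proof -
  define J where "J g = (SOME D. der D \<and> lact (\<lambda>f. ieta g * D f) Y = - comm (ephi Y g) Y \<and>
     (if g = Xi then D (jet_h 2) = jet_h 3 else D (h2pow 1) = - h2pow 1 * omega {g}))" for g
  have J: "der (J g) \<and> lact (\<lambda>f. ieta g * J g f) Y = - comm (ephi Y g) Y \<and>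
     (if g = Xi then J g (jet_h 2) = jet_h 3 else J g (h2pow 1) = - h2pow 1 * omega {g})" for g
    unfolding J_def by (rule someI_ex[OF ex_jet_flow])
  define E where "E g = (SOME E. der E \<and> (\<forall>f \<in> alg jet_gens. E f = J g f) \<and>
     (\<forall>f \<in> alg jet_gens. conj_der E f = J (conj_dir g) f) \<and>
     (\<forall>m. E (var_t m) = (if g = gT m then eta g else 0)) \<and> (\<forall>m. E (var_tb m) = (if g = gTb m then eta g else 0)))" for g
  have E: "der (E g) \<and> (\<forall>f \<in> alg jet_gens. E g f = J g f) \<and>
     (\<forall>f \<in> alg jet_gens. conj_der (E g) f = J (conj_dir g) f) \<and>
     (\<forall>m. E g (var_t m) = (if g = gT m then eta g else 0)) \<and> (\<forall>m. E g (var_tb m) = (if g = gTb m then eta g else 0))" for g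
    unfolding E_def using J by (intro someI_ex[OF ex_two_sided]) auto
  interpret F: frame E "\<lambda>g. omega {g}" "\<lambda>g. omegab {g}" tau
    by unfold_locales (use E tau_Omega in auto)
  let ?d = F.ext
  note d = F.ext.antider_axioms
  have u_gen: "h2pow 1 \<in> alg jet_gens" "jet_h 2 \<in> alg jet_gens"
    using jets_upto_subset[OF h2pow_jets] jets_upto_subset[OF jet_h_jets[of 2 2]] by simp_all
  have Eu: "E g (h2pow 1) = - h2pow 1 * omega {g}" if "g \<noteq> Xi" for g
    using E[of g] J[of g] that u_gen(1) by simp
  have Eub: "E g (fn_conj (h2pow 1)) = - fn_conj (h2pow 1) * omegab {g}" if "g \<noteq> Xib" for g
  proof -
    have "conj_der (E g) (h2pow 1) = - h2pow 1 * omega {conj_dir g}"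
      using E[of g] J[of "conj_dir g"] that u_gen(1) conj_dir_facts(4)[of g] by simp
    then have "fn_conj (conj_der (E g) (h2pow 1)) = - fn_conj (h2pow 1) * omegab {g}"
      by (simp add: conj_dir_facts)
    then show ?thesis by (simp add: conj_der_def)
  qed
  have EXi: "E Xi (jet_h 2) = jet_h 3" using E[of Xi] J[of Xi] u_gen(2) by simp
  have EXib: "E Xib (jet_hb 2) = jet_hb 3"
  proof -
    have "conj_der (E Xib) (jet_h 2) = jet_h 3" using E[of Xib] J[of Xi] u_gen(2) by simp
    then have "fn_conj (conj_der (E Xib) (jet_h 2)) = fn_conj (jet_h 3)" by simp
    then show ?thesis by (simp add: conj_der_def fn_conj_jet_h)
  qed
  have dt: "?d (fn0 (var_t m)) = dt m" "?d (fn0 (var_tb m)) = dtb m" for m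
    by (rule Omega_1_eqI; use E in \<open>auto simp: dt_beta dtb_beta beta_apply F.vf_ext simp flip: vf_def\<close>)+
  have ddt: "?d (dt m) = 0" "?d (dtb m) = 0" if "m \<ge> 1" for m
  proof -
    obtain n where n: "m = Suc n" using \<open>m \<ge> 1\<close> by (cases m) auto
    have "?d (theta (DT n)) = 0 \<and>\<^sub>f theta (DT n)" "?d (theta (DTb n)) = 0 \<and>\<^sub>f theta (DTb n)"
      by (rule F.ext_theta; simp add: xi_weight_def)+
    then show "?d (dt m) = 0" "?d (dtb m) = 0" by (simp_all add: n dt_Suc)
  qed
  have dxi: "?d xi = omega \<and>\<^sub>f xi" "?d xib = omegab \<and>\<^sub>f xib"
    by (rule F.ext_theta; simp add: xi_weight_def omega_Omega[unfolded One_nat_def])+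
  have A1: "?d xi - smult (cst \<i>) (rho \<and>\<^sub>f xi) =
       fsum (\<lambda>m. smult (a (2 * Suc m + 3)) (dt (Suc m) \<and>\<^sub>f xi))"
    unfolding dxi dt_Suc omega_wedge by simp
  have "smult (- cst \<i>) x = - smult (cst \<i>) x" for x by (simp add: fun_eq_iff)
  then have A2: "?d xib + smult (cst \<i>) (rho \<and>\<^sub>f xib) =
       fsum (\<lambda>m. smult (fn_conj (a (2 * Suc m + 3))) (dtb (Suc m) \<and>\<^sub>f xib))"
    unfolding dxi dt_Suc omega_wedge by simp
  have c2: "cst (2 * \<i>) = cst 2 * cst \<i>" by (simp add: cst_mult)
  have A3: "?d (fn0 (jet_h 2)) + smult (cst (2 * \<i>) * jet_h 2) rho =
       smult (jet_h 3) xi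
       - smult (cst 2) (fsum (\<lambda>m. smult (jet_h 2 * a (2 * Suc m + 3)) (dt (Suc m))))"
    unfolding dt_Suc fsum_pull[OF inj_DT(1)] c2
  proof (rule Omega_1_eqI)
    fix g
    let ?W = "fsum (\<lambda>m. smult (a (2 * Suc m + 3)) (theta (DT m)))"
    have d: "?d (fn0 (jet_h 2)) {g} = E g (jet_h 2)" by (simp add: F.vf_ext flip: vf_def)
    have W: "omega {g} = cst \<i> * rho {g} + ?W {g}" by (simp add: omega_def)
    show "(?d (fn0 (jet_h 2)) + smult (cst 2 * cst \<i> * jet_h 2) rho) {g} =
       (smult (jet_h 3) xi - smult (cst 2) (smult (jet_h 2) ?W)) {g}"
    proof (cases "g = Xi")
      case True
      then have "rho {g} = 0" "xi {g} = 1" by (auto simp: theta_def)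
      moreover have "?W {g} = 0" unfolding True by (rule fsum_theta_apply_0) auto
      ultimately show ?thesis using EXi True by (simp add: d[unfolded True])
    next
      case False
      then have "E g (jet_h 2) = - cst 2 * jet_h 2 * omega {g}"
        using Eu[OF False] square_root_rate(1)[OF F.der_E] by blast
      moreover have "xi {g} = 0" using False by (simp add: theta_def)
      ultimately show ?thesis by (simp add: d W algebra_simps eq_neg_iff_add_eq_0)
    qed
  qed (intro Omega_add Omega_diff Omega_smult Omega_fsum Omega_theta F.ext.d_fn0_Omega)+
  have A4: "?d (fn0 (jet_hb 2)) - smult (cst (2 * \<i>) * jet_hb 2) rho =
       smult (jet_hb 3) xib
       - smult (cst 2) (fsum (\<lambda>m. smult (jet_hb 2 * fn_conj (a (2 * Suc m + 3))) (dtb (Suc m))))"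
    unfolding dt_Suc fsum_pull[OF inj_DT(2)] c2
  proof (rule Omega_1_eqI)
    fix g
    let ?W = "fsum (\<lambda>m. smult (fn_conj (a (2 * Suc m + 3))) (theta (DTb m)))"
    have d: "?d (fn0 (jet_hb 2)) {g} = E g (jet_hb 2)" by (simp add: F.vf_ext flip: vf_def)
    have W: "omegab {g} = - cst \<i> * rho {g} + ?W {g}" by (simp add: omegab_def)
    show "(?d (fn0 (jet_hb 2)) - smult (cst 2 * cst \<i> * jet_hb 2) rho) {g} =
       (smult (jet_hb 3) xib - smult (cst 2) (smult (jet_hb 2) ?W)) {g}"
    proof (cases "g = Xib")
      case True
      then have "rho {g} = 0" "xib {g} = 1" by (auto simp: theta_def)
      moreover have "?W {g} = 0" unfolding True by (rule fsum_theta_apply_0) auto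
      ultimately show ?thesis using EXib True by (simp add: d[unfolded True])
    next
      case False
      then have "E g (jet_hb 2) = - cst 2 * jet_hb 2 * omegab {g}"
        using Eub[OF False] square_root_rate(2)[OF F.der_E] by blast
      moreover have "xib {g} = 0" using False by (simp add: theta_def)
      ultimately show ?thesis by (simp add: d W algebra_simps eq_neg_iff_add_eq_0)
    qed
  qed (intro Omega_add Omega_diff Omega_smult Omega_fsum Omega_theta F.ext.d_fn0_Omega)+
  let ?Ym = "Ymat a b c"
  let ?D0 = "mdiff ?d phi0 + (mwedge (phi_plus ?Ym) (phi_minus ?Ym) + mwedge (phi_minus ?Ym) (phi_plus ?Ym))"
  have A5: "?D0 i j 0 = 0" for i j
  proof (rule Omega_2_eqI)
    have "homog 2 (mdiff ?d phi0)"
      using F.ext.d_Omega[OF homogD[OF homog_phi0]] by (simp add: homog_def mdiff_def eval_nat_numeral)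
    moreover have "homog 2 (mwedge A B)" if "homog 1 A" "homog 1 B" for A B
      using homog_mwedge[OF that] by (simp add: eval_nat_numeral)
    ultimately have "homog 2 ?D0"
      using homog_phi_plus homog_phi_minus by (intro homog_add) blast+
    then show "?D0 i j 0 \<in> Omega 2" by (rule homogD)
    fix g h assume gh: "pos g < pos h"
    have "ieta g * ieta h * ?d rho {g, h} = (ieta g * eta g) * (ieta h * eta h) * kappa g h"
      unfolding F.ext_rho tau_pair[OF gh] by (simp only: ac_simps)
    then have "mcoef ?D0 {g, h} 0 = 0"
      unfolding degree_0_component[OF Y_nth d gh] by (simp add: kappa)
    then have "\<forall>i j. ?D0 i j 0 {g, h} = 0" by (simp add: mcoef_def zero_m2_def forall_two)
    then show "?D0 i j 0 {g, h} = 0 {g, h}" by simp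
  qed simp
  have A6: "cong_mod_dt (?d rho) (smult (curvR \<gamma> * cst (\<i> / 2)) (xi \<and>\<^sub>f xib))"
    unfolding cong_mod_dt_def F.ext_rho
  proof (intro allI impI)
    fix S assume S: "S \<subseteq> {Xi, Xib, Rho}"
    have O: "smult (curvR \<gamma> * cst (\<i> / 2)) (xi \<and>\<^sub>f xib) \<in> Omega 2"
      using Omega_smult[OF Omega_wedge[OF Omega_theta(1) Omega_theta(1)]] by (simp add: eval_nat_numeral)
    show "tau S = smult (curvR \<gamma> * cst (\<i> / 2)) (xi \<and>\<^sub>f xib) S"
    proof (cases "card S = 2")
      case True
      then obtain g h where gh: "S = {g, h}" "g \<noteq> h" by (meson card_2_iff)
      then have "S = {Xi, Xib} \<or> S = {Xi, Rho} \<or> S = {Xib, Rho}" using S by auto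
      moreover have "pos Xi < pos Xib" "pos Xi < pos Rho" "pos Xib < pos Rho" by simp_all
      ultimately show ?thesis
        using wedge_pair[OF Omega_theta(1)[of Xi] Omega_theta(1)[of Xib]] tau_xi_xib tau_rho
        by (auto simp: theta_def)
    next
      case False
      then have "tau S = 0" "smult (curvR \<gamma> * cst (\<i> / 2)) (xi \<and>\<^sub>f xib) S = 0"
        using OmegaD[OF tau_Omega, of S] OmegaD[OF O, of S] by blast+
      then show ?thesis by simp
    qed
  qed
  have A: "system_A \<gamma> a b c ?d"
    unfolding system_A_def using A1 A2 A3 A4 A5 A6 by (simp add: mdiff_def)
  have "flow Y (evf ?d g) (ephi Y g) (ephi_star Y g)" for g
    unfolding flow_def
  proof (intro conjI)
    have e: "evf ?d g f = ieta g * E g f" for f by (simp add: evf_def F.vf_ext)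
    have ceg: "conj_der (evf ?d g) f = ieta (conj_dir g) * conj_der (E g) f" for f
      by (simp add: conj_der_def e conj_dir_facts(1))
    show "der (evf ?d g)" by (rule F.ext.der_evf)
    show "is_star (ephi Y g) (ephi_star Y g)" by (rule is_star_ephi)
    have "lact (evf ?d g) Y = lact (\<lambda>f. ieta g * J g f) Y"
      by (rule lact_cong_jets) (use E[of g] J[of g] in \<open>auto simp: F.ext.der_evf e intro: der_scale\<close>)
    then show "lact (evf ?d g) Y = - comm (ephi Y g) Y" using J[of g] by simp
    have "lact (conj_der (evf ?d g)) Y = lact (\<lambda>f. ieta (conj_dir g) * J (conj_dir g) f) Y"
      by (rule lact_cong_jets)
         (use E[of g] J[of "conj_dir g"] in \<open>auto simp: F.ext.der_evf ceg intro: der_scale der_conj_der\<close>)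
    then show "lact (conj_der (evf ?d g)) Y = comm (ephi_star Y g) Y"
      using J[of "conj_dir g"] by (simp add: conj_dir_facts(2) comm_simps)
  qed
  then have C: "system_C a b c ?d"
    using killing_equations_iff_flow[OF Y_nth d] by (simp add: system_C_def Let_def)
  have "cmc_hierarchy \<gamma> a b c ?d"
    unfolding cmc_hierarchy_def using F.antiderivation_ext dt ddt A C by blast
  then show ?thesis by blast
qed

end

theorem theorem8p1:
  fixes \<gamma> :: real and d\<^sub>0 :: "form \<Rightarrow> form" and a b c :: "nat \<Rightarrow> fn"
  assumes "\<gamma>\<^sup>2 > 0"
    and "cmc_structure \<gamma> d\<^sub>0"
    and "canonical_killing \<gamma> d\<^sub>0 a b c"
  shows "(\<exists>d. cmc_hierarchy \<gamma> a b c d) \<and>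
         (\<forall>d. cmc_hierarchy \<gamma> a b c d \<longrightarrow> (\<forall>k. \<forall>\<alpha>\<in>Omega k. d (d \<alpha>) = 0))"
proof -
  interpret killing \<gamma> d\<^sub>0 a b c by unfold_locales (fact assms)+
  show ?thesis using hierarchy_exists hierarchy_square_zero by blast
qed

end
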